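(* Let $\Phi$ be an irreducible root system of rank $n$ with Weyl group $W$, and let $E_\Phi$ be the Euler characteristic of the complement $\mathcal{R}_\Phi$ of the toric arrangement defined by $\Phi$. Then $$E_\Phi=(-1)^n|W|.$$
   Context: Let $\mathfrak{g}$ be a simple Lie algebra of rank $n$ over $\mathbb{C}$, $\mathfrak{h}$ a Cartan subalgebra, $\Phi\subset\mathfrak{h}^*$ its irreducible root system with Weyl group $W$, $\Phi^\vee\subset\mathfrak{h}$ the coroots, $\langle\Phi^\vee\rangle$ the lattice they span, and $T=\mathfrak{h}/\langle\Phi^\vee\rangle$, a complex torus of rank $n$. Each root $\alpha$ takes integer values on $\langle\Phi^\vee\rangle$, hence induces a character $e^\alpha:T\to\mathbb{C}/\mathbb{Z}\simeq\mathbb{C}^*$; put $H_\alpha=\{t\in T:e^\alpha(t)=1\}$. The complement of the toric arrangement is $\mathcal{R}_\Phi=T\setminus\bigcup_{\alpha\in\Phi^+}H_\alpha$. *)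

theory Defs
  imports
    "HOL-Analysis.Analysis"
    "HOL-Homology.Homology"
    "HOL-Algebra.Bij"
    "HOL-Algebra.Generated_Groups"
    "HOL-Library.Extended_Nat"
begin

section \<open>Root systems and Weyl groups\<close>

text \<open>
  Reduced crystallographic root systems live in \<open>real ^ 'n\<close> with its standard inner product
  (every Euclidean space of dimension \<open>CARD('n)\<close> is isometric to this one).  Roots span the
  space, so the rank is \<open>CARD('n)\<close>.  The inner product is used to identify the space with its
  dual, so roots and coroots have the same type.
\<close>

definition coroot :: "real ^ 'n \<Rightarrow> real ^ 'n" where
  "coroot \<alpha> = (2 / (\<alpha> \<bullet> \<alpha>)) *\<^sub>R \<alpha>"

definition root_reflection :: "real ^ 'n \<Rightarrow> real ^ 'n \<Rightarrow> real ^ 'n" where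
  "root_reflection \<alpha> x = x - (x \<bullet> coroot \<alpha>) *\<^sub>R \<alpha>"

definition root_system :: "(real ^ 'n) set \<Rightarrow> bool" where
  "root_system \<Phi> \<longleftrightarrow>
     finite \<Phi> \<and> 0 \<notin> \<Phi> \<and> span \<Phi> = UNIV \<and>
     (\<forall>\<alpha>\<in>\<Phi>. \<forall>c. c *\<^sub>R \<alpha> \<in> \<Phi> \<longrightarrow> c = 1 \<or> c = -1) \<and>
     (\<forall>\<alpha>\<in>\<Phi>. root_reflection \<alpha> ` \<Phi> = \<Phi>) \<and>
     (\<forall>\<alpha>\<in>\<Phi>. \<forall>\<beta>\<in>\<Phi>. \<beta> \<bullet> coroot \<alpha> \<in> \<int>)"

definition irreducible_root_system :: "(real ^ 'n) set \<Rightarrow> bool" where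
  "irreducible_root_system \<Phi> \<longleftrightarrow>
     root_system \<Phi> \<and> \<Phi> \<noteq> {} \<and>
     \<not> (\<exists>A B. A \<noteq> {} \<and> B \<noteq> {} \<and> A \<union> B = \<Phi> \<and> A \<inter> B = {} \<and>
             (\<forall>\<alpha>\<in>A. \<forall>\<beta>\<in>B. \<alpha> \<bullet> \<beta> = 0))"

definition weyl_group :: "(real ^ 'n) set \<Rightarrow> (real ^ 'n \<Rightarrow> real ^ 'n) set" where
  "weyl_group \<Phi> = generate (BijGroup UNIV) (root_reflection ` \<Phi>)"

section \<open>The torus and the toric arrangement\<close>

text \<open>
  The Cartan subalgebra is \<open>complex ^ 'n\<close>, the complexification of \<open>real ^ 'n\<close>;
  \<open>root_functional \<alpha>\<close> is the complex-linear extension of \<open>\<lambda>x. \<alpha> \<bullet> x\<close>.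
\<close>

definition root_functional :: "real ^ 'n \<Rightarrow> complex ^ 'n \<Rightarrow> complex" where
  "root_functional \<alpha> z = (\<Sum>i\<in>UNIV. complex_of_real (\<alpha> $ i) * z $ i)"

definition complexify :: "real ^ 'n \<Rightarrow> complex ^ 'n" where
  "complexify x = (\<chi> i. complex_of_real (x $ i))"

definition coroot_lattice :: "(real ^ 'n) set \<Rightarrow> (complex ^ 'n) set" where
  "coroot_lattice \<Phi> =
     {complexify (\<Sum>\<alpha>\<in>\<Phi>. real_of_int (c \<alpha>) *\<^sub>R coroot \<alpha>) | c. True}"

definition torus_proj :: "(real ^ 'n) set \<Rightarrow> complex ^ 'n \<Rightarrow> (complex ^ 'n) set" where
  "torus_proj \<Phi> z = (\<lambda>l. z + l) ` coroot_lattice \<Phi>"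

definition torus :: "(real ^ 'n) set \<Rightarrow> (complex ^ 'n) set topology" where
  "torus \<Phi> =
     topology (\<lambda>U. U \<subseteq> range (torus_proj \<Phi>) \<and> open (torus_proj \<Phi> -` U))"

text \<open>
  For a root \<open>\<alpha>\<close> of \<open>\<Phi>\<close> and a coset \<open>t\<close> of the coroot lattice, the image below is a singleton
  (lemma \<open>root_character_torus_proj\<close>).  The identification of \<open>\<complex>/\<int>\<close> with the nonzero complex
  numbers is \<open>z \<mapsto> exp (2\<pi>iz)\<close>.
\<close>

definition root_character :: "real ^ 'n \<Rightarrow> (complex ^ 'n) set \<Rightarrow> complex" where
  "root_character \<alpha> t =
     the_elem ((\<lambda>z. exp (2 * of_real pi * \<i> * root_functional \<alpha> z)) ` t)"

definition root_hypersurface :: "(real ^ 'n) set \<Rightarrow> real ^ 'n \<Rightarrow> (complex ^ 'n) set set" where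
  "root_hypersurface \<Phi> \<alpha> = {t \<in> topspace (torus \<Phi>). root_character \<alpha> t = 1}"

text \<open>
  All roots are used instead of the positive ones only, which avoids choosing a positive system;
  lemma \<open>toric_complement_positive\<close> shows that this makes no difference.
\<close>

definition toric_complement :: "(real ^ 'n) set \<Rightarrow> (complex ^ 'n) set topology" where
  "toric_complement \<Phi> =
     subtopology (torus \<Phi>) (topspace (torus \<Phi>) - (\<Union>\<alpha>\<in>\<Phi>. root_hypersurface \<Phi> \<alpha>))"

section \<open>Euler characteristic\<close>

definition int_independent :: "('a, 'b) monoid_scheme \<Rightarrow> 'a set \<Rightarrow> bool" where
  "int_independent G S \<longleftrightarrow>
     finite S \<and> S \<subseteq> carrier G \<and>
     (\<forall>c :: 'a \<Rightarrow> int. (\<Otimes>\<^bsub>G\<^esub>x\<in>S. x [^]\<^bsub>G\<^esub> c x) = \<one>\<^bsub>G\<^esub> \<longrightarrow> (\<forall>x\<in>S. c x = 0))"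

definition abelian_rank :: "('a, 'b) monoid_scheme \<Rightarrow> enat" where
  "abelian_rank G = (SUP S \<in> {S. int_independent G S}. enat (card S))"

definition betti :: "nat \<Rightarrow> 'a topology \<Rightarrow> enat" where
  "betti p X = abelian_rank (homology_group (int p) X)"

definition finite_betti :: "'a topology \<Rightarrow> bool" where
  "finite_betti X \<longleftrightarrow> (\<forall>p. betti p X \<noteq> \<infinity>) \<and> finite {p. betti p X \<noteq> 0}"

text \<open>Meaningful only when \<open>finite_betti X\<close> holds.\<close>

definition euler_characteristic :: "'a topology \<Rightarrow> int" where
  "euler_characteristic X =
     (\<Sum>p | betti p X \<noteq> 0. (-1) ^ p * int (the_enat (betti p X)))"

section \<open>The definitions are well-behaved\<close>

lemma openin_torus:
  "openin (torus \<Phi>) U \<longleftrightarrow> U \<subseteq> range (torus_proj \<Phi>) \<and> open (torus_proj \<Phi> -` U)"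
proof -
  have "istopology (\<lambda>U. U \<subseteq> range (torus_proj \<Phi>) \<and> open (torus_proj \<Phi> -` U))"
    unfolding istopology_def by (auto simp: vimage_Union)
  then show ?thesis
    by (simp add: torus_def topology_inverse')
qed

lemma topspace_torus: "topspace (torus \<Phi>) = range (torus_proj \<Phi>)"
  unfolding topspace_def openin_torus
  by (auto intro!: exI[of _ "range (torus_proj \<Phi>)"] simp: vimage_def)

lemma quotient_map_torus_proj: "quotient_map euclidean (torus \<Phi>) (torus_proj \<Phi>)"
  by (auto simp: quotient_map_def topspace_torus openin_torus vimage_def)

lemma root_functional_add: "root_functional \<alpha> (x + y) = root_functional \<alpha> x + root_functional \<alpha> y"
  by (simp add: root_functional_def algebra_simps sum.distrib)

lemma root_functional_uminus: "root_functional (- \<alpha>) z = - root_functional \<alpha> z"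
  by (simp add: root_functional_def sum_negf)

lemma root_functional_complexify: "root_functional \<alpha> (complexify x) = of_real (\<alpha> \<bullet> x)"
  by (simp add: root_functional_def complexify_def inner_vec_def)

lemma root_functional_coroot_lattice:
  assumes "root_system \<Phi>" "\<alpha> \<in> \<Phi>" "l \<in> coroot_lattice \<Phi>"
  shows "root_functional \<alpha> l \<in> \<int>"
proof -
  obtain c where l: "l = complexify (\<Sum>\<beta>\<in>\<Phi>. real_of_int (c \<beta>) *\<^sub>R coroot \<beta>)"
    using assms(3) by (auto simp: coroot_lattice_def)
  have "(\<Sum>\<beta>\<in>\<Phi>. real_of_int (c \<beta>) * (\<alpha> \<bullet> coroot \<beta>)) \<in> \<int>"
    using assms(1,2) by (intro Ints_sum Ints_mult) (auto simp: root_system_def)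
  then obtain k where "(\<Sum>\<beta>\<in>\<Phi>. real_of_int (c \<beta>) * (\<alpha> \<bullet> coroot \<beta>)) = of_int k"
    by (auto elim: Ints_cases)
  then show ?thesis
    by (simp add: l root_functional_complexify inner_sum_right)
qed

lemma root_character_torus_proj:
  assumes "root_system \<Phi>" "\<alpha> \<in> \<Phi>"
  shows "root_character \<alpha> (torus_proj \<Phi> z) = exp (2 * of_real pi * \<i> * root_functional \<alpha> z)"
proof -
  let ?e = "\<lambda>z. exp (2 * of_real pi * \<i> * root_functional \<alpha> z)"
  have e: "?e (z + l) = ?e z" if l: "l \<in> coroot_lattice \<Phi>" for l
  proof -
    obtain k where "root_functional \<alpha> l = of_int k"
      using root_functional_coroot_lattice[OF assms l] by (auto elim: Ints_cases)
    moreover have "exp (2 * of_real pi * \<i> * of_int k) = (1 :: complex)"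
      using exp_integer_2pi[of "of_int k"] by (simp add: mult_ac)
    ultimately show ?thesis
      by (simp add: root_functional_add distrib_left exp_add)
  qed
  have "coroot_lattice \<Phi> \<noteq> {}"
    by (auto simp: coroot_lattice_def)
  with e have "?e ` torus_proj \<Phi> z = {?e z}"
    by (force simp: torus_proj_def image_image)
  then show ?thesis
    by (simp add: root_character_def)
qed

lemma uminus_root:
  assumes "root_system \<Phi>" "\<alpha> \<in> \<Phi>"
  shows "- \<alpha> \<in> \<Phi>"
proof -
  have "root_reflection \<alpha> \<alpha> \<in> \<Phi>" "\<alpha> \<noteq> 0"
    using assms unfolding root_system_def by blast+
  moreover from \<open>\<alpha> \<noteq> 0\<close> have "root_reflection \<alpha> \<alpha> = - \<alpha>"
    by (simp add: root_reflection_def coroot_def scaleR_2)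
  ultimately show ?thesis by simp
qed

lemma root_hypersurface_uminus:
  assumes "root_system \<Phi>" "\<alpha> \<in> \<Phi>"
  shows "root_hypersurface \<Phi> (- \<alpha>) = root_hypersurface \<Phi> \<alpha>"
  using assms
  by (auto simp: root_hypersurface_def topspace_torus root_character_torus_proj uminus_root
      root_functional_uminus exp_minus)

lemma toric_complement_positive:
  assumes "root_system \<Phi>" "\<And>\<alpha>. \<alpha> \<in> \<Phi> \<Longrightarrow> v \<bullet> \<alpha> \<noteq> 0"
  shows "toric_complement \<Phi> =
    subtopology (torus \<Phi>)
      (topspace (torus \<Phi>) - (\<Union>\<alpha>\<in>{\<alpha> \<in> \<Phi>. v \<bullet> \<alpha> > 0}. root_hypersurface \<Phi> \<alpha>))"
proof -
  have "root_hypersurface \<Phi> \<alpha> \<subseteq> (\<Union>\<alpha>\<in>{\<alpha> \<in> \<Phi>. v \<bullet> \<alpha> > 0}. root_hypersurface \<Phi> \<alpha>)"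
    if "\<alpha> \<in> \<Phi>" for \<alpha>
  proof (cases "v \<bullet> \<alpha> > 0")
    case True
    then show ?thesis using that by blast
  next
    case False
    then have "v \<bullet> (- \<alpha>) > 0" using assms(2)[OF that] by simp
    then show ?thesis
      using uminus_root[OF assms(1) that] root_hypersurface_uminus[OF assms(1) that] by blast
  qed
  then have "(\<Union>\<alpha>\<in>\<Phi>. root_hypersurface \<Phi> \<alpha>)
      = (\<Union>\<alpha>\<in>{\<alpha> \<in> \<Phi>. v \<bullet> \<alpha> > 0}. root_hypersurface \<Phi> \<alpha>)"
    by blast
  then show ?thesis
    by (simp add: toric_complement_def)
qed

end

theory Submission
  imports Defs
begin

text \<open>
  Write a point of \<open>\<complex>\<^sup>n\<close> as \<open>x + iy\<close>.  It lies on a hypersurface of the arrangement iff some root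
  \<open>\<alpha>\<close> satisfies both \<open>\<alpha>(y) = 0\<close> and \<open>\<alpha>(x) \<in> \<int>\<close>.  Project the complement to \<open>y\<close>.  The fibre over \<open>y\<close>
  consists of the \<open>x\<close> in the compact torus \<open>\<real>\<^sup>n / L\<close>, with \<open>L\<close> the lattice of the coroots, at which no
  root vanishing at \<open>y\<close> is an integer.

  If \<open>y \<noteq> 0\<close>, the fibre is invariant under a positive-dimensional subtorus, as some nonzero vector of
  \<open>L\<close> is annihilated by all roots that vanish at \<open>y\<close> (\<open>lattice_rational\<close>).  So it has Euler
  characteristic \<open>0\<close>, and by additivity so does the part of the complement over \<open>y \<noteq> 0\<close>
  (\<open>euler_stratum_zero\<close>).  Over \<open>y = 0\<close> the fibre is a disjoint union of alcoves, one for each element of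
  the Weyl group, because the affine Weyl group \<open>W \<ltimes> L\<close> acts simply transitively on the alcoves of
  \<open>\<real>\<^sup>n\<close> (\<open>alcove_transitive\<close>, \<open>alcove_free\<close>).  Each alcove \<open>D\<close> adds the contractible set
  \<open>D \<times> \<real>\<^sup>n\<close> along its intersection \<open>D \<times> (\<real>\<^sup>n - 0)\<close> with the part over \<open>y \<noteq> 0\<close>, which is a sphere up to
  homotopy; this contributes \<open>1 - (1 - (-1)\<^sup>n) = (-1)\<^sup>n\<close> (\<open>euler_complement\<close>).

  The topological input is small.  The open sets in question are built from convex ones, so it
  suffices to know that Euler characteristics are additive for open unions (\<open>has_euler_char_Un\<close>)
  and that contractible spaces have Euler characteristic \<open>1\<close>.  Additivity comes from the long exact
  sequences of pairs and excision, once ranks of abelian groups are known to be additive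
  (\<open>rank_nullity\<close>).  The simple transitivity on alcoves is proved with the classical argument on
  words in the reflections at the walls of one alcove.
\<close>

section \<open>Ranks of abelian groups\<close>

text \<open>
  Families rather than sets: the image of an independent set under a homomorphism can then be
  tested for independence before the homomorphism is known to be injective on it.
\<close>
definition independent_family :: "('a, 'b) monoid_scheme \<Rightarrow> ('i \<Rightarrow> 'a) \<Rightarrow> 'i set \<Rightarrow> bool" where
  "independent_family G v I \<longleftrightarrow>
     finite I \<and> v ` I \<subseteq> carrier G \<and>
     (\<forall>c :: 'i \<Rightarrow> int. (\<Otimes>\<^bsub>G\<^esub>i\<in>I. v i [^]\<^bsub>G\<^esub> c i) = \<one>\<^bsub>G\<^esub> \<longrightarrow> (\<forall>i\<in>I. c i = 0))"

text \<open>
  The rank of an arbitrary subset.  Kernels and images are measured with it inside their ambient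
  groups, so that no group structure has to be put on them.
\<close>
definition rank_in :: "('a, 'b) monoid_scheme \<Rightarrow> 'a set \<Rightarrow> enat" where
  "rank_in G K = (SUP S \<in> {S. int_independent G S \<and> S \<subseteq> K}. enat (card S))"

lemma abelian_rank_eq_rank_in: "abelian_rank G = rank_in G (carrier G)"
  unfolding abelian_rank_def rank_in_def
  by (rule arg_cong[where f = Sup]) (auto simp: int_independent_def)

lemma int_independent_iff: "int_independent G S \<longleftrightarrow> independent_family G (\<lambda>x. x) S"
  by (auto simp: int_independent_def independent_family_def)

lemma int_independentD:
  fixes c :: "'a \<Rightarrow> int"
  assumes "int_independent G S" "(\<Otimes>\<^bsub>G\<^esub>x\<in>S. x [^]\<^bsub>G\<^esub> c x) = \<one>\<^bsub>G\<^esub>" "x \<in> S"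
  shows "c x = 0"
  using assms by (auto simp: int_independent_def)

lemma independent_familyD:
  fixes c :: "'i \<Rightarrow> int"
  assumes "independent_family G v I" "(\<Otimes>\<^bsub>G\<^esub>i\<in>I. v i [^]\<^bsub>G\<^esub> c i) = \<one>\<^bsub>G\<^esub>" "i \<in> I"
  shows "c i = 0"
  using assms by (auto simp: independent_family_def)

context comm_group
begin

lemma finprod_int_pow:
  assumes "finite S" "v ` S \<subseteq> carrier G"
  shows "(\<Otimes>i\<in>S. v i [^] (c i :: int)) [^] (d :: int) = (\<Otimes>i\<in>S. v i [^] (c i * d))"
  using assms
proof (induction S)
  case (insert x F)
  have "(\<Otimes>i\<in>F. v i [^] c i) \<in> carrier G"
    using insert by (intro finprod_closed) auto
  then show ?case using insert
    by (simp add: Pi_iff image_subset_iff int_pow_distrib int_pow_pow)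
qed auto

lemma finprod_int_pow_add:
  assumes "finite S" "v ` S \<subseteq> carrier G"
  shows "(\<Otimes>i\<in>S. v i [^] (c i :: int)) \<otimes> (\<Otimes>i\<in>S. v i [^] (d i :: int)) = (\<Otimes>i\<in>S. v i [^] (c i + d i))"
proof -
  have "(\<Otimes>i\<in>S. v i [^] (c i + d i)) = (\<Otimes>i\<in>S. v i [^] c i \<otimes> v i [^] d i)"
    using assms by (intro finprod_cong') (auto simp: int_pow_mult)
  also have "\<dots> = (\<Otimes>i\<in>S. v i [^] c i) \<otimes> (\<Otimes>i\<in>S. v i [^] d i)"
    using assms by (intro finprod_multf) auto
  finally show ?thesis by simp
qed

lemma finprod_int_pow_sum:
  assumes "finite A" "finite S" "v ` S \<subseteq> carrier G"
  shows "(\<Otimes>a\<in>A. (\<Otimes>i\<in>S. v i [^] (c a i :: int)) [^] (d a :: int))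
       = (\<Otimes>i\<in>S. v i [^] (\<Sum>a\<in>A. c a i * d a))"
  using assms(1)
proof (induction A)
  case empty
  then show ?case by simp
next
  case (insert a A)
  have cl: "(\<Otimes>i\<in>S. v i [^] (c a i :: int)) \<in> carrier G" for a
    using assms by (intro finprod_closed) auto
  show ?case
    using insert cl assms
    by (simp add: Pi_iff image_subset_iff finprod_int_pow finprod_int_pow_add)
qed

lemma independent_family_subset:
  fixes v :: "'i \<Rightarrow> 'a"
  assumes "independent_family G v J" "I \<subseteq> J"
  shows "independent_family G v I"
  unfolding independent_family_def
proof (intro conjI allI impI)
  show fin: "finite I" using assms finite_subset by (auto simp: independent_family_def)
  show cl: "v ` I \<subseteq> carrier G" using assms by (auto simp: independent_family_def)
  fix c :: "'i \<Rightarrow> int" assume *: "(\<Otimes>i\<in>I. v i [^] c i) = \<one>"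
  let ?c = "\<lambda>i. if i \<in> I then c i else 0"
  have "(\<Otimes>i\<in>J. v i [^] ?c i) = (\<Otimes>i\<in>I. v i [^] c i)"
    using assms by (intro finprod_mono_neutral_cong_right) (auto simp: independent_family_def)
  with * have "?c i = 0" if "i \<in> J" for i
    using independent_familyD[OF assms(1), where c = ?c] that by simp
  then show "\<forall>i\<in>I. c i = 0" using assms(2) by (metis subsetD)
qed

text \<open>
  An element that destroys independence has a nonzero multiple in the span of the others.  This is
  all that remains of linear dependence over \<open>\<int>\<close>, where coefficients cannot be divided out.
\<close>
lemma independent_family_insert:
  fixes v :: "'i \<Rightarrow> 'a"
  assumes "independent_family G v J" "v s \<in> carrier G" "s \<notin> J" "\<not> independent_family G v (insert s J)"
  shows "\<exists>c :: _ \<Rightarrow> int. c s \<noteq> 0 \<and> (\<forall>i. i \<notin> insert s J \<longrightarrow> c i = 0) \<and> (\<Otimes>i\<in>insert s J. v i [^] c i) = \<one>"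
proof -
  obtain c :: "_ \<Rightarrow> int" where c: "(\<Otimes>i\<in>insert s J. v i [^] c i) = \<one>" "\<exists>i\<in>insert s J. c i \<noteq> 0"
    using assms unfolding independent_family_def by auto
  have cl: "v ` J \<subseteq> carrier G" "finite J" using assms by (auto simp: independent_family_def)
  have "c s \<noteq> 0"
  proof
    assume "c s = 0"
    then have "(\<Otimes>i\<in>J. v i [^] c i) = \<one>"
      using c(1) cl assms(2,3) by (simp add: Pi_iff image_subset_iff)
    then have "\<forall>i\<in>J. c i = 0" using assms(1) by (auto simp: independent_family_def)
    then show False using c(2) \<open>c s = 0\<close> by auto
  qed
  moreover let ?c = "\<lambda>i. if i \<in> insert s J then c i else 0"
  have "(\<Otimes>i\<in>insert s J. v i [^] ?c i) = (\<Otimes>i\<in>insert s J. v i [^] c i)"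
    using cl assms(2) by (intro finprod_cong') auto
  ultimately show ?thesis using c(1) by (intro exI[of _ ?c]) auto
qed

lemma independent_family_image:
  assumes "independent_family G v I"
  shows "inj_on v I" "int_independent G (v ` I)"
proof -
  have fin: "finite I" and cl: "v ` I \<subseteq> carrier G"
    and ind: "\<And>c :: _ \<Rightarrow> int. (\<Otimes>i\<in>I. v i [^] c i) = \<one> \<Longrightarrow> \<forall>i\<in>I. c i = 0"
    using assms by (auto simp: independent_family_def)
  show inj: "inj_on v I"
  proof (rule inj_onI, rule ccontr)
    fix i j assume ij: "i \<in> I" "j \<in> I" "v i = v j" "i \<noteq> j"
    let ?c = "\<lambda>k. if k = i then 1 else if k = j then -1 else (0::int)"
    have eq: "I = insert i (insert j (I - {i,j}))" using ij by auto
    have rest: "(\<Otimes>k\<in>I - {i,j}. v k [^] ?c k) = \<one>"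
      by (rule finprod_one_eqI) auto
    have cl': "v k [^] ?c k \<in> carrier G" if "k \<in> I" for k using cl that by auto
    have "(\<Otimes>k\<in>insert j (I - {i,j}). v k [^] ?c k) = inv (v j)"
      using finprod_insert[of "I - {i,j}" j "\<lambda>k. v k [^] ?c k"] fin cl ij rest cl'
      by (auto simp: int_pow_neg image_subset_iff Pi_iff)
    then have "(\<Otimes>k\<in>insert i (insert j (I - {i,j})). v k [^] ?c k) = \<one>"
      using finprod_insert[of "insert j (I - {i,j})" i "\<lambda>k. v k [^] ?c k"] fin cl ij cl'
      by (auto simp: image_subset_iff Pi_iff)
    then have "(\<Otimes>k\<in>I. v k [^] ?c k) = \<one>" by (simp flip: eq)
    from independent_familyD[OF assms this \<open>i \<in> I\<close>] show False by simp
  qed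
  show "int_independent G (v ` I)"
    unfolding int_independent_def
  proof (intro conjI allI impI)
    fix c :: "'a \<Rightarrow> int" assume *: "(\<Otimes>x\<in>v ` I. x [^] c x) = \<one>"
    have "(\<Otimes>x\<in>v ` I. x [^] c x) = (\<Otimes>i\<in>I. v i [^] c (v i))"
      using inj cl by (intro finprod_reindex) auto
    with * ind[of "\<lambda>i. c (v i)"] show "\<forall>x\<in>v ` I. c x = 0" by auto
  qed (use fin cl in auto)
qed

text \<open>
  Subsets of independent sets are independent, so every size up to the supremum is attained.
\<close>
lemma enat_le_rank_in_iff:
  "enat n \<le> rank_in G K \<longleftrightarrow> (\<exists>S. int_independent G S \<and> S \<subseteq> K \<and> card S = n)"
proof
  assume "\<exists>S. int_independent G S \<and> S \<subseteq> K \<and> card S = n"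
  then show "enat n \<le> rank_in G K"
    unfolding rank_in_def by (auto intro!: SUP_upper2)
next
  assume le: "enat n \<le> rank_in G K"
  have "\<exists>S. int_independent G S \<and> S \<subseteq> K \<and> n \<le> card S"
  proof (rule ccontr)
    assume no: "\<not> ?thesis"
    have emp: "int_independent G {}" by (simp add: int_independent_def)
    with no have "n \<noteq> 0" by (metis empty_subsetI le0)
    have "rank_in G K \<le> enat (n - 1)"
      unfolding rank_in_def
    proof (rule SUP_least)
      fix S assume "S \<in> {S. int_independent G S \<and> S \<subseteq> K}"
      with no have "\<not> n \<le> card S" by blast
      then show "enat (card S) \<le> enat (n - 1)" by simp
    qed
    with le have "enat n \<le> enat (n - 1)" by (rule order_trans)
    with \<open>n \<noteq> 0\<close> show False by simp
  qed
  then obtain S where S: "int_independent G S" "S \<subseteq> K" "n \<le> card S" by auto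
  then obtain T where T: "T \<subseteq> S" "card T = n" by (meson obtain_subset_with_card_n)
  then have "int_independent G T"
    using S independent_family_subset by (auto simp: int_independent_iff)
  with T S show "\<exists>S. int_independent G S \<and> S \<subseteq> K \<and> card S = n" by blast
qed

end

lemma hom_finprod_int_pow:
  assumes "comm_group G" "comm_group H" "f \<in> hom G H" "finite S" "v ` S \<subseteq> carrier G"
  shows "f (\<Otimes>\<^bsub>G\<^esub>i\<in>S. v i [^]\<^bsub>G\<^esub> (c i :: int)) = (\<Otimes>\<^bsub>H\<^esub>i\<in>S. f (v i) [^]\<^bsub>H\<^esub> c i)"
proof -
  interpret G: comm_group G by fact
  interpret H: comm_group H by fact
  have hc: "f x \<in> carrier H" if "x \<in> carrier G" for x using assms(3) that by (auto simp: hom_def)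
  show ?thesis
    using assms(4,5)
  proof (induction S)
    case empty
    then show ?case
      using assms(3) by (simp add: hom_one[OF _ G.is_group H.is_group])
  next
    case (insert x F)
    have "(\<Otimes>\<^bsub>G\<^esub>i\<in>F. v i [^]\<^bsub>G\<^esub> c i) \<in> carrier G"
      using insert by (intro G.finprod_closed) auto
    then show ?case
      using insert hc
      by (simp add: Pi_def image_subset_iff hom_mult[OF assms(3)]
          hom_int_pow[OF assms(3) _ G.is_group H.is_group])
  qed
qed

text \<open>
  Lift the independent elements of the image.  A relation among the lifts and elements of the
  kernel maps to a relation in the image, which kills the coefficients of the lifts; what is left
  is a relation in the kernel.
\<close>
lemma rank_nullity_ge:
  assumes G: "comm_group G" and H: "comm_group H" and f: "f \<in> hom G H"
    and S: "int_independent G S" "S \<subseteq> kernel G H f" and T: "int_independent H T" "T \<subseteq> f ` carrier G"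
  shows "\<exists>U. int_independent G U \<and> card U = card S + card T"
proof -
  interpret G: comm_group G by fact
  interpret H: comm_group H by fact
  define g where "g = inv_into (carrier G) f"
  have g: "g t \<in> carrier G" "f (g t) = t" if "t \<in> T" for t
    using T(2) that by (auto simp: g_def inv_into_into f_inv_into_f subset_iff)
  have inj: "inj_on g T" by (metis g(2) inj_onI)
  have fin: "finite S" "finite T" and SG: "S \<subseteq> carrier G" and TH: "\<And>t. t \<in> T \<Longrightarrow> t \<in> carrier H"
    using S(1) T(1) by (auto simp: int_independent_def)
  have one: "\<one>\<^bsub>H\<^esub> \<notin> T"
  proof
    assume "\<one>\<^bsub>H\<^esub> \<in> T"
    let ?c = "\<lambda>x. if x = \<one>\<^bsub>H\<^esub> then 1 else (0::int)"
    have "(\<Otimes>\<^bsub>H\<^esub>x\<in>T. x [^]\<^bsub>H\<^esub> ?c x) = \<one>\<^bsub>H\<^esub>"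
      by (rule H.finprod_one_eqI) auto
    from int_independentD[OF T(1) this] have "?c \<one>\<^bsub>H\<^esub> = 0" using \<open>\<one>\<^bsub>H\<^esub> \<in> T\<close> .
    with \<open>\<one>\<^bsub>H\<^esub> \<in> T\<close> show False by auto
  qed
  have fS: "f x = \<one>\<^bsub>H\<^esub>" if "x \<in> S" for x using S(2) that by (auto simp: kernel_def)
  have disj: "S \<inter> g ` T = {}" using one fS g by fastforce
  have "int_independent G (S \<union> g ` T)"
    unfolding int_independent_def
  proof (intro conjI allI impI)
    show "S \<union> g ` T \<subseteq> carrier G" using SG g by auto
    fix c :: "_ \<Rightarrow> int"
    assume *: "(\<Otimes>\<^bsub>G\<^esub>x\<in>S \<union> g ` T. x [^]\<^bsub>G\<^esub> c x) = \<one>\<^bsub>G\<^esub>"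
    have "f (\<Otimes>\<^bsub>G\<^esub>x\<in>S \<union> g ` T. x [^]\<^bsub>G\<^esub> c x) = (\<Otimes>\<^bsub>H\<^esub>x\<in>S \<union> g ` T. f x [^]\<^bsub>H\<^esub> c x)"
      using hom_finprod_int_pow[OF G H f, of "S \<union> g ` T" "\<lambda>x. x" c] fin SG g by auto
    also have "\<dots> = (\<Otimes>\<^bsub>H\<^esub>x\<in>g ` T. f x [^]\<^bsub>H\<^esub> c x)"
      using fin fS g TH by (intro H.finprod_mono_neutral_cong_right) auto
    also have "\<dots> = (\<Otimes>\<^bsub>H\<^esub>t\<in>T. f (g t) [^]\<^bsub>H\<^esub> c (g t))"
    proof (rule H.finprod_reindex)
      show "(\<lambda>x. f x [^]\<^bsub>H\<^esub> c x) \<in> g ` T \<rightarrow> carrier H"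
        using g TH by (auto intro!: H.int_pow_closed)
    qed (rule inj)
    also have "\<dots> = (\<Otimes>\<^bsub>H\<^esub>t\<in>T. t [^]\<^bsub>H\<^esub> c (g t))"
      using g TH by (intro H.finprod_cong') (auto intro!: H.int_pow_closed)
    finally have "(\<Otimes>\<^bsub>H\<^esub>t\<in>T. t [^]\<^bsub>H\<^esub> c (g t)) = \<one>\<^bsub>H\<^esub>"
      using * hom_one[OF f G.is_group H.is_group] by simp
    then have c0: "\<forall>t\<in>T. c (g t) = 0"
      using T(1) unfolding int_independent_def by (auto dest!: spec[of _ "\<lambda>t. c (g t)"])
    have "(\<Otimes>\<^bsub>G\<^esub>x\<in>S \<union> g ` T. x [^]\<^bsub>G\<^esub> c x) = (\<Otimes>\<^bsub>G\<^esub>x\<in>S. x [^]\<^bsub>G\<^esub> c x)"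
      using fin c0 g SG by (intro G.finprod_mono_neutral_cong_right) auto
    with * S(1) have "\<forall>x\<in>S. c x = 0" by (auto simp: int_independent_def)
    with c0 show "\<forall>x\<in>S \<union> g ` T. c x = 0" by auto
  qed (use fin in auto)
  moreover have "card (S \<union> g ` T) = card S + card T"
    using fin disj inj by (simp add: card_Un_disjoint card_image)
  ultimately show ?thesis by blast
qed

text \<open>
  Take \<open>T \<subseteq> U\<close> maximal with independent image.  By maximality each remaining \<open>s \<in> U\<close> has a
  nonzero multiple that agrees in \<open>H\<close> with a combination of \<open>T\<close>, and the difference \<open>u s\<close> lies in
  the kernel.  The \<open>u s\<close> are independent because \<open>s\<close> occurs in \<open>u s\<close>, with nonzero
  coefficient, and in no other one.
\<close>
lemma rank_nullity_le:
  assumes G: "comm_group G" and H: "comm_group H" and f: "f \<in> hom G H"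
    and U: "int_independent G U"
  shows "\<exists>S T. int_independent G S \<and> S \<subseteq> kernel G H f \<and> int_independent H T \<and> T \<subseteq> f ` carrier G
             \<and> card U = card S + card T"
proof -
  interpret G: comm_group G by fact
  interpret H: comm_group H by fact
  have fin: "finite U" and cl: "U \<subseteq> carrier G" using U by (auto simp: int_independent_def)
  have hc: "f x \<in> carrier H" if "x \<in> carrier G" for x using f that by (auto simp: hom_def)
  define P where "P = (\<lambda>T. T \<subseteq> U \<and> independent_family H f T)"
  have "P {}" by (auto simp: P_def independent_family_def)
  moreover have "\<And>T. P T \<Longrightarrow> card T \<le> card U" using fin by (auto simp: P_def card_mono)
  ultimately obtain T where T: "P T" and mx: "\<And>T'. P T' \<Longrightarrow> card T' \<le> card T"
    using ex_has_greatest_nat[of P "{}" card "Suc (card U)"] by (metis less_Suc_eq_le)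
  have TU: "T \<subseteq> U" and Ti: "independent_family H f T" using T by (auto simp: P_def)
  have "\<exists>c :: _ \<Rightarrow> int. c s \<noteq> 0 \<and> (\<forall>i. i \<notin> insert s T \<longrightarrow> c i = 0) \<and>
          (\<Otimes>\<^bsub>H\<^esub>i\<in>insert s T. f i [^]\<^bsub>H\<^esub> c i) = \<one>\<^bsub>H\<^esub>" if s: "s \<in> U - T" for s
  proof (rule H.independent_family_insert[OF Ti])
    show "\<not> independent_family H f (insert s T)"
    proof
      assume "independent_family H f (insert s T)"
      then have "card (insert s T) \<le> card T" using mx[of "insert s T"] s TU by (auto simp: P_def)
      then show False using s TU fin by (auto simp: card_insert_if finite_subset)
    qed
  qed (use s cl hc in auto)
  then obtain c :: "_ \<Rightarrow> _ \<Rightarrow> int" where c: "\<And>s. s \<in> U - T \<Longrightarrow> c s s \<noteq> 0"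
      "\<And>s i. s \<in> U - T \<Longrightarrow> i \<notin> insert s T \<Longrightarrow> c s i = 0"
      "\<And>s. s \<in> U - T \<Longrightarrow> (\<Otimes>\<^bsub>H\<^esub>i\<in>insert s T. f i [^]\<^bsub>H\<^esub> c s i) = \<one>\<^bsub>H\<^esub>"
    by metis
  define u where "u = (\<lambda>s. (\<Otimes>\<^bsub>G\<^esub>i\<in>U. i [^]\<^bsub>G\<^esub> c s i))"
  have ucl: "u s \<in> carrier G" for s unfolding u_def using cl by (intro G.finprod_closed) auto
  have ker: "u s \<in> kernel G H f" if s: "s \<in> U - T" for s
  proof -
    have "f (u s) = (\<Otimes>\<^bsub>H\<^esub>i\<in>U. f i [^]\<^bsub>H\<^esub> c s i)"
      unfolding u_def using hom_finprod_int_pow[OF G H f fin, of "\<lambda>x. x"] cl by auto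
    also have "\<dots> = (\<Otimes>\<^bsub>H\<^esub>i\<in>insert s T. f i [^]\<^bsub>H\<^esub> c s i)"
      using fin s TU c(2)[OF s] cl hc by (intro H.finprod_mono_neutral_cong_right) (auto simp: subset_iff)
    finally show ?thesis using c(3)[OF s] ucl by (simp add: kernel_def)
  qed
  have uind: "independent_family G u (U - T)"
    unfolding independent_family_def
  proof (intro conjI allI impI ballI)
    fix d :: "_ \<Rightarrow> int" and s
    assume *: "(\<Otimes>\<^bsub>G\<^esub>s\<in>U - T. u s [^]\<^bsub>G\<^esub> d s) = \<one>\<^bsub>G\<^esub>" and s: "s \<in> U - T"
    have "(\<Otimes>\<^bsub>G\<^esub>s\<in>U - T. u s [^]\<^bsub>G\<^esub> d s) = (\<Otimes>\<^bsub>G\<^esub>i\<in>U. i [^]\<^bsub>G\<^esub> (\<Sum>s\<in>U - T. c s i * d s))"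
      unfolding u_def using fin cl by (intro G.finprod_int_pow_sum) auto
    with * U have "\<forall>i\<in>U. (\<Sum>s\<in>U - T. c s i * d s) = 0" by (auto simp: int_independent_def)
    then have "(\<Sum>r\<in>U - T. c r s * d r) = 0" using s by auto
    moreover have "(\<Sum>r\<in>U - T. c r s * d r) = (\<Sum>r\<in>{s}. c r s * d r)"
      using s c(2) fin by (intro sum.mono_neutral_right) auto
    ultimately show "d s = 0" using c(1)[OF s] by simp
  qed (use fin ucl in auto)
  have "int_independent G (u ` (U - T))" "card (u ` (U - T)) = card (U - T)"
    using G.independent_family_image[OF uind] by (auto simp: card_image)
  moreover have "int_independent H (f ` T)" "card (f ` T) = card T"
    using H.independent_family_image[OF Ti] by (auto simp: card_image)
  moreover have "card U = card (U - T) + card T"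
    using TU fin by (simp add: card_Diff_subset finite_subset card_mono)
  moreover have "f ` T \<subseteq> f ` carrier G" "u ` (U - T) \<subseteq> kernel G H f" using TU cl ker by auto
  ultimately show ?thesis by metis
qed

lemma enat_eqI_le:
  assumes "\<And>n. enat n \<le> x \<longleftrightarrow> enat n \<le> y" shows "x = y"
proof (rule antisym)
  have *: "x \<le> y" if "\<And>n. enat n \<le> x \<Longrightarrow> enat n \<le> y" for x y :: enat
  proof (cases x)
    case (enat n) then show ?thesis using that by auto
  next
    case infinity then show ?thesis using that[of "Suc (the_enat y)"] that by (cases y) auto
  qed
  show "x \<le> y" by (rule *) (use assms in blast)
  show "y \<le> x" by (rule *) (use assms in blast)
qed

lemma enat_le_add_iff: "enat n \<le> x + y \<longleftrightarrow> (\<exists>a b. n = a + b \<and> enat a \<le> x \<and> enat b \<le> y)"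
proof
  assume "enat n \<le> x + y"
  show "\<exists>a b. n = a + b \<and> enat a \<le> x \<and> enat b \<le> y"
  proof (cases x)
    case (enat m)
    then show ?thesis
    proof (cases "n \<le> m")
      case True then show ?thesis using enat by (intro exI[of _ n] exI[of _ 0]) (auto simp: zero_enat_def[symmetric])
    next
      case False
      with enat \<open>enat n \<le> x + y\<close> show ?thesis
        by (intro exI[of _ m] exI[of _ "n - m"]) (cases y; auto)
    qed
  next
    case infinity
    then show ?thesis by (intro exI[of _ n] exI[of _ 0]) (auto simp: zero_enat_def[symmetric])
  qed
next
  assume "\<exists>a b. n = a + b \<and> enat a \<le> x \<and> enat b \<le> y"
  then obtain a b where "n = a + b" "enat a \<le> x" "enat b \<le> y" by blast
  then show "enat n \<le> x + y" by (metis add_mono plus_enat_simps(1))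
qed

theorem rank_nullity:
  assumes G: "comm_group G" and H: "comm_group H" and f: "f \<in> hom G H"
  shows "abelian_rank G = rank_in G (kernel G H f) + rank_in H (f ` carrier G)"
proof (rule enat_eqI_le)
  fix n
  have sub: "int_independent G S \<Longrightarrow> S \<subseteq> carrier G" for S by (auto simp: int_independent_def)
  show "enat n \<le> abelian_rank G \<longleftrightarrow> enat n \<le> rank_in G (kernel G H f) + rank_in H (f ` carrier G)"
    unfolding abelian_rank_eq_rank_in enat_le_add_iff
      comm_group.enat_le_rank_in_iff[OF G] comm_group.enat_le_rank_in_iff[OF H]
  proof
    assume "\<exists>S. int_independent G S \<and> S \<subseteq> carrier G \<and> card S = n"
    then obtain U where "int_independent G U" "card U = n" by auto
    with rank_nullity_le[OF G H f] show "\<exists>a b. n = a + b \<and>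
       (\<exists>S. int_independent G S \<and> S \<subseteq> kernel G H f \<and> card S = a) \<and>
       (\<exists>S. int_independent H S \<and> S \<subseteq> f ` carrier G \<and> card S = b)" by metis
  next
    assume "\<exists>a b. n = a + b \<and>
       (\<exists>S. int_independent G S \<and> S \<subseteq> kernel G H f \<and> card S = a) \<and>
       (\<exists>S. int_independent H S \<and> S \<subseteq> f ` carrier G \<and> card S = b)"
    with rank_nullity_ge[OF G H f] sub show "\<exists>S. int_independent G S \<and> S \<subseteq> carrier G \<and> card S = n"
      by metis
  qed
qed

lemma rank_in_trivial:
  assumes "comm_group G" shows "rank_in G {\<one>\<^bsub>G\<^esub>} = 0"
proof -
  interpret comm_group G by fact
  have "\<not> enat 1 \<le> rank_in G {\<one>\<^bsub>G\<^esub>}"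
  proof
    assume "enat 1 \<le> rank_in G {\<one>\<^bsub>G\<^esub>}"
    then obtain S where "int_independent G S" "S \<subseteq> {\<one>\<^bsub>G\<^esub>}" "card S = 1" by (auto simp: enat_le_rank_in_iff)
    then have "int_independent G {\<one>\<^bsub>G\<^esub>}" by (metis card.empty subset_singletonD zero_neq_one)
    then show False using int_independentD[of G "{\<one>\<^bsub>G\<^esub>}" "\<lambda>_. 1" "\<one>\<^bsub>G\<^esub>"] by simp
  qed
  then show ?thesis by (cases "rank_in G {\<one>\<^bsub>G\<^esub>}") (auto simp: zero_enat_def)
qed

lemma abelian_rank_trivial_group:
  assumes "comm_group G" "trivial_group G"
  shows "abelian_rank G = 0"
  using assms rank_in_trivial[of G] by (auto simp: abelian_rank_eq_rank_in trivial_group_def)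

lemma abelian_rank_iso:
  assumes G: "comm_group G" and H: "comm_group H" and "G \<cong> H"
  shows "abelian_rank G = abelian_rank H"
proof -
  obtain f where f: "f \<in> iso G H" using assms(3) by (auto simp: is_iso_def)
  then have hom: "f \<in> hom G H" and bij: "bij_betw f (carrier G) (carrier H)" by (auto simp: iso_def)
  have gh: "group_hom G H f"
    using G H hom by (simp add: group_hom_def group_hom_axioms_def comm_group.axioms(2))
  then have "kernel G H f = {\<one>\<^bsub>G\<^esub>}"
    using bij by (metis bij_betw_def group_hom.inj_iff_trivial_ker)
  with rank_nullity[OF G H hom] bij show ?thesis
    by (simp add: rank_in_trivial[OF G] abelian_rank_eq_rank_in[of H] bij_betw_def)
qed

lemma finprod_integer_group:
  "finite S \<Longrightarrow> finprod integer_group f S = sum f S"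
proof (induction S rule: finite_induct)
  case empty
  then show ?case using comm_monoid.finprod_empty[of integer_group] abelian_integer_group comm_group_def by (metis one_integer_group sum.empty)
next
  case (insert x F)
  have "comm_monoid integer_group" using abelian_integer_group comm_group_def by blast
  then show ?case using insert by (subst comm_monoid.finprod_insert) auto
qed

lemma abelian_rank_integer_group: "abelian_rank integer_group = 1"
proof -
  have c: "comm_group integer_group" by (rule abelian_integer_group)
  have "int_independent integer_group {1}"
    by (auto simp: int_independent_def finprod_integer_group)
  then have "enat 1 \<le> abelian_rank integer_group"
    unfolding abelian_rank_eq_rank_in comm_group.enat_le_rank_in_iff[OF c] by (intro exI[of _ "{1}"]) auto
  moreover have "\<not> enat 2 \<le> abelian_rank integer_group"
  proof
    assume "enat 2 \<le> abelian_rank integer_group"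
    then obtain S where S: "int_independent integer_group S" "card S = 2"
      unfolding abelian_rank_eq_rank_in comm_group.enat_le_rank_in_iff[OF c] by auto
    then obtain a b where ab: "S = {a, b}" "a \<noteq> b" by (meson card_2_iff)
    let ?c = "\<lambda>x. if x = a then b else - a"
    have "(\<Otimes>\<^bsub>integer_group\<^esub>x\<in>S. x [^]\<^bsub>integer_group\<^esub> ?c x) = \<one>\<^bsub>integer_group\<^esub>"
      using ab by (auto simp: finprod_integer_group)
    from int_independentD[OF S(1) this] have "?c a = 0" "?c b = 0" using ab(1) by blast+
    with ab(2) have "b = 0" "a = 0" by auto
    with ab show False by simp
  qed
  ultimately show ?thesis
    by (cases "abelian_rank integer_group") (auto simp: one_enat_def not_le)
qed

section \<open>Additivity of the Euler characteristic\<close>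

text \<open>
  Degrees range over all integers, so that long exact sequences need no exception in degree \<open>0\<close>;
  the bound \<open>N\<close> replaces the sum over the nonzero terms by a sum over an initial segment, which
  can be chosen in common for several spaces.
\<close>
definition has_euler :: "(int \<Rightarrow> enat) \<Rightarrow> int \<Rightarrow> bool" where
  "has_euler b e \<longleftrightarrow> (\<forall>p. b p \<noteq> \<infinity>) \<and> (\<forall>p<0. b p = 0) \<and>
     (\<exists>N. (\<forall>p\<ge>int N. b p = 0) \<and> e = (\<Sum>p<N. (-1) ^ p * int (the_enat (b (int p)))))"

lemma has_euler_iff:
  assumes "\<And>p. b p \<noteq> \<infinity>" "\<And>p. p < 0 \<Longrightarrow> b p = 0" "\<And>p. p \<ge> int N \<Longrightarrow> b p = 0"
  shows "has_euler b e \<longleftrightarrow> e = (\<Sum>p<N. (-1) ^ p * int (the_enat (b (int p))))"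
proof -
  let ?f = "\<lambda>p. (-1) ^ p * int (the_enat (b (int p)))"
  have *: "sum ?f {..<M} = sum ?f {..<N}" if M: "\<forall>p\<ge>int M. b p = 0" for M
  proof -
    have "sum ?f {..<K} = sum ?f {..<min M N}" if "K = M \<or> K = N" for K
      using that M assms(3)
      by (intro sum.mono_neutral_right) (auto simp: min_def zero_enat_def split: if_splits)
    then show ?thesis by metis
  qed
  show ?thesis
    unfolding has_euler_def using assms * by (metis (no_types, lifting))
qed

text \<open>
  In a long exact sequence of a pair let \<open>r1\<close>, \<open>r2\<close>, \<open>r3\<close> be the ranks of the three kinds of maps.
  The alternating sums of \<open>a + q\<close> and of \<open>x\<close> differ by a telescoping sum in \<open>r3\<close> whose ends
  vanish.  The two alternatives in the hypothesis are the two instances of the two-out-of-three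
  principle that excision calls for.
\<close>
lemma has_euler_exact:
  fixes r1 r2 r3 :: "int \<Rightarrow> enat"
  assumes a: "\<And>p. a p = r3 (p + 1) + r1 p" and x: "\<And>p. x p = r1 p + r2 p" and q: "\<And>p. q p = r2 p + r3 p"
    and neg: "\<And>p. p < 0 \<Longrightarrow> a p = 0 \<and> x p = 0 \<and> q p = 0"
    and two: "has_euler a ea \<and> has_euler x ex \<and> er = ex - ea \<or>
              has_euler a ea \<and> has_euler q er \<and> ex = ea + er"
  shows "has_euler a ea \<and> has_euler x ex \<and> has_euler q er \<and> ex = ea + er"
proof -
  have afin: "a p \<noteq> \<infinity>" and xqfin: "x p \<noteq> \<infinity> \<or> q p \<noteq> \<infinity>" for p
    using two unfolding has_euler_def by blast+
  have r1: "r1 p \<noteq> \<infinity>" and r3: "r3 p \<noteq> \<infinity>" for p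
    using afin[of p] afin[of "p - 1"] a[of p] a[of "p - 1"]
    by (auto simp: plus_eq_infty_iff_enat simp del: not_infinity_eq)
  have r2: "r2 p \<noteq> \<infinity>" for p
    using xqfin[of p] x[of p] q[of p] by (auto simp: plus_eq_infty_iff_enat simp del: not_infinity_eq)
  define s1 s2 s3 where "s1 p = int (the_enat (r1 p))" "s2 p = int (the_enat (r2 p))" "s3 p = int (the_enat (r3 p))" for p
  have te: "the_enat (u + v) = the_enat u + the_enat v" if "u \<noteq> \<infinity>" "v \<noteq> \<infinity>" for u v
    using that by auto
  have fin: "a p \<noteq> \<infinity>" "x p \<noteq> \<infinity>" "q p \<noteq> \<infinity>" for p
    using r1 r2 r3 by (auto simp: a x q plus_eq_infty_iff_enat simp del: not_infinity_eq)
  have s: "int (the_enat (a p)) = s3 (p + 1) + s1 p" "int (the_enat (x p)) = s1 p + s2 p"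
      "int (the_enat (q p)) = s2 p + s3 p" for p
    using r1 r2 r3 by (auto simp: a x q te s1_s2_s3_def)
  have "\<exists>N. \<forall>p\<ge>int N. a p = 0 \<and> (x p = 0 \<or> q p = 0)"
    using two
  proof
    assume "has_euler a ea \<and> has_euler x ex \<and> er = ex - ea"
    then obtain N1 N2 where "\<forall>p\<ge>int N1. a p = 0" "\<forall>p\<ge>int N2. x p = 0" by (auto simp: has_euler_def)
    then show ?thesis by (intro exI[of _ "max N1 N2"]) auto
  next
    assume "has_euler a ea \<and> has_euler q er \<and> ex = ea + er"
    then obtain N1 N2 where "\<forall>p\<ge>int N1. a p = 0" "\<forall>p\<ge>int N2. q p = 0" by (auto simp: has_euler_def)
    then show ?thesis by (intro exI[of _ "max N1 N2"]) auto
  qed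
  then obtain N where N: "\<forall>p\<ge>int N. a p = 0 \<and> (x p = 0 \<or> q p = 0)" by blast
  define M where "M = Suc N"
  have z: "a p = 0 \<and> x p = 0 \<and> q p = 0 \<and> r3 p = 0" if "p \<ge> int M" for p
  proof -
    have "p \<ge> int N" "p - 1 \<ge> int N" using that by (auto simp: M_def)
    then have "a p = 0" "a (p - 1) = 0" "x p = 0 \<or> q p = 0" using N by blast+
    then show ?thesis using a[of p] a[of "p - 1"] x[of p] q[of p] by auto
  qed
  have r30: "r3 0 = 0" using neg[of "-1"] a[of "-1"] by simp
  let ?S = "\<lambda>b. \<Sum>p<M. (-1) ^ p * int (the_enat (b (int p)))"
  have he: "has_euler b e \<longleftrightarrow> e = ?S b" if "b = a \<or> b = x \<or> b = q" for b e
    using that fin neg z by (intro has_euler_iff) blast+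
  have "(\<Sum>p<K. (-1) ^ p * (s3 (int p + 1) + s3 (int p))) = s3 0 - (-1) ^ K * s3 (int K)" for K
    by (induction K) (auto simp: algebra_simps)
  then have tel: "(\<Sum>p<M. (-1) ^ p * (s3 (int p + 1) + s3 (int p))) = 0"
    using r30 z[of "int M"] by (simp add: s1_s2_s3_def zero_enat_def)
  have "?S a + ?S q - ?S x = (\<Sum>p<M. (-1) ^ p * (s3 (int p + 1) + s3 (int p)))"
    unfolding s sum.distrib[symmetric] sum_subtractf[symmetric] by (rule sum.cong) (auto simp: algebra_simps)
  with tel have S: "?S x = ?S a + ?S q" by simp
  from two show ?thesis
    using S by (auto simp: he)
qed

definition rel_betti :: "'a topology \<Rightarrow> 'a set \<Rightarrow> int \<Rightarrow> enat" where
  "rel_betti X S p = abelian_rank (relative_homology_group p X S)"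

text \<open>
  Exactness identifies each kernel with the preceding image; then ranks add up along each map.
\<close>
lemma rel_betti_exact:
  fixes X :: "'a topology" and S :: "'a set"
  defines "A \<equiv> \<lambda>p. homology_group p (subtopology X S)"
    and "B \<equiv> \<lambda>p. homology_group p X" and "C \<equiv> \<lambda>p. relative_homology_group p X S"
    and "i \<equiv> \<lambda>p. hom_induced p (subtopology X S) {} X {} id" and "j \<equiv> \<lambda>p. hom_induced p X {} X S id"
    and "d \<equiv> \<lambda>p. hom_boundary p X S"
  shows "abelian_rank (A p) = rank_in (A p) (d (p + 1) ` carrier (C (p + 1))) + rank_in (B p) (i p ` carrier (A p))"
    "abelian_rank (B p) = rank_in (B p) (i p ` carrier (A p)) + rank_in (C p) (j p ` carrier (B p))"
    "abelian_rank (C p) = rank_in (C p) (j p ` carrier (B p)) + rank_in (A (p - 1)) (d p ` carrier (C p))"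
proof -
  have hom: "i p \<in> hom (A p) (B p)" "j p \<in> hom (B p) (C p)" "d p \<in> hom (C p) (A (p - 1))" for p
    unfolding A_def B_def C_def i_def j_def d_def by (rule hom_induced_hom hom_boundary_hom)+
  have comm: "comm_group (A p)" "comm_group (B p)" "comm_group (C p)" for p
    unfolding A_def B_def C_def by simp_all
  have kd: "kernel (C p) (A (p - 1)) (d p) = j p ` carrier (B p)" for p
    using homology_exactness_axiom_1[of p X S] unfolding A_def B_def C_def i_def j_def d_def by simp
  have ki: "kernel (A (p - 1)) (B (p - 1)) (i (p - 1)) = d p ` carrier (C p)" for p
    using homology_exactness_axiom_2[of p X S] unfolding A_def B_def C_def i_def j_def d_def by simp
  have kj: "kernel (B p) (C p) (j p) = i p ` carrier (A p)" for p
    using homology_exactness_axiom_3[of p X S] unfolding A_def B_def C_def i_def j_def d_def by simp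
  show "abelian_rank (A p) = rank_in (A p) (d (p + 1) ` carrier (C (p + 1))) + rank_in (B p) (i p ` carrier (A p))"
    using rank_nullity[OF comm(1) comm(2) hom(1)[of p]] ki[of "p + 1"] by simp
  show "abelian_rank (B p) = rank_in (B p) (i p ` carrier (A p)) + rank_in (C p) (j p ` carrier (B p))"
    using rank_nullity[OF comm(2) comm(3) hom(2)[of p]] kj[of p] by simp
  show "abelian_rank (C p) = rank_in (C p) (j p ` carrier (B p)) + rank_in (A (p - 1)) (d p ` carrier (C p))"
    using rank_nullity[OF comm(3) comm(1) hom(3)[of p]] kd[of p] by simp
qed

lemma rel_betti_negative: "p < 0 \<Longrightarrow> rel_betti X S p = 0"
  unfolding rel_betti_def by (intro abelian_rank_trivial_group) auto

lemma has_euler_pair: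
  assumes "has_euler (rel_betti (subtopology X S) {}) ea \<and> has_euler (rel_betti X {}) ex \<and> er = ex - ea \<or>
           has_euler (rel_betti (subtopology X S) {}) ea \<and> has_euler (rel_betti X S) er \<and> ex = ea + er"
  shows "has_euler (rel_betti (subtopology X S) {}) ea \<and> has_euler (rel_betti X {}) ex \<and>
         has_euler (rel_betti X S) er \<and> ex = ea + er"
proof (rule has_euler_exact[where
      ?r1.0 = "\<lambda>p. rank_in (homology_group p X)
          (hom_induced p (subtopology X S) {} X {} id ` carrier (homology_group p (subtopology X S)))"
      and ?r2.0 = "\<lambda>p. rank_in (relative_homology_group p X S) (hom_induced p X {} X S id ` carrier (homology_group p X))"
      and ?r3.0 = "\<lambda>p. rank_in (homology_group (p - 1) (subtopology X S)) (hom_boundary p X S ` carrier (relative_homology_group p X S))"])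
  fix p
  show "rel_betti (subtopology X S) {} p = rank_in (homology_group (p + 1 - 1) (subtopology X S)) (hom_boundary (p + 1) X S ` carrier (relative_homology_group (p + 1) X S))
    + rank_in (homology_group p X)
          (hom_induced p (subtopology X S) {} X {} id ` carrier (homology_group p (subtopology X S)))"
    using rel_betti_exact(1)[of p X S] by (simp add: rel_betti_def)
  show "rel_betti X {} p = rank_in (homology_group p X)
          (hom_induced p (subtopology X S) {} X {} id ` carrier (homology_group p (subtopology X S)))
     + rank_in (relative_homology_group p X S) (hom_induced p X {} X S id ` carrier (homology_group p X))"
    using rel_betti_exact(2)[of p X S] by (simp add: rel_betti_def)
  show "rel_betti X S p = rank_in (relative_homology_group p X S) (hom_induced p X {} X S id ` carrier (homology_group p X))
     + rank_in (homology_group (p - 1) (subtopology X S)) (hom_boundary p X S ` carrier (relative_homology_group p X S))"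
    using rel_betti_exact(3)[of p X S] by (simp add: rel_betti_def)
qed (use assms in \<open>auto simp: rel_betti_negative\<close>)

definition has_euler_char :: "'a topology \<Rightarrow> int \<Rightarrow> bool" where
  "has_euler_char X e \<longleftrightarrow> finite_betti X \<and> euler_characteristic X = e"

text \<open>
  The defining sum ranges over the degrees with nonzero Betti number, the other one over an
  initial segment; the additional terms vanish.
\<close>
lemma has_euler_char_iff: "has_euler_char X e \<longleftrightarrow> has_euler (rel_betti X {}) e"
proof -
  let ?b = "rel_betti X {}"
  have b: "betti p X = ?b (int p)" for p by (simp add: betti_def rel_betti_def)
  show ?thesis
  proof
    assume "has_euler_char X e"
    then have f: "\<And>p. betti p X \<noteq> \<infinity>" "finite {p. betti p X \<noteq> 0}" and e: "e = euler_characteristic X"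
      by (auto simp: has_euler_char_def finite_betti_def)
    obtain N where N: "\<forall>p\<in>{p. betti p X \<noteq> 0}. p < N" using f(2) finite_nat_set_iff_bounded by blast
    have fin: "?b p \<noteq> \<infinity>" for p
      using f(1)[of "nat p"] by (cases "p < 0") (auto simp: rel_betti_negative b)
    have zz: "?b p = 0" if "p \<ge> int N" for p
    proof -
      have "p = int (nat p)" "\<not> nat p < N" using that by auto
      then show ?thesis using N b[of "nat p"] by force
    qed
    have "e = (\<Sum>p<N. (-1) ^ p * int (the_enat (?b (int p))))"
      unfolding e euler_characteristic_def b[symmetric] using N by (intro sum.mono_neutral_left) (auto simp: zero_enat_def)
    then show "has_euler ?b e"
      using fin zz by (subst has_euler_iff[of _ N]) (auto simp: rel_betti_negative)
  next
    assume "has_euler ?b e"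
    then obtain N where f: "\<And>p. ?b p \<noteq> \<infinity>" and N: "\<forall>p\<ge>int N. ?b p = 0"
      and e: "e = (\<Sum>p<N. (-1) ^ p * int (the_enat (?b (int p))))" by (auto simp: has_euler_def)
    have sub: "{p. betti p X \<noteq> 0} \<subseteq> {..<N}" using N by (metis (mono_tags) b lessThan_iff mem_Collect_eq not_le of_nat_le_iff subsetI)
    have "euler_characteristic X = e"
      unfolding e euler_characteristic_def b[symmetric] using sub by (intro sum.mono_neutral_left) (auto simp: zero_enat_def)
    then show "has_euler_char X e"
      using f sub finite_subset by (auto simp: has_euler_char_def finite_betti_def b)
  qed
qed

lemma has_euler_char_homotopy_equivalent:
  assumes "X homotopy_equivalent_space Y"
  shows "has_euler_char X e \<longleftrightarrow> has_euler_char Y e"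
proof -
  have "abelian_rank (homology_group p X) = abelian_rank (homology_group p Y)" for p
    using assms by (intro abelian_rank_iso homotopy_equivalent_space_imp_isomorphic_homology_groups) auto
  then show ?thesis by (simp add: has_euler_char_iff rel_betti_def[abs_def])
qed

lemma has_euler_char_empty:
  assumes "topspace X = {}" shows "has_euler_char X 0"
proof -
  have "rel_betti X {} p = 0" for p
    unfolding rel_betti_def using assms
    by (intro abelian_rank_trivial_group trivial_homology_group_empty) auto
  then show ?thesis unfolding has_euler_char_iff has_euler_def by (auto intro: exI[of _ 0])
qed

lemma has_euler_char_contractible:
  assumes "contractible_space X" "topspace X \<noteq> {}"
  shows "has_euler_char X 1"
proof -
  have 0: "rel_betti X {} 0 = 1"
    unfolding rel_betti_def using assms
    by (subst abelian_rank_iso[OF _ _ isomorphic_integer_zeroth_homology_group])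
      (auto simp: contractible_imp_path_connected_space abelian_rank_integer_group abelian_integer_group)
  have 1: "rel_betti X {} p = 0" if "p \<noteq> 0" for p
  proof -
    have "trivial_group (homology_group p X)"
      using trivial_reduced_homology_group_contractible_space[OF assms(1), of p] un_reduced_homology_group[OF that, of X]
      by simp
    then show ?thesis unfolding rel_betti_def by (intro abelian_rank_trivial_group) auto
  qed
  have "rel_betti X {} p \<noteq> \<infinity>" for p using 0 1 by (cases "p = 0") auto
  with 0 1 show ?thesis
    unfolding has_euler_char_iff has_euler_def by (auto intro!: exI[of _ 1] simp: one_enat_def)
qed

text \<open>
  The part to excise is the complement of \<open>B\<close>: it is closed and contained in the open set \<open>A\<close>.
\<close>
lemma rel_betti_excision:
  assumes "openin X A" "openin X B" "A \<union> B = topspace X"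
  shows "rel_betti X A = rel_betti (subtopology X B) (A \<inter> B)"
proof
  fix p
  let ?U = "topspace X - B"
  have AB: "A \<subseteq> topspace X" "B \<subseteq> topspace X" using assms openin_subset by blast+
  have "closedin X ?U" using assms(2) by (simp add: closedin_diff)
  then have "X closure_of ?U \<subseteq> X interior_of A"
    using assms AB by (auto simp: closure_of_closedin interior_of_openin)
  from homology_excision_axiom[OF this AB(1), of p]
  have "relative_homology_group p (subtopology X (topspace X - ?U)) (A - ?U)
      \<cong> relative_homology_group p (subtopology X (topspace X)) A"
    by (auto simp: is_iso_def)
  moreover have "topspace X - ?U = B" "A - ?U = A \<inter> B" using AB by auto
  ultimately show "rel_betti X A p = rel_betti (subtopology X B) (A \<inter> B) p"
    unfolding rel_betti_def by (metis abelian_rank_iso abelian_relative_homology_group subtopology_topspace)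
qed

text \<open>
  The numerical shadow of Mayer--Vietoris.  With \<open>X = A \<union> B\<close>, excision equates the relative Euler
  characteristics of \<open>(X, A)\<close> and \<open>(B, A \<inter> B)\<close>, and these are \<open>\<chi>(X) - \<chi>(A)\<close> and
  \<open>\<chi>(B) - \<chi>(A \<inter> B)\<close> by the exact sequences of the two pairs.
\<close>
theorem has_euler_char_Un:
  assumes "openin T A" "openin T B"
    and "has_euler_char (subtopology T A) a" "has_euler_char (subtopology T B) b"
    and "has_euler_char (subtopology T (A \<inter> B)) c"
  shows "has_euler_char (subtopology T (A \<union> B)) (a + b - c)"
proof -
  let ?X = "subtopology T (A \<union> B)"
  have AB: "A \<subseteq> topspace T" "B \<subseteq> topspace T" using assms openin_subset by blast+
  have op: "openin ?X A" "openin ?X B" using assms(1,2) unfolding openin_subtopology by blast+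
  have top: "topspace ?X = A \<union> B" using AB by auto
  have subs: "subtopology ?X A = subtopology T A" "subtopology ?X B = subtopology T B"
    "subtopology (subtopology T B) (A \<inter> B) = subtopology T (A \<inter> B)"
    by (auto simp: subtopology_subtopology intro!: arg_cong[where f = "subtopology T"])
  have "has_euler (rel_betti (subtopology T B) (A \<inter> B)) (b - c)"
    using has_euler_pair[of "subtopology T B" "A \<inter> B" c b "b - c"] assms
    by (simp add: has_euler_char_iff subs)
  then have "has_euler (rel_betti ?X A) (b - c)"
    using rel_betti_excision[OF op top[symmetric]] by (simp add: subs)
  then have "has_euler (rel_betti ?X {}) (a + (b - c))"
    using has_euler_pair[of ?X A a "a + (b - c)" "b - c"] assms(3) by (simp add: has_euler_char_iff subs)
  then show ?thesis by (simp add: has_euler_char_iff algebra_simps)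
qed

section \<open>Valuations of periodic open sets\<close>

text \<open>
  Points of \<open>'e \<times> 'e\<close> are pairs \<open>(x, y)\<close> of a real and an imaginary part, and the lattice \<open>L\<close>
  translates the real part.  A periodic open set stands for its image in the torus, and
  \<open>euler A e\<close> says that the Euler characteristic of this image exists and is \<open>e\<close>; it is a relation
  because existence has to be established along the way.  The computation uses topology only
  through the last three assumptions: the empty set has value \<open>0\<close>, a convex set that injects into
  the torus has value \<open>1\<close>, and values are additive on unions of periodic open sets.

  The assumption \<open>rational\<close> is what remains of the rationality of the subspace on which the roots
  vanishing at \<open>y\<close> are all zero: with \<open>y\<close> it contains a nonzero lattice vector.
\<close>
locale periodic_arrangement =
  fixes L \<Phi> :: "'e::euclidean_space set" and euler :: "('e \<times> 'e) set \<Rightarrow> int \<Rightarrow> bool"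
  assumes L_0: "0 \<in> L" and L_add: "\<And>l m. l \<in> L \<Longrightarrow> m \<in> L \<Longrightarrow> l + m \<in> L"
    and L_minus: "\<And>l. l \<in> L \<Longrightarrow> - l \<in> L"
    and finite_roots: "finite \<Phi>" and uminus_roots: "\<And>\<alpha>. \<alpha> \<in> \<Phi> \<Longrightarrow> - \<alpha> \<in> \<Phi>"
    and integral: "\<And>\<alpha> l. \<alpha> \<in> \<Phi> \<Longrightarrow> l \<in> L \<Longrightarrow> \<alpha> \<bullet> l \<in> \<int>"
    and separating: "\<And>x. (\<And>\<alpha>. \<alpha> \<in> \<Phi> \<Longrightarrow> \<alpha> \<bullet> x = 0) \<Longrightarrow> x = 0"
    and cocompact: "\<exists>D. bounded D \<and> (\<forall>x. \<exists>l\<in>L. x + l \<in> D)"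
    and rational: "\<And>y. y \<noteq> 0 \<Longrightarrow> \<exists>l\<in>L. l \<noteq> 0 \<and> (\<forall>\<alpha>\<in>\<Phi>. \<alpha> \<bullet> y = 0 \<longrightarrow> \<alpha> \<bullet> l = 0)"
    and euler_empty: "euler {} 0"
    and euler_cell: "\<And>K. open K \<Longrightarrow> convex K \<Longrightarrow> K \<noteq> {} \<Longrightarrow>
        (\<And>x y l. (x, y) \<in> K \<Longrightarrow> l \<in> L \<Longrightarrow> (x + l, y) \<in> K \<Longrightarrow> l = 0) \<Longrightarrow>
        euler {(x + l, y) | x y l. (x, y) \<in> K \<and> l \<in> L} 1"
    and euler_Un: "\<And>A B a b c. open A \<Longrightarrow> open B \<Longrightarrow>
        (\<And>x y l. (x, y) \<in> A \<Longrightarrow> l \<in> L \<Longrightarrow> (x + l, y) \<in> A) \<Longrightarrow>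
        (\<And>x y l. (x, y) \<in> B \<Longrightarrow> l \<in> L \<Longrightarrow> (x + l, y) \<in> B) \<Longrightarrow>
        euler A a \<Longrightarrow> euler B b \<Longrightarrow> euler (A \<inter> B) c \<Longrightarrow> euler (A \<union> B) (a + b - c)"
begin

definition orbit :: "('e \<times> 'e) set \<Rightarrow> ('e \<times> 'e) set" where
  "orbit K = {(x + l, y) | x y l. (x, y) \<in> K \<and> l \<in> L}"

definition periodic :: "('e \<times> 'e) set \<Rightarrow> bool" where
  "periodic A \<longleftrightarrow> open A \<and> (\<forall>x y l. (x, y) \<in> A \<longrightarrow> l \<in> L \<longrightarrow> (x + l, y) \<in> A)"

lemma L_diff: "l \<in> L \<Longrightarrow> m \<in> L \<Longrightarrow> l - m \<in> L"
  using L_add[of l "- m"] L_minus[of m] by simp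

lemma euler_union:
  assumes "periodic A" "periodic B" "euler A a" "euler B b" "euler (A \<inter> B) c"
  shows "euler (A \<union> B) (a + b - c)"
  using assms by (intro euler_Un) (auto simp: periodic_def)

lemma periodic_Un: "periodic A \<Longrightarrow> periodic B \<Longrightarrow> periodic (A \<union> B)"
  and periodic_empty: "periodic {}"
  by (auto simp: periodic_def)

lemma periodic_UN: "(\<And>i. i \<in> I \<Longrightarrow> periodic (B i)) \<Longrightarrow> periodic (\<Union>i\<in>I. B i)"
  unfolding periodic_def by (intro conjI open_UN) blast+

lemma orbitI: "(x, y) \<in> K \<Longrightarrow> l \<in> L \<Longrightarrow> (x + l, y) \<in> orbit K"
  by (auto simp: orbit_def)

lemma orbit_iff: "(x, y) \<in> orbit K \<longleftrightarrow> (\<exists>l\<in>L. (x + l, y) \<in> K)"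
proof
  assume "(x, y) \<in> orbit K"
  then obtain x' l where "x = x' + l" "(x', y) \<in> K" "l \<in> L" by (auto simp: orbit_def)
  then show "\<exists>l\<in>L. (x + l, y) \<in> K" using L_minus by (intro bexI[of _ "- l"]) auto
next
  assume "\<exists>l\<in>L. (x + l, y) \<in> K"
  then obtain l where "l \<in> L" "(x + l, y) \<in> K" by blast
  then show "(x, y) \<in> orbit K" using orbitI[of "x + l" y K "- l"] L_minus by simp
qed

lemma periodic_orbit:
  assumes "open K" shows "periodic (orbit K)"
  unfolding periodic_def
proof (intro conjI allI impI)
  have "orbit K = (\<Union>l\<in>L. (\<lambda>z. z + (l, 0)) -` K)"
    using orbit_iff by auto
  moreover have "open ((\<lambda>z. z + (l, 0)) -` K)" for l :: 'e
    using assms by (intro open_vimage continuous_intros)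
  ultimately show "open (orbit K)" by auto
  fix x y l assume "(x, y) \<in> orbit K" "l \<in> L"
  then obtain m where "m \<in> L" "(x + m, y) \<in> K" by (auto simp: orbit_iff)
  then show "(x + l, y) \<in> orbit K"
    using L_diff[OF \<open>m \<in> L\<close> \<open>l \<in> L\<close>] by (auto simp: orbit_iff algebra_simps intro!: bexI[of _ "m - l"])
qed

lemma euler_disjoint_or_equal:
  assumes "finite I" "\<And>i. i \<in> I \<Longrightarrow> periodic (B i)" "\<And>i. i \<in> I \<Longrightarrow> euler (B i) 0"
    "\<And>i j. i \<in> I \<Longrightarrow> j \<in> I \<Longrightarrow> B i \<inter> B j \<noteq> {} \<Longrightarrow> B i = B j"
  shows "euler (\<Union>i\<in>I. B i) 0"
  using assms
proof (induction I)
  case empty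
  then show ?case by (simp add: euler_empty)
next
  case (insert i I)
  have IH: "euler (\<Union>i\<in>I. B i) 0" using insert by blast
  show ?case
  proof (cases "B i \<inter> (\<Union>i\<in>I. B i) = {}")
    case True
    then have "euler (B i \<union> (\<Union>i\<in>I. B i)) (0 + 0 - 0)"
      using insert.prems IH euler_empty by (intro euler_union periodic_UN) auto
    then show ?thesis by simp
  next
    case False
    then obtain j where "j \<in> I" "B i \<inter> B j \<noteq> {}" by blast
    then have "B i = B j" using insert.prems(3)[of i j] by blast
    then have "(\<Union>i\<in>insert i I. B i) = (\<Union>i\<in>I. B i)" using \<open>j \<in> I\<close> by blast
    then show ?thesis using IH by simp
  qed
qed

lemma euler_disjoint:
  assumes "finite I" "\<And>i. i \<in> I \<Longrightarrow> periodic (B i)" "\<And>i. i \<in> I \<Longrightarrow> euler (B i) 1"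
    "\<And>i j. i \<in> I \<Longrightarrow> j \<in> I \<Longrightarrow> B i \<inter> B j \<noteq> {} \<Longrightarrow> i = j"
  shows "euler (\<Union>i\<in>I. B i) (int (card I))"
  using assms
proof (induction I)
  case empty
  then show ?case by (simp add: euler_empty)
next
  case (insert i I)
  have IH: "euler (\<Union>i\<in>I. B i) (int (card I))" using insert by blast
  have "B i \<inter> (\<Union>i\<in>I. B i) = {}" using insert by blast
  then have "euler (B i \<union> (\<Union>i\<in>I. B i)) (1 + int (card I) - 0)"
    using insert.prems IH euler_empty by (intro euler_union periodic_UN) auto
  then show ?case using insert.hyps by simp
qed

text \<open>
  Here \<open>\<Lambda>\<close> is the stabiliser of the convex set \<open>S\<close>, whose image in the torus is homotopy
  equivalent to a compact torus with fundamental group \<open>\<Lambda>\<close>; so the value is \<open>0\<close> unless \<open>\<Lambda>\<close> is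
  trivial.  For a root \<open>\<alpha>\<close> that is not zero on \<open>\<Lambda>\<close>, with \<open>\<alpha>\<close> taking on \<open>\<Lambda>\<close> exactly the multiples of
  \<open>m\<close>, the image of \<open>S\<close> maps to the circle \<open>\<real> / m\<int>\<close>.  Two overlapping arcs cover this circle,
  and the arcs as well as the two components of their overlap pull back to pieces that all have the
  same stabiliser, the kernel of \<open>\<alpha>\<close> in \<open>\<Lambda>\<close>.  By induction they share one value \<open>e\<close>, and
  \<open>e + e - (e + e) = 0\<close>.
\<close>
lemma euler_slab:
  fixes \<Lambda> :: "'e set"
  assumes "open S" "convex S" "S \<noteq> {}"
    and "\<Lambda> \<subseteq> L" "0 \<in> \<Lambda>" "\<And>l m. l \<in> \<Lambda> \<Longrightarrow> m \<in> \<Lambda> \<Longrightarrow> l + m \<in> \<Lambda>" "\<And>l. l \<in> \<Lambda> \<Longrightarrow> - l \<in> \<Lambda>"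
    and "\<And>x y l. (x, y) \<in> S \<Longrightarrow> l \<in> L \<Longrightarrow> (x + l, y) \<in> S \<Longrightarrow> l \<in> \<Lambda>"
    and "\<And>x y l. (x, y) \<in> S \<Longrightarrow> l \<in> \<Lambda> \<Longrightarrow> (x + l, y) \<in> S"
  shows "euler (orbit S) (if \<Lambda> = {0} then 1 else 0)"
  using assms
proof (induction "card {\<alpha>\<in>\<Phi>. \<exists>l\<in>\<Lambda>. \<alpha> \<bullet> l \<noteq> 0}" arbitrary: S \<Lambda> rule: less_induct)
  case (less \<Lambda> S)
  note S = less.prems(1-3) and \<Lambda> = less.prems(4-7) and stab = less.prems(8,9)
  show ?case
  proof (cases "\<Lambda> = {0}")
    case True
    then have "euler (orbit S) 1" unfolding orbit_def using S stab by (intro euler_cell) auto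
    then show ?thesis using True by simp
  next
    case False
    then obtain l1 where l1: "l1 \<in> \<Lambda>" "l1 \<noteq> 0" using \<Lambda>(2) by blast
    then obtain \<alpha> where \<alpha>: "\<alpha> \<in> \<Phi>" "\<alpha> \<bullet> l1 \<noteq> 0" using separating by blast
    define Q where "Q = (\<lambda>k::nat. k > 0 \<and> (\<exists>l\<in>\<Lambda>. \<bar>\<alpha> \<bullet> l\<bar> = real k))"
    have Q: "Q (nat \<bar>i\<bar>)" if "l \<in> \<Lambda>" "\<alpha> \<bullet> l = of_int i" "i \<noteq> 0" for l i
      using that by (auto simp: Q_def intro!: bexI[of _ l])
    have int: "\<exists>i. \<alpha> \<bullet> l = of_int i" if "l \<in> \<Lambda>" for l
      using integral[OF \<alpha>(1), of l] that \<Lambda>(1) by (auto elim: Ints_cases)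
    from int[OF l1(1)] \<alpha>(2) l1(1) Q have "\<exists>k. Q k" by fastforce
    define m where "m = Least Q"
    have Qm: "Q m" unfolding m_def by (rule LeastI_ex) fact
    then have m: "m > 0" by (simp add: Q_def)
    obtain l0 where l0: "l0 \<in> \<Lambda>" "\<alpha> \<bullet> l0 = real m"
    proof -
      from Qm obtain l where "l \<in> \<Lambda>" "\<bar>\<alpha> \<bullet> l\<bar> = real m" by (auto simp: Q_def)
      then show ?thesis using that[of l] that[of "- l"] \<Lambda>(4) by (cases "\<alpha> \<bullet> l \<ge> 0") auto
    qed
    have small: "\<alpha> \<bullet> l = 0" if l: "l \<in> \<Lambda>" "\<bar>\<alpha> \<bullet> l\<bar> < real m" for l
    proof (rule ccontr)
      assume "\<alpha> \<bullet> l \<noteq> 0"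
      with int[OF l(1)] obtain i where i: "\<alpha> \<bullet> l = of_int i" "i \<noteq> 0" by auto
      with Q l have "m \<le> nat \<bar>i\<bar>" unfolding m_def by (blast intro: Least_le)
      then show False using i l by linarith
    qed
    define \<Lambda>' where "\<Lambda>' = {l\<in>\<Lambda>. \<alpha> \<bullet> l = 0}"
    define piece where "piece a b = S \<inter> {(x, y). a < \<alpha> \<bullet> x \<and> \<alpha> \<bullet> x < b}" for a b :: real
    define e :: int where "e = (if \<Lambda>' = {0} then 1 else 0)"
    have piece_iff: "(x, y) \<in> piece a b \<longleftrightarrow> (x, y) \<in> S \<and> a < \<alpha> \<bullet> x \<and> \<alpha> \<bullet> x < b" for x y a b
      by (auto simp: piece_def)
    have strip: "{(x :: 'e, y :: 'e). a < \<alpha> \<bullet> x \<and> \<alpha> \<bullet> x < b} = {z. (\<alpha>, 0) \<bullet> z > a} \<inter> {z. (\<alpha>, 0) \<bullet> z < b}" for a b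
      by (auto simp: inner_prod_def)
    have op: "open (piece a b)" for a b
      unfolding piece_def strip using S(1) by (intro open_Int open_halfspace_lt open_halfspace_gt)
    have cv: "convex (piece a b)" for a b
      unfolding piece_def strip using S(2) by (intro convex_Int convex_halfspace_lt convex_halfspace_gt)
    \<comment> \<open>By convexity \<open>S\<close> contains the whole line in direction \<open>l0\<close>, so \<open>\<alpha>\<close> takes all real values on \<open>S\<close>.\<close>
    have line: "(x + t *\<^sub>R l0, y) \<in> S" if xy: "(x, y) \<in> S" for x y t
    proof -
      have nat: "(x + real k *\<^sub>R l0, y) \<in> S \<and> (x - real k *\<^sub>R l0, y) \<in> S" for k :: nat
      proof (induction k)
        case (Suc k)
        then have "(x + real k *\<^sub>R l0 + l0, y) \<in> S" "(x - real k *\<^sub>R l0 + (- l0), y) \<in> S"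
          using stab(2) l0(1) \<Lambda>(4) by blast+
        then show ?case by (simp add: algebra_simps)
      qed (use xy in simp)
      obtain k :: nat where k: "\<bar>t\<bar> < real k" using reals_Archimedean2 by blast
      define u where "u = (t / real k + 1) / 2"
      have "u \<ge> 0" "u \<le> 1" using k by (auto simp: u_def field_simps abs_if split: if_splits)
      then have "(1 - u) *\<^sub>R (x - real k *\<^sub>R l0, y) + u *\<^sub>R (x + real k *\<^sub>R l0, y) \<in> S"
        using nat[of k] S(2) unfolding convex_alt by blast
      also have "(1 - u) *\<^sub>R (x - real k *\<^sub>R l0, y) + u *\<^sub>R (x + real k *\<^sub>R l0, y)
          = (x + ((2 * u - 1) * real k) *\<^sub>R l0, y)"
        by (simp add: algebra_simps flip: scaleR_add_left)
      also have "(2 * u - 1) * real k = t" using k by (simp add: u_def field_simps)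
      finally show ?thesis .
    qed
    have ne: "piece a b \<noteq> {}" if "a < b" for a b
    proof -
      obtain x y where xy: "(x, y) \<in> S" using S(3) by auto
      define t where "t = ((a + b) / 2 - \<alpha> \<bullet> x) / real m"
      have "\<alpha> \<bullet> (x + t *\<^sub>R l0) = (a + b) / 2"
        using m l0 by (simp add: t_def inner_add_right)
      then have "(x + t *\<^sub>R l0, y) \<in> piece a b" using line[OF xy, of t] that by (simp add: piece_iff)
      then show ?thesis by blast
    qed
    have euler_piece: "euler (orbit (piece a b)) e" if ab: "a < b" "b - a \<le> real m" for a b
      unfolding e_def
    proof (rule less.hyps)
      have "{\<beta>\<in>\<Phi>. \<exists>l\<in>\<Lambda>'. \<beta> \<bullet> l \<noteq> 0} \<subset> {\<beta>\<in>\<Phi>. \<exists>l\<in>\<Lambda>. \<beta> \<bullet> l \<noteq> 0}"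
        using \<alpha> l1 by (auto simp: \<Lambda>'_def)
      then show "card {\<beta>\<in>\<Phi>. \<exists>l\<in>\<Lambda>'. \<beta> \<bullet> l \<noteq> 0} < card {\<beta>\<in>\<Phi>. \<exists>l\<in>\<Lambda>. \<beta> \<bullet> l \<noteq> 0}"
        by (intro psubset_card_mono) (use finite_roots in auto)
      fix x y l assume xy: "(x, y) \<in> piece a b"
      {
        assume l: "l \<in> L" "(x + l, y) \<in> piece a b"
        then have "l \<in> \<Lambda>" using xy stab(1) by (auto simp: piece_iff)
        moreover have "\<bar>\<alpha> \<bullet> l\<bar> < real m" using xy l ab by (auto simp: piece_iff inner_add_right)
        ultimately show "l \<in> \<Lambda>'" using small by (auto simp: \<Lambda>'_def)
      next
        assume "l \<in> \<Lambda>'"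
        then show "(x + l, y) \<in> piece a b"
          using xy stab(2) by (auto simp: piece_iff \<Lambda>'_def inner_add_right)
      }
    qed (use op cv ne ab \<Lambda> in \<open>auto simp: \<Lambda>'_def inner_add_right\<close>)
    \<comment> \<open>The arcs are \<open>(0, 2h)\<close> and \<open>(h, 3h)\<close> on a circle of length \<open>2h\<close>; they overlap in \<open>(h, 2h)\<close> and,
      across the point \<open>0\<close>, in \<open>(2h, 3h)\<close>, a translate of \<open>(0, h)\<close>.\<close>
    define h where "h = real m / 2"
    have h: "h > 0" "real m = 2 * h" using m by (auto simp: h_def)
    let ?A = "orbit (piece 0 (2 * h))" and ?B = "orbit (piece h (3 * h))"
      and ?C = "orbit (piece 0 h)" and ?D = "orbit (piece h (2 * h))"
    have piece_values: "euler ?A e" "euler ?B e" "euler ?C e" "euler ?D e"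
      using h by (auto intro!: euler_piece)
    have CD: "?C \<inter> ?D = {}"
    proof (rule ccontr)
      assume "?C \<inter> ?D \<noteq> {}"
      then obtain x y l l' where *: "l \<in> L" "l' \<in> L" "(x + l, y) \<in> piece 0 h" "(x + l', y) \<in> piece h (2 * h)"
        by (auto simp: orbit_iff)
      have "(x + l) + (l' - l) = x + l'" by simp
      then have "l' - l \<in> \<Lambda>" using *(3,4) stab(1)[of "x + l" y "l' - l"] L_diff[OF *(2,1)] by (simp add: piece_iff)
      moreover have "\<bar>\<alpha> \<bullet> (l' - l)\<bar> < real m"
        using *(3,4) h by (auto simp: piece_iff inner_add_right inner_diff_right)
      ultimately have "\<alpha> \<bullet> (l' - l) = 0" by (rule small)
      then show False using *(3,4) by (auto simp: piece_iff inner_add_right inner_diff_right)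
    qed
    have AB: "?A \<inter> ?B = ?C \<union> ?D"
    proof
      show "?A \<inter> ?B \<subseteq> ?C \<union> ?D"
      proof clarify
        fix x y assume "(x, y) \<in> ?A" "(x, y) \<in> ?B" and nD: "(x, y) \<notin> ?D"
        then obtain l l' where *: "l \<in> L" "l' \<in> L" "(x + l, y) \<in> piece 0 (2 * h)" "(x + l', y) \<in> piece h (3 * h)"
          by (auto simp: orbit_iff)
        have eq: "(x + l) + (l' - l) = x + l'" by simp
        then have l\<Lambda>: "l' - l \<in> \<Lambda>"
          using *(3,4) stab(1)[of "x + l" y "l' - l"] L_diff[OF *(2,1)] by (simp add: piece_iff)
        show "(x, y) \<in> ?C"
        proof (cases "\<alpha> \<bullet> (x + l) < h")
          case True
          then have "(x + l, y) \<in> piece 0 h" using * by (simp add: piece_iff)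
          then show ?thesis using * by (auto simp: orbit_iff)
        next
          case F: False
          have "\<alpha> \<bullet> (x + l) = h"
          proof (rule ccontr)
            assume "\<alpha> \<bullet> (x + l) \<noteq> h"
            then have "(x + l, y) \<in> piece h (2 * h)" using * F by (simp add: piece_iff)
            then show False using nD * by (auto simp: orbit_iff)
          qed
          moreover have "\<bar>\<alpha> \<bullet> (l' - l)\<bar> < real m"
            using calculation *(4) h by (auto simp: piece_iff inner_add_right inner_diff_right)
          with small l\<Lambda> have "\<alpha> \<bullet> (l' - l) = 0" by blast
          ultimately show ?thesis using *(4) by (auto simp: piece_iff inner_add_right inner_diff_right)
        qed
      qed
      show "?C \<union> ?D \<subseteq> ?A \<inter> ?B"
      proof clarify
        fix x y assume "(x, y) \<in> ?C \<union> ?D"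
        then obtain l where l: "l \<in> L" "(x + l, y) \<in> piece 0 h \<or> (x + l, y) \<in> piece h (2 * h)"
          by (auto simp: orbit_iff)
        then have "(x + l, y) \<in> piece 0 (2 * h)" using h by (auto simp: piece_iff)
        moreover have "(x + l, y) \<in> piece h (3 * h) \<or> (x + (l + l0), y) \<in> piece h (3 * h)"
          using l(2) stab(2)[of "x + l" y l0] l0 h by (auto simp: piece_iff inner_add_right add.assoc)
        ultimately show "(x, y) \<in> ?A \<inter> ?B"
          using l(1) L_add[of l l0] l0(1) \<Lambda>(1) by (auto simp: orbit_iff)
      qed
    qed
    have AuB: "?A \<union> ?B = orbit S"
    proof
      show "?A \<union> ?B \<subseteq> orbit S" by (auto simp: orbit_iff piece_iff)
      show "orbit S \<subseteq> ?A \<union> ?B"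
      proof clarify
        fix x y assume "(x, y) \<in> orbit S" and nB: "(x, y) \<notin> ?B"
        then obtain l where l: "l \<in> L" "(x + l, y) \<in> S" by (auto simp: orbit_iff)
        define k where "k = \<lfloor>\<alpha> \<bullet> (x + l) / real m\<rfloor>"
        have mult: "of_int k *\<^sub>R l0 \<in> \<Lambda>" for k
        proof -
          have "real n *\<^sub>R l0 \<in> \<Lambda>" for n by (induction n) (use \<Lambda> l0 in \<open>auto simp: algebra_simps\<close>)
          from this[of "nat k"] \<Lambda>(4)[OF this[of "nat (- k)"]] show ?thesis by (cases "k \<ge> 0") auto
        qed
        let ?l = "l + of_int (- k) *\<^sub>R l0"
        have "x + ?l = (x + l) + of_int (- k) *\<^sub>R l0" by (simp only: add.assoc)
        then have in': "(x + ?l, y) \<in> S" using stab(2)[OF l(2) mult[of "- k"]] by (simp only:)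
        have L': "?l \<in> L" using L_add[OF l(1)] mult[of "- k"] \<Lambda>(1) by blast
        have v: "\<alpha> \<bullet> (x + ?l) = \<alpha> \<bullet> (x + l) - of_int k * real m" using l0 by (simp add: inner_add_right inner_diff_right)
        have "of_int k \<le> \<alpha> \<bullet> (x + l) / real m" "\<alpha> \<bullet> (x + l) / real m < of_int k + 1" by (simp_all add: k_def)
        then have "0 \<le> \<alpha> \<bullet> (x + ?l)" "\<alpha> \<bullet> (x + ?l) < real m"
          unfolding v using m by (auto simp: field_simps)
        moreover have "\<alpha> \<bullet> (x + ?l) \<noteq> 0"
        proof
          assume "\<alpha> \<bullet> (x + ?l) = 0"
          then have "(x + (?l + l0), y) \<in> piece h (3 * h)"
            using stab(2)[OF in' l0(1)] l0(2) h by (simp add: piece_iff inner_add_right add.assoc)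
          then show False using nB L_add[OF L'] l0(1) \<Lambda>(1) by (auto simp: orbit_iff)
        qed
        ultimately have "(x + ?l, y) \<in> piece 0 (2 * h)" using in' h by (auto simp: piece_iff)
        then show "(x, y) \<in> ?A" using L' by (auto simp: orbit_iff)
      qed
    qed
    have "euler (?C \<union> ?D) (e + e - 0)"
      using op piece_values CD euler_empty by (intro euler_union periodic_orbit) auto
    then have "euler (?A \<union> ?B) (e + e - (e + e - 0))"
      using op piece_values AB by (intro euler_union periodic_orbit) auto
    then show ?thesis using False by (simp add: AuB)
  qed
qed

definition generic :: "'e set \<Rightarrow> 'e set" where
  "generic \<Psi> = {x. \<forall>\<alpha>\<in>\<Psi>. \<alpha> \<bullet> x \<notin> \<int>}"

text \<open>
  The connected component of \<open>x0\<close> in \<open>generic \<Psi>\<close>, for \<open>x0\<close> in this set; an alcove if \<open>\<Psi> = \<Phi>\<close>.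
\<close>
definition cell :: "'e set \<Rightarrow> 'e \<Rightarrow> 'e set" where
  "cell \<Psi> x0 = {x \<in> generic \<Psi>. \<forall>\<alpha>\<in>\<Psi>. \<lfloor>\<alpha> \<bullet> x\<rfloor> = \<lfloor>\<alpha> \<bullet> x0\<rfloor>}"

lemma cell_eq:
  "cell \<Psi> x0 = (\<Inter>\<alpha>\<in>\<Psi>. {x. of_int \<lfloor>\<alpha> \<bullet> x0\<rfloor> < \<alpha> \<bullet> x} \<inter> {x. \<alpha> \<bullet> x < of_int \<lfloor>\<alpha> \<bullet> x0\<rfloor> + 1})"
proof -
  have "t \<notin> \<int> \<and> \<lfloor>t\<rfloor> = k \<longleftrightarrow> of_int k < t \<and> t < of_int k + 1" for t :: real and k
  proof
    assume *: "t \<notin> \<int> \<and> \<lfloor>t\<rfloor> = k"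
    then have "t \<noteq> of_int k" by (metis Ints_of_int)
    then show "of_int k < t \<and> t < of_int k + 1" using * by linarith
  next
    assume *: "of_int k < t \<and> t < of_int k + 1"
    then have "\<lfloor>t\<rfloor> = k" by linarith
    moreover have "t \<notin> \<int>"
    proof
      assume "t \<in> \<int>"
      then obtain j where "t = of_int j" by (auto elim: Ints_cases)
      then have "real_of_int k < real_of_int j" "real_of_int j < real_of_int (k + 1)" using * by simp_all
      then have "k < j" "j < k + 1" by (simp_all only: of_int_less_iff)
      then show False by simp
    qed
    ultimately show "t \<notin> \<int> \<and> \<lfloor>t\<rfloor> = k" by simp
  qed
  then show ?thesis unfolding cell_def generic_def by auto
qed

lemma open_cell: "finite \<Psi> \<Longrightarrow> open (cell \<Psi> x0)"
  unfolding cell_eq by (intro open_INT open_Int ballI open_halfspace_lt open_halfspace_gt)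

lemma convex_cell: "convex (cell \<Psi> x0)"
  unfolding cell_eq by (intro convex_INT convex_Int convex_halfspace_lt convex_halfspace_gt)

lemma integral_floor:
  assumes "\<alpha> \<in> \<Phi>" "l \<in> L"
  shows "\<alpha> \<bullet> (x + l) \<in> \<int> \<longleftrightarrow> \<alpha> \<bullet> x \<in> \<int>" "\<lfloor>\<alpha> \<bullet> (x + l)\<rfloor> = \<lfloor>\<alpha> \<bullet> x\<rfloor> + \<lfloor>\<alpha> \<bullet> l\<rfloor>"
proof -
  obtain k where k: "\<alpha> \<bullet> l = of_int k" using integral[OF assms] by (auto elim: Ints_cases)
  show "\<alpha> \<bullet> (x + l) \<in> \<int> \<longleftrightarrow> \<alpha> \<bullet> x \<in> \<int>"
    by (simp add: inner_add_right k)
  show "\<lfloor>\<alpha> \<bullet> (x + l)\<rfloor> = \<lfloor>\<alpha> \<bullet> x\<rfloor> + \<lfloor>\<alpha> \<bullet> l\<rfloor>" by (simp add: inner_add_right k)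
qed

lemma generic_translate: "\<Psi> \<subseteq> \<Phi> \<Longrightarrow> l \<in> L \<Longrightarrow> x + l \<in> generic \<Psi> \<longleftrightarrow> x \<in> generic \<Psi>"
  unfolding generic_def using integral_floor(1)[of _ l x] by blast

lemma open_generic:
  assumes "finite \<Psi>" shows "open (generic \<Psi>)"
proof -
  have "generic \<Psi> = (\<Inter>\<alpha>\<in>\<Psi>. (\<lambda>x. \<alpha> \<bullet> x) -` (- \<int>))" by (auto simp: generic_def)
  moreover have "open ((\<lambda>x. \<alpha> \<bullet> x) -` (- \<int>))" for \<alpha> :: 'e
    by (intro open_vimage continuous_intros) (simp add: open_Compl)
  ultimately show ?thesis using assms by auto
qed

lemma periodic_generic:
  assumes "\<Psi> \<subseteq> \<Phi>" "open U" shows "periodic (generic \<Psi> \<times> U)"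
  unfolding periodic_def
  using assms open_generic[OF finite_subset[OF assms(1) finite_roots]] generic_translate
  by (auto intro: open_Times)

text \<open>
  A lattice vector that moves some point of a cell to a point of the same cell pairs with each root
  of \<open>\<Psi>\<close> to an integer of absolute value below \<open>1\<close>; hence the stabiliser is the part of \<open>L\<close>
  annihilated by \<open>\<Psi>\<close>.
\<close>
lemma euler_cell_orbit:
  assumes "\<Psi> \<subseteq> \<Phi>" "x0 \<in> generic \<Psi>" "open K" "convex K" "K \<noteq> {}"
  shows "euler (orbit (cell \<Psi> x0 \<times> K)) (if {l\<in>L. \<forall>\<alpha>\<in>\<Psi>. \<alpha> \<bullet> l = 0} = {0} then 1 else 0)"
proof (rule euler_slab)
  have "finite \<Psi>" using assms(1) finite_roots finite_subset by blast
  then show "open (cell \<Psi> x0 \<times> K)" using assms by (intro open_Times open_cell)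
  show "convex (cell \<Psi> x0 \<times> K)" using assms by (intro convex_Times convex_cell)
  have "x0 \<in> cell \<Psi> x0" using assms by (auto simp: cell_def)
  then show "cell \<Psi> x0 \<times> K \<noteq> {}" using assms by auto
  fix x y l assume xy: "(x, y) \<in> cell \<Psi> x0 \<times> K"
  {
    assume l: "l \<in> L" "(x + l, y) \<in> cell \<Psi> x0 \<times> K"
    have "\<alpha> \<bullet> l = 0" if "\<alpha> \<in> \<Psi>" for \<alpha>
    proof -
      have "\<lfloor>\<alpha> \<bullet> (x + l)\<rfloor> = \<lfloor>\<alpha> \<bullet> x\<rfloor>" using xy l that by (auto simp: cell_def)
      with integral_floor(2)[of \<alpha> l x] that assms l(1) have "\<lfloor>\<alpha> \<bullet> l\<rfloor> = 0" by auto
      moreover have "\<alpha> \<bullet> l \<in> \<int>" using that assms l(1) integral by auto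
      ultimately show ?thesis by (auto elim!: Ints_cases)
    qed
    then show "l \<in> {l\<in>L. \<forall>\<alpha>\<in>\<Psi>. \<alpha> \<bullet> l = 0}" using l by simp
  next
    assume "l \<in> {l\<in>L. \<forall>\<alpha>\<in>\<Psi>. \<alpha> \<bullet> l = 0}"
    then show "(x + l, y) \<in> cell \<Psi> x0 \<times> K" using xy by (auto simp: cell_def generic_def inner_add_right)
  }
qed (auto simp: L_0 L_add L_minus inner_add_right)

lemma orbit_cell_meet:
  assumes "\<Psi> \<subseteq> \<Phi>" "orbit (cell \<Psi> x \<times> K) \<inter> orbit (cell \<Psi> y \<times> K') \<noteq> {}"
  shows "\<exists>l\<in>L. \<forall>\<alpha>\<in>\<Psi>. \<lfloor>\<alpha> \<bullet> y\<rfloor> = \<lfloor>\<alpha> \<bullet> x\<rfloor> + \<lfloor>\<alpha> \<bullet> l\<rfloor>"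
proof -
  obtain u v l m where *: "l \<in> L" "m \<in> L" "u + l \<in> cell \<Psi> x" "u + m \<in> cell \<Psi> y"
    using assms(2) by (auto simp: orbit_iff)
  have "\<lfloor>\<alpha> \<bullet> y\<rfloor> = \<lfloor>\<alpha> \<bullet> x\<rfloor> + \<lfloor>\<alpha> \<bullet> (m - l)\<rfloor>" if "\<alpha> \<in> \<Psi>" for \<alpha>
  proof -
    have "u + m = (u + l) + (m - l)" by simp
    then have "\<lfloor>\<alpha> \<bullet> (u + m)\<rfloor> = \<lfloor>\<alpha> \<bullet> (u + l)\<rfloor> + \<lfloor>\<alpha> \<bullet> (m - l)\<rfloor>"
      using integral_floor(2)[of \<alpha> "m - l" "u + l"] L_diff * that assms(1) by auto
    then show ?thesis using * that by (auto simp: cell_def)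
  qed
  then show ?thesis using L_diff * by blast
qed

text \<open>
  Translation by \<open>l\<close> preserves every cell, so each orbit of cells contributes \<open>0\<close>.  Only finitely many orbits occur, because every point can be moved into a bounded
  set, where the roots have bounded integer parts.
\<close>
lemma euler_generic_zero:
  assumes "\<Psi> \<subseteq> \<Phi>" "l \<in> L" "l \<noteq> 0" "\<And>\<alpha>. \<alpha> \<in> \<Psi> \<Longrightarrow> \<alpha> \<bullet> l = 0" "open K" "convex K"
  shows "euler (generic \<Psi> \<times> K) 0"
proof (cases "K = {}")
  case True then show ?thesis by (simp add: euler_empty)
next
  case False
  have fin: "finite \<Psi>" using assms(1) finite_roots finite_subset by blast
  obtain D where D: "bounded D" "\<And>x. \<exists>l\<in>L. x + l \<in> D" using cocompact by blast
  obtain R where R: "\<And>x. x \<in> D \<Longrightarrow> norm x \<le> R" using D(1) by (auto simp: bounded_iff)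
  define \<C> where "\<C> = cell \<Psi> ` (D \<inter> generic \<Psi>)"
  have "finite \<C>"
  proof -
    define N where "N = \<lceil>(\<Sum>\<alpha>\<in>\<Psi>. norm \<alpha>) * R\<rceil> + 1"
    have bd: "\<lfloor>\<alpha> \<bullet> x\<rfloor> \<in> {-N..N}" if "x \<in> D" "\<alpha> \<in> \<Psi>" for x \<alpha>
    proof -
      have "\<bar>\<alpha> \<bullet> x\<bar> \<le> norm \<alpha> * norm x" by (rule Cauchy_Schwarz_ineq2)
      also have "\<dots> \<le> (\<Sum>\<alpha>\<in>\<Psi>. norm \<alpha>) * R"
        using R[OF that(1)] member_le_sum[of \<alpha> \<Psi> norm] fin that(2)
        by (intro mult_mono sum_nonneg) auto
      finally show ?thesis unfolding N_def by (simp add: abs_le_iff) linarith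
    qed
    have "\<C> \<subseteq> (\<lambda>k. {x \<in> generic \<Psi>. \<forall>\<alpha>\<in>\<Psi>. \<lfloor>\<alpha> \<bullet> x\<rfloor> = k \<alpha>}) ` (PiE \<Psi> (\<lambda>_. {-N..N}))"
    proof
      fix C assume "C \<in> \<C>"
      then obtain x where x: "x \<in> D" "C = cell \<Psi> x" by (auto simp: \<C>_def)
      then show "C \<in> (\<lambda>k. {x \<in> generic \<Psi>. \<forall>\<alpha>\<in>\<Psi>. \<lfloor>\<alpha> \<bullet> x\<rfloor> = k \<alpha>}) ` (PiE \<Psi> (\<lambda>_. {-N..N}))"
        unfolding x(2) cell_def
      proof (intro image_eqI[of _ _ "restrict (\<lambda>\<alpha>. \<lfloor>\<alpha> \<bullet> x\<rfloor>) \<Psi>"])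
        show "restrict (\<lambda>\<alpha>. \<lfloor>\<alpha> \<bullet> x\<rfloor>) \<Psi> \<in> PiE \<Psi> (\<lambda>_. {-N..N})"
          using bd[OF x(1)] by (simp only: restrict_PiE_iff) blast
      qed simp
    qed
    then show ?thesis by (rule finite_subset) (intro finite_imageI finite_PiE fin finite_atLeastAtMost_int)
  qed
  have "generic \<Psi> \<times> K = (\<Union>C\<in>\<C>. orbit (C \<times> K))"
  proof
    show "generic \<Psi> \<times> K \<subseteq> (\<Union>C\<in>\<C>. orbit (C \<times> K))"
    proof clarify
      fix x y assume xy: "x \<in> generic \<Psi>" "y \<in> K"
      obtain l where l: "l \<in> L" "x + l \<in> D" using D(2) by blast
      then have g: "x + l \<in> generic \<Psi>" using generic_translate assms(1) xy by blast
      then have "(x, y) \<in> orbit (cell \<Psi> (x + l) \<times> K)" using xy l by (auto simp: orbit_iff cell_def)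
      then show "(x, y) \<in> (\<Union>C\<in>\<C>. orbit (C \<times> K))" using g l by (auto simp: \<C>_def)
    qed
    show "(\<Union>C\<in>\<C>. orbit (C \<times> K)) \<subseteq> generic \<Psi> \<times> K"
      using generic_translate[OF assms(1)] by (auto simp: \<C>_def orbit_iff cell_def)
  qed
  moreover have "euler (\<Union>C\<in>\<C>. orbit (C \<times> K)) 0"
  proof (rule euler_disjoint_or_equal)
    fix C assume "C \<in> \<C>"
    then obtain x0 where x0: "x0 \<in> generic \<Psi>" "C = cell \<Psi> x0" by (auto simp: \<C>_def)
    show "periodic (orbit (C \<times> K))" using x0 fin assms by (auto intro!: periodic_orbit open_Times open_cell)
    have "l \<in> {l\<in>L. \<forall>\<alpha>\<in>\<Psi>. \<alpha> \<bullet> l = 0}" using assms by auto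
    then show "euler (orbit (C \<times> K)) 0" using euler_cell_orbit[OF assms(1) x0(1) assms(5,6) False] assms(3) x0(2)
      by (auto split: if_splits)
    fix C' assume C': "C' \<in> \<C>" "orbit (C \<times> K) \<inter> orbit (C' \<times> K) \<noteq> {}"
    then obtain x1 where x1: "C' = cell \<Psi> x1" by (auto simp: \<C>_def)
    obtain m where m: "m \<in> L" "\<And>\<alpha>. \<alpha> \<in> \<Psi> \<Longrightarrow> \<lfloor>\<alpha> \<bullet> x1\<rfloor> = \<lfloor>\<alpha> \<bullet> x0\<rfloor> + \<lfloor>\<alpha> \<bullet> m\<rfloor>"
      using orbit_cell_meet[OF assms(1)] C'(2) x0(2) x1 by blast
    have *: "x + m \<in> cell \<Psi> x1 \<longleftrightarrow> x \<in> cell \<Psi> x0" for x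
      using m integral_floor[OF _ m(1)] assms(1) generic_translate[OF assms(1) m(1)]
      by (auto simp: cell_def subset_iff)
    have "(x, y) \<in> orbit (C \<times> K) \<longleftrightarrow> (x, y) \<in> orbit (C' \<times> K)" for x y
    proof
      assume "(x, y) \<in> orbit (C \<times> K)"
      then obtain l where "l \<in> L" "x + l \<in> cell \<Psi> x0" "y \<in> K" by (auto simp: orbit_iff x0)
      then show "(x, y) \<in> orbit (C' \<times> K)"
        using *[of "x + l"] L_add[OF _ m(1)] by (auto simp: orbit_iff x1 add.assoc)
    next
      assume "(x, y) \<in> orbit (C' \<times> K)"
      then obtain l where "l \<in> L" "x + l \<in> cell \<Psi> x1" "y \<in> K" by (auto simp: orbit_iff x1)
      then show "(x, y) \<in> orbit (C \<times> K)"
        using *[of "x + (l - m)"] L_diff[OF _ m(1)] by (auto simp: orbit_iff x0 intro!: bexI[of _ "l - m"])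
    qed
    then show "orbit (C \<times> K) = orbit (C' \<times> K)" by auto
  qed fact
  ultimately show ?thesis by simp
qed

text \<open>
  The roots separate points, so alcoves have trivial stabiliser and each orbit of alcoves
  contributes \<open>1\<close>.
\<close>
lemma euler_generic_alcoves:
  assumes "finite I" "\<And>i. i \<in> I \<Longrightarrow> p i \<in> generic \<Phi>"
    and cover: "\<And>x. x \<in> generic \<Phi> \<Longrightarrow> \<exists>i\<in>I. \<exists>l\<in>L. x + l \<in> cell \<Phi> (p i)"
    and disj: "\<And>i j x l. i \<in> I \<Longrightarrow> j \<in> I \<Longrightarrow> l \<in> L \<Longrightarrow> p i + l \<in> cell \<Phi> (p j) \<Longrightarrow> i = j"
    and K: "open K" "convex K" "K \<noteq> {}"
  shows "euler (generic \<Phi> \<times> K) (int (card I))"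
proof -
  have "generic \<Phi> \<times> K = (\<Union>i\<in>I. orbit (cell \<Phi> (p i) \<times> K))"
  proof
    show "generic \<Phi> \<times> K \<subseteq> (\<Union>i\<in>I. orbit (cell \<Phi> (p i) \<times> K))"
      using cover by (force simp: orbit_iff)
    show "(\<Union>i\<in>I. orbit (cell \<Phi> (p i) \<times> K)) \<subseteq> generic \<Phi> \<times> K"
      using generic_translate[of \<Phi>] by (auto simp: orbit_iff cell_def)
  qed
  moreover have "euler (\<Union>i\<in>I. orbit (cell \<Phi> (p i) \<times> K)) (int (card I))"
  proof (rule euler_disjoint)
    fix i assume i: "i \<in> I"
    show "periodic (orbit (cell \<Phi> (p i) \<times> K))"
      using finite_roots K by (auto intro!: periodic_orbit open_Times open_cell)
    have "{l\<in>L. \<forall>\<alpha>\<in>\<Phi>. \<alpha> \<bullet> l = 0} = {0}" using separating L_0 by auto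
    then show "euler (orbit (cell \<Phi> (p i) \<times> K)) 1"
      using euler_cell_orbit[OF _ assms(2)[OF i] K] by simp
    fix j assume j: "j \<in> I" "orbit (cell \<Phi> (p i) \<times> K) \<inter> orbit (cell \<Phi> (p j) \<times> K) \<noteq> {}"
    then obtain l where l: "l \<in> L" "\<And>\<alpha>. \<alpha> \<in> \<Phi> \<Longrightarrow> \<lfloor>\<alpha> \<bullet> p j\<rfloor> = \<lfloor>\<alpha> \<bullet> p i\<rfloor> + \<lfloor>\<alpha> \<bullet> l\<rfloor>"
      using orbit_cell_meet[of \<Phi>] by blast
    then have "p i + l \<in> cell \<Phi> (p j)"
      using integral_floor(2)[OF _ l(1)] generic_translate[of \<Phi> l "p i"] assms(2)[OF i] by (auto simp: cell_def)
    then show "i = j" using disj i j(1) l(1) by blast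
  qed fact
  ultimately show ?thesis by simp
qed

text \<open>
  Intersections of convex sets are convex, so additivity propagates the value \<open>0\<close> from convex sets
  to their finite unions.
\<close>
lemma euler_generic_zero_UN:
  assumes "\<Psi> \<subseteq> \<Phi>" "l \<in> L" "l \<noteq> 0" "\<And>\<alpha>. \<alpha> \<in> \<Psi> \<Longrightarrow> \<alpha> \<bullet> l = 0"
    and "finite I" "\<And>i. i \<in> I \<Longrightarrow> open (K i) \<and> convex (K i)"
  shows "euler (generic \<Psi> \<times> (\<Union>i\<in>I. K i)) 0"
  using assms(5,6)
proof (induction I arbitrary: K)
  case empty
  then show ?case by (simp add: euler_empty)
next
  case (insert i I)
  have eq: "generic \<Psi> \<times> (\<Union>j\<in>insert i I. K j) = generic \<Psi> \<times> K i \<union> generic \<Psi> \<times> (\<Union>j\<in>I. K j)" by auto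
  have int: "(generic \<Psi> \<times> K i) \<inter> (generic \<Psi> \<times> (\<Union>j\<in>I. K j)) = generic \<Psi> \<times> (\<Union>j\<in>I. K i \<inter> K j)" by auto
  have "euler (generic \<Psi> \<times> K i \<union> generic \<Psi> \<times> (\<Union>j\<in>I. K j)) (0 + 0 - 0)"
  proof (rule euler_union)
    show "periodic (generic \<Psi> \<times> K i)" "periodic (generic \<Psi> \<times> (\<Union>j\<in>I. K j))"
      using insert.prems assms(1) by (auto intro!: periodic_generic)
    show "euler (generic \<Psi> \<times> K i) 0" using insert.prems assms by (intro euler_generic_zero) auto
    show "euler (generic \<Psi> \<times> (\<Union>j\<in>I. K j)) 0" using insert by blast
    show "euler ((generic \<Psi> \<times> K i) \<inter> (generic \<Psi> \<times> (\<Union>j\<in>I. K j))) 0"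
      unfolding int using insert.prems by (intro insert.IH) (auto intro: convex_Int)
  qed
  then show ?case unfolding eq by simp
qed

section \<open>Strata of the complement over the faces of the central arrangement\<close>

text \<open>
  As roots come in opposite pairs, this set determines the signs of all roots at \<open>y\<close>, that is, the
  face of the central arrangement that contains \<open>y\<close>.
\<close>
definition positives :: "'e \<Rightarrow> 'e set" where
  "positives y = {\<alpha>\<in>\<Phi>. 0 < \<alpha> \<bullet> y}"

text \<open>
  The part of the complement of the arrangement that lies over a union of faces.
\<close>
definition stratum :: "'e set set \<Rightarrow> ('e \<times> 'e) set" where
  "stratum \<F> = {(x, y). positives y \<in> \<F> \<and> (\<forall>\<alpha>\<in>\<Phi>. \<alpha> \<bullet> y = 0 \<longrightarrow> \<alpha> \<bullet> x \<notin> \<int>)}"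

text \<open>
  The open star of the face encoded by \<open>G\<close>: the union of the faces whose closure contains it.
\<close>
definition star :: "'e set \<Rightarrow> 'e set" where
  "star G = {y. \<forall>\<alpha>\<in>G. 0 < \<alpha> \<bullet> y}"

lemma open_star: "finite G \<Longrightarrow> open (star G)" and convex_star: "convex (star G)"
proof -
  have eq: "star G = (\<Inter>\<alpha>\<in>G. {y. 0 < \<alpha> \<bullet> y})" by (auto simp: star_def)
  show "open (star G)" if "finite G" unfolding eq using that by (intro open_INT ballI open_halfspace_gt)
  show "convex (star G)" unfolding eq by (intro convex_INT convex_halfspace_gt)
qed

lemma star_eq: "G \<subseteq> \<Phi> \<Longrightarrow> star G = {y. G \<subseteq> positives y}"
  by (auto simp: star_def positives_def)

lemma positives_uminus: "\<alpha> \<in> \<Phi> \<Longrightarrow> \<alpha> \<bullet> y = 0 \<longleftrightarrow> \<alpha> \<notin> positives y \<and> - \<alpha> \<notin> positives y"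
  using uminus_roots by (auto simp: positives_def)

lemma positives_empty_iff: "positives y = {} \<longleftrightarrow> y = 0"
proof
  assume "positives y = {}"
  then have "\<alpha> \<bullet> y = 0" if "\<alpha> \<in> \<Phi>" for \<alpha> using positives_uminus[OF that] by simp
  then show "y = 0" by (rule separating)
qed (simp add: positives_def)

text \<open>
  A family that is closed under passing to supersets describes an open union of faces.  Remove a
  minimal member \<open>G\<close>, the face of some \<open>y0 \<noteq> 0\<close>, and let \<open>\<Psi>\<close> be the roots vanishing at \<open>y0\<close>.  What
  is lost is covered by \<open>generic \<Psi> \<times> star G\<close>, and it overlaps the remaining part in
  \<open>generic \<Psi>\<close> times the star without \<open>G\<close> itself, a finite union of smaller stars.  By \<open>rational\<close>,
  \<open>generic \<Psi>\<close> is invariant under a translation subgroup of the torus, so both pieces have value \<open>0\<close>.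
\<close>
lemma euler_stratum_zero:
  assumes "\<F> \<subseteq> Pow \<Phi>" "{} \<notin> \<F>" "\<And>G G'. G \<in> \<F> \<Longrightarrow> G \<subseteq> G' \<Longrightarrow> G' \<subseteq> \<Phi> \<Longrightarrow> G' \<in> \<F>"
  shows "periodic (stratum \<F>) \<and> euler (stratum \<F>) 0"
  using assms
proof (induction "card \<F>" arbitrary: \<F>)
  case 0
  then have "\<F> = {}" using finite_roots finite_subset by (metis card_0_eq finite_Pow_iff)
  then have "stratum \<F> = {}" by (auto simp: stratum_def)
  then show ?case by (simp add: periodic_empty euler_empty)
next
  case (Suc n)
  note \<F> = Suc.prems
  have fin: "finite \<F>" using \<F>(1) finite_roots finite_subset by (metis finite_Pow_iff)
  then obtain G where G: "G \<in> \<F>" "\<And>G'. G' \<in> \<F> \<Longrightarrow> G' \<subseteq> G \<Longrightarrow> G' = G"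
    using finite_has_minimal[of \<F>] Suc.hyps(2) by (metis card.empty nat.distinct(1))
  have G\<Phi>: "G \<subseteq> \<Phi>" using G \<F>(1) by blast
  let ?F = "\<F> - {G}"
  have IH: "periodic (stratum ?F)" "euler (stratum ?F) 0"
  proof -
    have "periodic (stratum ?F) \<and> euler (stratum ?F) 0"
    proof (rule Suc.hyps(1))
      show "n = card ?F" using Suc.hyps(2) G(1) fin by simp
      show "?F \<subseteq> Pow \<Phi>" "{} \<notin> ?F" using \<F>(1,2) by blast+
      show "G'' \<in> ?F" if "G' \<in> ?F" "G' \<subseteq> G''" "G'' \<subseteq> \<Phi>" for G' G''
        using that \<F>(3)[of G' G''] G(2)[of G'] by blast
    qed
    then show "periodic (stratum ?F)" "euler (stratum ?F) 0" by blast+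
  qed
  show ?case
  proof (cases "\<exists>y. positives y = G")
    case False
    then have "stratum \<F> = stratum ?F" by (auto simp: stratum_def)
    then show ?thesis using IH by simp
  next
    case True
    then obtain y0 where y0: "positives y0 = G" by blast
    with G \<F>(2) have "y0 \<noteq> 0" using positives_empty_iff by metis
    then obtain l where l: "l \<in> L" "l \<noteq> 0" "\<And>\<alpha>. \<alpha> \<in> \<Phi> \<Longrightarrow> \<alpha> \<bullet> y0 = 0 \<Longrightarrow> \<alpha> \<bullet> l = 0"
      using rational by blast
    define \<Psi> where "\<Psi> = {\<alpha>\<in>\<Phi>. \<alpha> \<bullet> y0 = 0}"
    have \<Psi>: "\<alpha> \<in> \<Psi> \<longleftrightarrow> \<alpha> \<in> \<Phi> \<and> \<alpha> \<notin> G \<and> - \<alpha> \<notin> G" for \<alpha>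
      using positives_uminus[of \<alpha> y0] y0 by (auto simp: \<Psi>_def)
    have \<Psi>sub: "\<Psi> \<subseteq> \<Phi>" by (auto simp: \<Psi>_def)
    have eq: "stratum \<F> = stratum ?F \<union> generic \<Psi> \<times> star G"
    proof
      show "stratum \<F> \<subseteq> stratum ?F \<union> generic \<Psi> \<times> star G"
        using star_eq[OF G\<Phi>] positives_uminus by (auto simp: stratum_def generic_def \<Psi>)
      have "generic \<Psi> \<times> star G \<subseteq> stratum \<F>"
      proof clarify
        fix x y assume xy: "x \<in> generic \<Psi>" "y \<in> star G"
        then have GP: "G \<subseteq> positives y" using star_eq[OF G\<Phi>] by blast
        then have "positives y \<in> \<F>" using \<F>(3)[OF G(1)] by (auto simp: positives_def)
        moreover have "\<alpha> \<bullet> x \<notin> \<int>" if "\<alpha> \<in> \<Phi>" "\<alpha> \<bullet> y = 0" for \<alpha>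
        proof -
          have "\<alpha> \<in> \<Psi>" using that GP positives_uminus[of \<alpha> y] unfolding \<Psi> by blast
          then show ?thesis using xy(1) by (simp add: generic_def)
        qed
        ultimately show "(x, y) \<in> stratum \<F>" by (auto simp: stratum_def)
      qed
      then show "stratum ?F \<union> generic \<Psi> \<times> star G \<subseteq> stratum \<F>" by (auto simp: stratum_def)
    qed
    have int: "stratum ?F \<inter> generic \<Psi> \<times> star G = generic \<Psi> \<times> (\<Union>\<beta>\<in>\<Phi> - G. star (insert \<beta> G))"
    proof -
      have "(x, y) \<in> stratum ?F \<inter> generic \<Psi> \<times> star G \<longleftrightarrow> x \<in> generic \<Psi> \<and> G \<subset> positives y" for x y
      proof -
        have "(x, y) \<in> stratum \<F>" if "x \<in> generic \<Psi>" "G \<subseteq> positives y"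
          using that eq star_eq[OF G\<Phi>] by blast
        then show ?thesis using star_eq[OF G\<Phi>] by (auto simp: stratum_def)
      qed
      moreover have "(\<exists>\<beta>\<in>\<Phi> - G. y \<in> star (insert \<beta> G)) \<longleftrightarrow> G \<subset> positives y" for y
      proof -
        have "y \<in> star (insert \<beta> G) \<longleftrightarrow> insert \<beta> G \<subseteq> positives y" if "\<beta> \<in> \<Phi>" for \<beta>
          using star_eq[of "insert \<beta> G"] G\<Phi> that by simp
        moreover have "positives y \<subseteq> \<Phi>" by (auto simp: positives_def)
        ultimately show ?thesis by blast
      qed
      ultimately show ?thesis by (auto simp: set_eq_iff)
    qed
    have finG: "finite G" using G\<Phi> finite_roots finite_subset by blast
    have perX: "periodic (generic \<Psi> \<times> star G)" using \<Psi>sub open_star[OF finG] by (rule periodic_generic)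
    have "euler (stratum ?F \<union> generic \<Psi> \<times> star G) (0 + 0 - 0)"
    proof (rule euler_union[OF IH(1) perX IH(2)])
      show "euler (generic \<Psi> \<times> star G) 0"
        using \<Psi>sub l open_star[OF finG] convex_star by (intro euler_generic_zero[of \<Psi> l]) (auto simp: \<Psi>_def)
      show "euler (stratum ?F \<inter> generic \<Psi> \<times> star G) 0"
        unfolding int using \<Psi>sub l finG finite_roots
        by (intro euler_generic_zero_UN[of \<Psi> l] conjI open_star convex_star) (auto simp: \<Psi>_def)
    qed
    then show ?thesis using eq periodic_Un[OF IH(1) perX] by simp
  qed
qed

text \<open>
  A convex set without an affine subspace of codimension \<open>card B\<close> is homotopy equivalent to a sphere
  of dimension \<open>card B - 1\<close>, which explains the factor.  Instead of this equivalence, induction on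
  \<open>B\<close> is used: for a further coordinate \<open>b\<close>, the set is the union of the one for \<open>B\<close> and the two half
  spaces where \<open>b\<close> is positive or negative, and each half space meets the former in a set of the
  same kind.  So the values satisfy \<open>h(d + 1) = 2 a - h(d)\<close>.
\<close>
lemma euler_punctured:
  assumes a: "\<And>K. open K \<Longrightarrow> convex K \<Longrightarrow> K \<noteq> {} \<Longrightarrow> euler (generic \<Phi> \<times> K) a"
    and "finite B" "B \<subseteq> Basis" "open K" "convex K" "\<exists>y\<in>K. \<forall>b\<in>B. y \<bullet> b = 0"
  shows "euler (generic \<Phi> \<times> {y\<in>K. \<exists>b\<in>B. y \<bullet> b \<noteq> 0}) (a * (1 - (-1) ^ card B))"
  using assms(2-)
proof (induction B arbitrary: K)
  case empty
  then show ?case by (simp add: euler_empty)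
next
  case (insert b B)
  let ?U = "\<lambda>K. {y\<in>K. \<exists>b\<in>B. y \<bullet> b \<noteq> 0}"
  let ?P = "K \<inter> {y. y \<bullet> b > 0}" and ?N = "K \<inter> {y. y \<bullet> b < 0}"
  let ?h = "a * (1 - (-1) ^ card B)"
  have opU: "open (?U K)" if "open K" for K
  proof -
    have "?U K = (\<Union>b\<in>B. K \<inter> {y. b \<bullet> y < 0} \<union> K \<inter> {y. b \<bullet> y > 0})" by (auto simp: inner_commute neq_iff)
    then show ?thesis using that by (auto intro!: open_halfspace_lt open_halfspace_gt)
  qed
  obtain p where p: "p \<in> K" "p \<bullet> b = 0" "\<And>c. c \<in> B \<Longrightarrow> p \<bullet> c = 0" using insert.prems by auto
  have bB: "b \<in> Basis" "B \<subseteq> Basis" "b \<notin> B" using insert by auto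
  \<comment> \<open>A common zero \<open>p\<close> of all coordinates, moved slightly along \<open>b\<close>, gives common zeros of the
    coordinates in \<open>B\<close> on both sides.\<close>
  obtain e where e: "e > 0" "ball p e \<subseteq> K" using p(1) insert.prems(2) open_contains_ball by blast
  have shift: "p + t *\<^sub>R b \<in> K" "(p + t *\<^sub>R b) \<bullet> b = t" "c \<in> B \<Longrightarrow> (p + t *\<^sub>R b) \<bullet> c = 0"
    if "\<bar>t\<bar> < e" for t c
  proof -
    show "p + t *\<^sub>R b \<in> K" using e that bB by (intro subsetD[OF e(2)]) (simp add: dist_norm)
    show "(p + t *\<^sub>R b) \<bullet> b = t" using p bB by (simp add: inner_add_left)
    show "(p + t *\<^sub>R b) \<bullet> c = 0" if "c \<in> B"
      using p bB that inner_not_same_Basis[of b c] by (auto simp: inner_add_left)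
  qed
  have eP: "\<exists>y\<in>?P. \<forall>c\<in>B. y \<bullet> c = 0" using e shift[of "e / 2"] by (intro bexI[of _ "p + (e / 2) *\<^sub>R b"]) auto
  have eN: "\<exists>y\<in>?N. \<forall>c\<in>B. y \<bullet> c = 0" using e shift[of "- e / 2"] by (intro bexI[of _ "p + (- e / 2) *\<^sub>R b"]) auto
  have oPN: "open ?P" "open ?N" "convex ?P" "convex ?N"
    using insert.prems open_halfspace_gt[of 0 b] open_halfspace_lt[of b 0]
      convex_halfspace_gt[of 0 b] convex_halfspace_lt[of b 0]
    by (auto simp: inner_commute intro!: convex_Int)
  have hK: "euler (generic \<Phi> \<times> ?U K) ?h" "euler (generic \<Phi> \<times> ?U ?P) ?h" "euler (generic \<Phi> \<times> ?U ?N) ?h"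
    using insert.IH[of K] insert.IH[of ?P] insert.IH[of ?N] insert.prems oPN eP eN p by auto
  have aP: "euler (generic \<Phi> \<times> ?P) a" and aN: "euler (generic \<Phi> \<times> ?N) a"
    using a oPN eP eN by blast+
  have per: "periodic (generic \<Phi> \<times> V)" if "open V" for V using that by (intro periodic_generic) auto
  have i1: "(generic \<Phi> \<times> ?U K) \<inter> (generic \<Phi> \<times> ?P) = generic \<Phi> \<times> ?U ?P" by auto
  have 1: "euler (generic \<Phi> \<times> ?U K \<union> generic \<Phi> \<times> ?P) (?h + a - ?h)"
    by (rule euler_union[OF per per hK(1) aP]) (simp_all only: i1 opU[OF insert.prems(2)] oPN hK)
  have u1: "generic \<Phi> \<times> ?U K \<union> generic \<Phi> \<times> ?P = generic \<Phi> \<times> (?U K \<union> ?P)" by auto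
  have i2: "(generic \<Phi> \<times> (?U K \<union> ?P)) \<inter> (generic \<Phi> \<times> ?N) = generic \<Phi> \<times> ?U ?N" by auto
  have "euler (generic \<Phi> \<times> (?U K \<union> ?P) \<union> generic \<Phi> \<times> ?N) (a + a - ?h)"
  proof (rule euler_union[OF per per _ aN])
    show "euler (generic \<Phi> \<times> (?U K \<union> ?P)) a" using 1 by (simp add: u1)
  qed (simp_all only: i2 opU[OF insert.prems(2)] oPN hK open_Un)
  moreover have "generic \<Phi> \<times> (?U K \<union> ?P) \<union> generic \<Phi> \<times> ?N = generic \<Phi> \<times> {y\<in>K. \<exists>c\<in>insert b B. y \<bullet> c \<noteq> 0}"
    by (auto simp: neq_iff)
  moreover have "a + a - ?h = a * (1 - (-1) ^ card (insert b B))" using insert.hyps by (simp add: algebra_simps)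
  ultimately show ?case by (simp only:)
qed

text \<open>
  The points with \<open>y \<noteq> 0\<close> contribute \<open>0\<close>.  A neighbourhood of the rest is \<open>generic \<Phi>\<close> times the
  whole space of \<open>y\<close>, of value \<open>a\<close>, and it meets the former in \<open>generic \<Phi>\<close> times a punctured
  space, of value \<open>a (1 - (-1)\<^sup>n)\<close>.
\<close>
theorem euler_complement:
  assumes a: "\<And>K. open K \<Longrightarrow> convex K \<Longrightarrow> K \<noteq> {} \<Longrightarrow> euler (generic \<Phi> \<times> K) a"
  shows "euler {(x, y). \<forall>\<alpha>\<in>\<Phi>. \<alpha> \<bullet> y = 0 \<longrightarrow> \<alpha> \<bullet> x \<notin> \<int>} ((-1) ^ DIM('e) * a)"
proof -
  let ?N = "stratum (Pow \<Phi> - {{}})" and ?X = "generic \<Phi> \<times> UNIV"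
  have N: "periodic ?N" "euler ?N 0" using euler_stratum_zero[of "Pow \<Phi> - {{}}"] by auto
  have N_iff: "(x, y) \<in> ?N \<longleftrightarrow> y \<noteq> 0 \<and> (\<forall>\<alpha>\<in>\<Phi>. \<alpha> \<bullet> y = 0 \<longrightarrow> \<alpha> \<bullet> x \<notin> \<int>)" for x y
    by (auto simp: stratum_def positives_empty_iff) (auto simp: positives_def)
  have M: "{(x, y). \<forall>\<alpha>\<in>\<Phi>. \<alpha> \<bullet> y = 0 \<longrightarrow> \<alpha> \<bullet> x \<notin> \<int>} = ?N \<union> ?X"
    using N_iff by (auto simp: generic_def)
  have nz: "(\<exists>b\<in>Basis. y \<bullet> b \<noteq> 0) \<longleftrightarrow> y \<noteq> 0" for y :: 'e
    using euclidean_all_zero_iff[of y] by blast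
  have "?N \<inter> ?X = generic \<Phi> \<times> {y\<in>UNIV. \<exists>b\<in>Basis. y \<bullet> b \<noteq> 0}"
    unfolding nz using N_iff by (auto simp: generic_def)
  moreover have "euler (generic \<Phi> \<times> {y\<in>UNIV. \<exists>b\<in>Basis. y \<bullet> b \<noteq> 0}) (a * (1 - (-1) ^ card (Basis :: 'e set)))"
    by (rule euler_punctured) (auto intro: a intro!: exI[of _ 0])
  ultimately have "euler (?N \<union> ?X) (0 + a - a * (1 - (-1) ^ DIM('e)))"
    using N by (intro euler_union periodic_generic a) auto
  then show ?thesis unfolding M by (simp add: algebra_simps)
qed

end

section \<open>The coroot lattice\<close>

locale reduced_root_system =
  fixes \<Phi> :: "(real ^ 'n) set"
  assumes root_system_roots: "root_system \<Phi>"
begin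

\<comment> \<open>Hyperplanes are pairs below and should not be taken apart by the simplifier.\<close>
declare split_paired_All [simp del] split_paired_Ex [simp del]

lemma finite_Phi: "finite \<Phi>" and zero_notin_Phi: "0 \<notin> \<Phi>" and span_Phi: "span \<Phi> = UNIV"
  using root_system_roots by (simp_all add: root_system_def)

lemma reduced: "\<alpha> \<in> \<Phi> \<Longrightarrow> c *\<^sub>R \<alpha> \<in> \<Phi> \<Longrightarrow> c = 1 \<or> c = -1"
  using root_system_roots by (simp add: root_system_def)

lemma reflection_root: "\<alpha> \<in> \<Phi> \<Longrightarrow> \<beta> \<in> \<Phi> \<Longrightarrow> root_reflection \<alpha> \<beta> \<in> \<Phi>"
  using root_system_roots unfolding root_system_def by (metis imageI)

lemma cartan_integer: "\<alpha> \<in> \<Phi> \<Longrightarrow> \<beta> \<in> \<Phi> \<Longrightarrow> \<beta> \<bullet> coroot \<alpha> \<in> \<int>"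
  using root_system_roots by (simp add: root_system_def)

lemma uminus_Phi: "\<alpha> \<in> \<Phi> \<Longrightarrow> - \<alpha> \<in> \<Phi>" by (rule uminus_root[OF root_system_roots])

lemma root_nonzero: "\<alpha> \<in> \<Phi> \<Longrightarrow> \<alpha> \<bullet> \<alpha> > 0" using zero_notin_Phi by auto

lemma root_coroot: "\<alpha> \<in> \<Phi> \<Longrightarrow> \<alpha> \<bullet> coroot \<alpha> = 2"
  using root_nonzero[of \<alpha>] by (simp add: coroot_def)

lemma coroot_uminus: "coroot (- \<alpha>) = - coroot \<alpha>" by (simp add: coroot_def)

lemma root_reflection_eq: "root_reflection \<alpha> x = x - (\<alpha> \<bullet> x) *\<^sub>R coroot \<alpha>"
  by (simp add: root_reflection_def coroot_def inner_commute)

lemma linear_reflection: "linear (root_reflection \<alpha>)"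
  unfolding root_reflection_def
  by (rule linearI) (auto simp: inner_add_left algebra_simps)

lemma reflection_isometry: "\<alpha> \<in> \<Phi> \<Longrightarrow> root_reflection \<alpha> x \<bullet> root_reflection \<alpha> y = x \<bullet> y"
  using root_nonzero[of \<alpha>]
  by (simp add: root_reflection_def coroot_def inner_diff_left inner_diff_right inner_commute field_simps)

lemma reflection_involution: "\<alpha> \<in> \<Phi> \<Longrightarrow> root_reflection \<alpha> (root_reflection \<alpha> x) = x"
  using root_coroot[of \<alpha>]
  by (simp add: root_reflection_eq inner_diff_right scaleR_diff_left algebra_simps flip: scaleR_2)

lemma coroot_reflection:
  assumes "\<alpha> \<in> \<Phi>" shows "coroot (root_reflection \<alpha> \<beta>) = root_reflection \<alpha> (coroot \<beta>)"
  using reflection_isometry[OF assms, of \<beta> \<beta>] linear_reflection[of \<alpha>]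
  by (simp add: coroot_def linear_scale)

definition real_lattice :: "(real ^ 'n) set" where
  "real_lattice = {\<Sum>\<alpha>\<in>\<Phi>. real_of_int (c \<alpha>) *\<^sub>R coroot \<alpha> | c. True}"

lemma lattice_0: "0 \<in> real_lattice"
  unfolding real_lattice_def by (auto intro!: exI[of _ "\<lambda>_. 0"])

lemma lattice_add: "l \<in> real_lattice \<Longrightarrow> m \<in> real_lattice \<Longrightarrow> l + m \<in> real_lattice"
proof -
  assume "l \<in> real_lattice" "m \<in> real_lattice"
  then obtain c d where "l = (\<Sum>\<alpha>\<in>\<Phi>. real_of_int (c \<alpha>) *\<^sub>R coroot \<alpha>)" "m = (\<Sum>\<alpha>\<in>\<Phi>. real_of_int (d \<alpha>) *\<^sub>R coroot \<alpha>)"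
    by (auto simp: real_lattice_def)
  then have "l + m = (\<Sum>\<alpha>\<in>\<Phi>. real_of_int (c \<alpha> + d \<alpha>) *\<^sub>R coroot \<alpha>)"
    by (simp add: scaleR_add_left sum.distrib)
  then show ?thesis unfolding real_lattice_def by (intro CollectI exI[of _ "\<lambda>\<alpha>. c \<alpha> + d \<alpha>"]) simp
qed

lemma lattice_minus: "l \<in> real_lattice \<Longrightarrow> - l \<in> real_lattice"
proof -
  assume "l \<in> real_lattice"
  then obtain c where "l = (\<Sum>\<alpha>\<in>\<Phi>. real_of_int (c \<alpha>) *\<^sub>R coroot \<alpha>)" by (auto simp: real_lattice_def)
  then have "- l = (\<Sum>\<alpha>\<in>\<Phi>. real_of_int (- c \<alpha>) *\<^sub>R coroot \<alpha>)" by (simp add: sum_negf)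
  then show ?thesis unfolding real_lattice_def by (intro CollectI exI[of _ "\<lambda>\<alpha>. - c \<alpha>"]) simp
qed

lemma lattice_coroot: "\<alpha> \<in> \<Phi> \<Longrightarrow> of_int k *\<^sub>R coroot \<alpha> \<in> real_lattice"
  unfolding real_lattice_def
  by (intro CollectI exI[of _ "\<lambda>\<beta>. if \<beta> = \<alpha> then k else 0"])
    (simp add: if_distrib[of real_of_int] if_distrib[of "\<lambda>c. c *\<^sub>R _"] finite_Phi cong: if_cong)

lemma lattice_sum: "finite A \<Longrightarrow> (\<And>\<alpha>. \<alpha> \<in> A \<Longrightarrow> f \<alpha> \<in> real_lattice) \<Longrightarrow> sum f A \<in> real_lattice"
  by (induction A rule: finite_induct) (auto simp: lattice_0 lattice_add)

lemma lattice_integral: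
  assumes "\<alpha> \<in> \<Phi>" "l \<in> real_lattice" shows "\<alpha> \<bullet> l \<in> \<int>"
proof -
  obtain c where "l = (\<Sum>\<beta>\<in>\<Phi>. real_of_int (c \<beta>) *\<^sub>R coroot \<beta>)" using assms by (auto simp: real_lattice_def)
  then show ?thesis using assms cartan_integer by (auto simp: inner_sum_right intro!: Ints_sum Ints_mult)
qed

lemma lattice_reflection: "\<alpha> \<in> \<Phi> \<Longrightarrow> l \<in> real_lattice \<Longrightarrow> root_reflection \<alpha> l \<in> real_lattice"
proof -
  assume *: "\<alpha> \<in> \<Phi>" "l \<in> real_lattice"
  then obtain k where k: "\<alpha> \<bullet> l = of_int k" using lattice_integral[OF *] by (auto elim: Ints_cases)
  have "root_reflection \<alpha> l = l + of_int (- k) *\<^sub>R coroot \<alpha>" by (simp add: root_reflection_eq k)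
  then show ?thesis using * lattice_add lattice_coroot by metis
qed

lemma separating: "(\<And>\<alpha>. \<alpha> \<in> \<Phi> \<Longrightarrow> \<alpha> \<bullet> x = 0) \<Longrightarrow> x = 0"
proof -
  assume *: "\<And>\<alpha>. \<alpha> \<in> \<Phi> \<Longrightarrow> \<alpha> \<bullet> x = 0"
  have "\<Phi> \<subseteq> {y. y \<bullet> x = 0}" using * by auto
  moreover have "subspace {y. y \<bullet> x = 0}" by (auto simp: subspace_def inner_add_left)
  ultimately have "span \<Phi> \<subseteq> {y. y \<bullet> x = 0}" by (rule span_minimal)
  then have "x \<in> {y. y \<bullet> x = 0}" unfolding span_Phi by blast
  then show "x = 0" by simp
qed

text \<open>
  The coroots span the space; subtract the integer parts of the coefficients.
\<close>
lemma lattice_cocompact: "\<exists>D. bounded D \<and> (\<forall>x. \<exists>l\<in>real_lattice. x + l \<in> D)"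
proof (intro exI conjI allI)
  let ?D = "cball 0 (\<Sum>\<alpha>\<in>\<Phi>. norm (coroot \<alpha>)) :: (real ^ 'n) set"
  show "bounded ?D" by simp
  fix x
  have "x \<in> span \<Phi>" using span_Phi by simp
  then obtain u where u: "x = (\<Sum>\<alpha>\<in>\<Phi>. u \<alpha> *\<^sub>R \<alpha>)" unfolding span_finite[OF finite_Phi] by auto
  define t where "t \<alpha> = u \<alpha> * (\<alpha> \<bullet> \<alpha>) / 2" for \<alpha>
  have "u \<alpha> *\<^sub>R \<alpha> = t \<alpha> *\<^sub>R coroot \<alpha>" if "\<alpha> \<in> \<Phi>" for \<alpha>
    using root_nonzero[OF that] by (simp add: t_def coroot_def)
  then have x: "x = (\<Sum>\<alpha>\<in>\<Phi>. t \<alpha> *\<^sub>R coroot \<alpha>)" unfolding u by (intro sum.cong) auto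
  define l where "l = (\<Sum>\<alpha>\<in>\<Phi>. of_int (- \<lfloor>t \<alpha>\<rfloor>) *\<^sub>R coroot \<alpha>)"
  have l: "l \<in> real_lattice" unfolding l_def using finite_Phi lattice_coroot by (intro lattice_sum)
  have "x + l = (\<Sum>\<alpha>\<in>\<Phi>. frac (t \<alpha>) *\<^sub>R coroot \<alpha>)"
    unfolding x l_def sum.distrib[symmetric] by (intro sum.cong) (auto simp: frac_def algebra_simps)
  moreover have "frac (t \<alpha>) * norm (coroot \<alpha>) \<le> norm (coroot \<alpha>)" for \<alpha>
    by (intro mult_left_le_one_le) (auto simp: frac_ge_0 less_imp_le frac_lt_1)
  ultimately have "norm (x + l) \<le> (\<Sum>\<alpha>\<in>\<Phi>. norm (coroot \<alpha>))"
    by (auto intro!: order.trans[OF norm_sum] sum_mono simp: frac_ge_0)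
  then show "\<exists>l\<in>real_lattice. x + l \<in> ?D" using l by auto
qed

text \<open>
  The sum of the coroots that are positive at \<open>y\<close> has positive inner product with \<open>y\<close>.  A
  reflection in a root that vanishes at \<open>y\<close> fixes \<open>y\<close>, hence permutes these coroots and fixes their
  sum, so this root vanishes on the sum.
\<close>
lemma lattice_rational:
  assumes "y \<noteq> 0" shows "\<exists>l\<in>real_lattice. l \<noteq> 0 \<and> (\<forall>\<alpha>\<in>\<Phi>. \<alpha> \<bullet> y = 0 \<longrightarrow> \<alpha> \<bullet> l = 0)"
proof (intro bexI conjI ballI impI)
  let ?P = "{\<alpha>\<in>\<Phi>. \<alpha> \<bullet> y > 0}"
  define l where "l = (\<Sum>\<alpha>\<in>?P. coroot \<alpha>)"
  have fin: "finite ?P" using finite_Phi by auto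
  show "l \<in> real_lattice" unfolding l_def using fin lattice_coroot[of _ 1] by (intro lattice_sum) auto
  obtain \<beta> where "\<beta> \<in> \<Phi>" "\<beta> \<bullet> y \<noteq> 0" using separating assms by blast
  then have "\<beta> \<in> ?P \<or> - \<beta> \<in> ?P" using uminus_Phi by auto
  then have ne: "?P \<noteq> {}" by blast
  have "l \<bullet> y = (\<Sum>\<alpha>\<in>?P. coroot \<alpha> \<bullet> y)" by (simp add: l_def inner_sum_left)
  also have "\<dots> > 0" using fin ne root_nonzero by (intro sum_pos) (auto simp: coroot_def)
  finally show "l \<noteq> 0" by auto
  fix \<gamma> assume \<gamma>: "\<gamma> \<in> \<Phi>" "\<gamma> \<bullet> y = 0"
  have "root_reflection \<gamma> y = y" using \<gamma> by (simp add: root_reflection_eq)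
  then have inn: "root_reflection \<gamma> \<alpha> \<bullet> y = \<alpha> \<bullet> y" for \<alpha> using reflection_isometry[OF \<gamma>(1), of \<alpha> y] by simp
  have P: "root_reflection \<gamma> \<alpha> \<in> ?P" if "\<alpha> \<in> ?P" for \<alpha>
    using that reflection_root[OF \<gamma>(1)] inn by simp
  have "bij_betw (root_reflection \<gamma>) ?P ?P"
  proof (rule bij_betw_byWitness[where f' = "root_reflection \<gamma>"])
    show "root_reflection \<gamma> ` ?P \<subseteq> ?P" by (rule image_subsetI) (rule P)
    then show "root_reflection \<gamma> ` ?P \<subseteq> ?P" .
  qed (intro ballI reflection_involution[OF \<gamma>(1)])+
  then have "l = (\<Sum>\<alpha>\<in>?P. coroot (root_reflection \<gamma> \<alpha>))" unfolding l_def by (rule sum.reindex_bij_betw[symmetric])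
  also have "\<dots> = root_reflection \<gamma> l"
    unfolding l_def coroot_reflection[OF \<gamma>(1)] by (rule linear_sum[OF linear_reflection, symmetric])
  finally have "l = root_reflection \<gamma> l" .
  then have "(\<gamma> \<bullet> l) *\<^sub>R coroot \<gamma> = 0" by (simp add: root_reflection_eq)
  moreover have "coroot \<gamma> \<noteq> 0" using root_coroot[OF \<gamma>(1)] by auto
  ultimately show "\<gamma> \<bullet> l = 0" by simp
qed

section \<open>Affine reflections and alcoves\<close>

text \<open>
  The pair \<open>(\<alpha>, k)\<close> encodes the hyperplane where \<open>\<alpha>\<close> takes the value \<open>k\<close>, together with an
  orientation: \<open>(-\<alpha>, -k)\<close> is the same hyperplane with its sides exchanged.
\<close>
definition hyperplanes :: "((real ^ 'n) \<times> int) set" where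
  "hyperplanes = \<Phi> \<times> UNIV"

definition height :: "(real ^ 'n) \<times> int \<Rightarrow> real ^ 'n \<Rightarrow> real" where
  "height h x = fst h \<bullet> x - of_int (snd h)"

definition mirror :: "(real ^ 'n) \<times> int \<Rightarrow> real ^ 'n \<Rightarrow> real ^ 'n" where
  "mirror h x = x - height h x *\<^sub>R coroot (fst h)"

definition opposite :: "(real ^ 'n) \<times> int \<Rightarrow> (real ^ 'n) \<times> int" where
  "opposite h = (- fst h, - snd h)"

text \<open>
  The preimage of the hyperplane \<open>h\<close> under the reflection in \<open>s\<close>.  The floor converts a Cartan
  integer from type \<open>real\<close>.
\<close>
definition pullback :: "(real ^ 'n) \<times> int \<Rightarrow> (real ^ 'n) \<times> int \<Rightarrow> (real ^ 'n) \<times> int" where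
  "pullback s h = (root_reflection (fst s) (fst h), snd h - snd s * \<lfloor>fst h \<bullet> coroot (fst s)\<rfloor>)"

lemma opposite: "h \<in> hyperplanes \<Longrightarrow> opposite h \<in> hyperplanes" "height (opposite h) x = - height h x"
    "mirror (opposite h) = mirror h"
  by (auto simp: opposite_def hyperplanes_def height_def mirror_def uminus_Phi coroot_uminus fun_eq_iff algebra_simps)

lemma height_diff: "height h (x - v) = height h x - fst h \<bullet> v"
  by (simp add: height_def inner_diff_right)

lemma height_mirror: "h \<in> hyperplanes \<Longrightarrow> height h (mirror h x) = - height h x"
  using root_coroot[of "fst h"] by (auto simp: mirror_def height_diff hyperplanes_def)

lemma mirror_mirror: "h \<in> hyperplanes \<Longrightarrow> mirror h (mirror h x) = x"
  unfolding mirror_def[of h "mirror h x"] by (simp add: height_mirror) (simp add: mirror_def)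

lemma floor_cartan: "s \<in> hyperplanes \<Longrightarrow> h \<in> hyperplanes \<Longrightarrow> of_int \<lfloor>fst h \<bullet> coroot (fst s)\<rfloor> = fst h \<bullet> coroot (fst s)"
  using cartan_integer[of "fst s" "fst h"] by (auto simp: hyperplanes_def elim!: Ints_cases)

lemma pullback:
  assumes s: "s \<in> hyperplanes" and h: "h \<in> hyperplanes"
  shows "pullback s h \<in> hyperplanes" "height h (mirror s x) = height (pullback s h) x"
    "mirror h (mirror s x) = mirror s (mirror (pullback s h) x)"
proof -
  have \<Phi>: "fst s \<in> \<Phi>" "fst h \<in> \<Phi>" using s h by (auto simp: hyperplanes_def)
  show "pullback s h \<in> hyperplanes" using \<Phi> reflection_root by (auto simp: pullback_def hyperplanes_def)
  show hh: "height h (mirror s x) = height (pullback s h) x" for x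
  proof -
    have "height h (mirror s x) = fst h \<bullet> x - of_int (snd h) - (fst s \<bullet> x - of_int (snd s)) * (fst h \<bullet> coroot (fst s))"
      by (simp add: mirror_def height_diff) (simp add: height_def)
    also have "\<dots> = height (pullback s h) x"
      unfolding height_def pullback_def fst_conv snd_conv of_int_diff of_int_mult floor_cartan[OF s h] root_reflection_def
      by (simp add: inner_diff_left algebra_simps)
    finally show ?thesis .
  qed
  have lin: "mirror s (x + v) = mirror s x + root_reflection (fst s) v" for x v
    by (simp add: mirror_def root_reflection_eq height_def inner_add_right algebra_simps)
  have "root_reflection (fst s) (coroot (fst (pullback s h))) = coroot (fst h)"
    using coroot_reflection[OF \<Phi>(1), of "fst h"] reflection_involution[OF \<Phi>(1), of "coroot (fst h)"]
    by (simp add: pullback_def)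
  then have "mirror s (mirror (pullback s h) x) = mirror s x - height (pullback s h) x *\<^sub>R coroot (fst h)"
    using lin[of x "- height (pullback s h) x *\<^sub>R coroot (fst (pullback s h))"] linear_reflection[of "fst s"]
    by (simp add: mirror_def[of "pullback s h"] linear_neg linear_scale)
  then show "mirror h (mirror s x) = mirror s (mirror (pullback s h) x)"
    by (simp add: mirror_def[of h] hh)
qed

lemma height_mirror_diff: "height h (mirror s x) = height h x - height s x * (fst h \<bullet> coroot (fst s))"
  by (simp add: mirror_def height_diff)

lemma finite_hyperplanes: "finite {h \<in> hyperplanes. a < height h x \<and> height h y < b}"
proof (rule finite_subset)
  show "{h \<in> hyperplanes. a < height h x \<and> height h y < b} \<subseteq> (SIGMA \<alpha>:\<Phi>. {\<lfloor>\<alpha> \<bullet> y - b\<rfloor>..\<lceil>\<alpha> \<bullet> x - a\<rceil>})"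
    by (auto simp: hyperplanes_def height_def) linarith+
qed (use finite_Phi in auto)

definition walk :: "((real ^ 'n) \<times> int) list \<Rightarrow> real ^ 'n \<Rightarrow> real ^ 'n" where
  "walk hs x = foldr mirror hs x"

lemma walk_simps [simp]: "walk [] x = x" "walk (h # hs) x = mirror h (walk hs x)"
    "walk (hs @ hs') x = walk hs (walk hs' x)"
  by (auto simp: walk_def)

text \<open>
  Conjugates of affine reflections by elements of the affine Weyl group are affine reflections.
\<close>
lemma pullback_walk:
  assumes "set hs \<subseteq> hyperplanes" "h \<in> hyperplanes"
  shows "\<exists>h'\<in>hyperplanes. \<forall>x. height h (walk hs x) = height h' x \<and> mirror h (walk hs x) = walk hs (mirror h' x)"
  using assms
proof (induction hs arbitrary: h)
  case (Cons s hs)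
  then have *: "set hs \<subseteq> hyperplanes" "s \<in> hyperplanes" "h \<in> hyperplanes" by auto
  from Cons.IH[OF *(1) pullback(1)[OF *(2,3)]] obtain h' where "h' \<in> hyperplanes"
    "\<forall>x. height (pullback s h) (walk hs x) = height h' x \<and> mirror (pullback s h) (walk hs x) = walk hs (mirror h' x)"
    by blast
  then show ?case using pullback[OF *(2,3)] by (intro bexI[of _ h']) auto
qed auto

end

locale base_point = reduced_root_system \<Phi> for \<Phi> :: "(real ^ 'n) set" +
  fixes p :: "real ^ 'n"
  assumes regular_p: "\<And>h. h \<in> hyperplanes \<Longrightarrow> height h p \<noteq> 0"
begin

definition separators :: "real ^ 'n \<Rightarrow> ((real ^ 'n) \<times> int) set" where
  "separators x = {h \<in> hyperplanes. height h p > 0 \<and> height h x < 0}"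

text \<open>
  The walls of the alcove of \<open>p\<close>, oriented towards \<open>p\<close>: a hyperplane is a wall iff it alone
  separates \<open>p\<close> from the mirror image of \<open>p\<close> in it.
\<close>
definition walls :: "((real ^ 'n) \<times> int) set" where
  "walls = {h \<in> hyperplanes. height h p > 0 \<and> separators (mirror h p) = {h}}"

lemma walls_hyperplanes: "walls \<subseteq> hyperplanes" by (auto simp: walls_def)

lemma finite_separators: "finite (separators x)"
  using finite_hyperplanes[of 0 p x 0] by (simp add: separators_def)

text \<open>
  Move from \<open>p\<close> to \<open>x\<close> on the straight segment, and let \<open>h\<close> be the first hyperplane that is crossed,
  the nearest one to \<open>p\<close> in case of a tie.  Suppose that \<open>h' \<noteq> h\<close> also separates \<open>p\<close> from
  its mirror image in \<open>h\<close>, and let \<open>h''\<close> be the mirror image of \<open>h'\<close>, oriented towards \<open>p\<close>.  Then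
  \<open>height h' + height h'' = c * height h\<close> with a constant \<open>c > 0\<close>, so \<open>h'\<close> is
  crossed later than \<open>h\<close>, or not at all, only if \<open>h''\<close> is crossed earlier, and vice versa; hence
  all three are crossed at once.  In terms of distances from \<open>p\<close> the relation reads \<open>d h' + d h'' = 2 cos(\<theta>) d h\<close>
  with \<open>\<theta>\<close> the angle between the normals.  Minimality of \<open>d h\<close> forces \<open>cos(\<theta>) = 1\<close>, and then
  the hyperplanes are parallel, at the same distance, and equal.
\<close>
lemma wall_separates:
  assumes "separators x \<noteq> {}" shows "\<exists>s\<in>walls. height s x < 0"
proof -
  \<comment> \<open>The segment crosses \<open>h\<close> at time \<open>1 / (1 + \<rho> h)\<close>, so the first crossing has maximal \<open>\<rho>\<close>.\<close>
  define \<rho> where "\<rho> h = - height h x / height h p" for h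
  define d where "d h = height h p / norm (fst h)" for h
  obtain h0 where h0: "is_arg_min (\<lambda>h. - \<rho> h) (\<lambda>h. h \<in> separators x) h0"
    using ex_is_arg_min_if_finite[OF finite_separators assms] by blast
  let ?N = "{h \<in> separators x. \<rho> h = \<rho> h0}"
  have "h0 \<in> ?N" using h0 by (simp add: is_arg_min_def)
  then have "finite ?N" "?N \<noteq> {}" using finite_separators by auto
  from ex_is_arg_min_if_finite[OF this] obtain h where h: "is_arg_min d (\<lambda>h. h \<in> ?N) h" by blast
  have hN: "h \<in> separators x" using h by (auto simp: is_arg_min_def)
  have max: "\<rho> h' \<le> \<rho> h" if "h' \<in> separators x" for h'
    using h0 h that by (auto simp: is_arg_min_def not_less)
  have min: "d h \<le> d h'" if "h' \<in> separators x" "\<rho> h' = \<rho> h" for h'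
    using h that by (auto simp: is_arg_min_def not_less)
  have hh: "h \<in> hyperplanes" "height h p > 0" "height h x < 0" using hN by (auto simp: separators_def)
  have "h' = h" if h': "h' \<in> separators (mirror h p)" for h'
  proof -
    have hh': "h' \<in> hyperplanes" "height h' p > 0" "height h' (mirror h p) < 0"
      using h' by (auto simp: separators_def)
    define c where "c = fst h' \<bullet> coroot (fst h)"
    define h'' where "h'' = opposite (pullback h h')"
    have h''h: "h'' \<in> hyperplanes" unfolding h''_def using pullback(1) opposite(1) hh hh' by blast
    have h''v: "height h'' y = - height h' (mirror h y)" for y
      unfolding h''_def using opposite(2) pullback(2) hh hh' by simp
    have sum: "height h' y + height h'' y = c * height h y" for y
      unfolding h''v height_mirror_diff c_def by simp
    have h''p: "height h'' p > 0" using h''v hh' by simp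
    then have c: "c > 0" using sum[of p] hh hh' by (metis add_pos_pos zero_less_mult_pos2)
    have xr: "height k x = - \<rho> k * height k p" if "height k p > 0" for k using that by (simp add: \<rho>_def)
    have rpos: "\<rho> h > 0" using hh by (simp add: \<rho>_def divide_neg_pos)
    have sx: "\<rho> h' * height h' p + \<rho> h'' * height h'' p = \<rho> h * (height h' p + height h'' p)"
      using sum[of x] sum[of p] xr[of h'] xr[of h''] xr[of h] hh(2) hh'(2) h''p by (simp add: algebra_simps)
    have le: "\<rho> h' \<le> \<rho> h" "\<rho> h'' \<le> \<rho> h"
    proof -
      have *: "\<rho> k \<le> \<rho> h" if "k \<in> hyperplanes" "height k p > 0" for k
      proof (cases "height k x < 0")
        case True then show ?thesis using max[of k] that by (simp add: separators_def)
      next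
        case False
        then have "\<rho> k \<le> 0" using that by (simp add: \<rho>_def divide_le_0_iff)
        then show ?thesis using rpos by simp
      qed
      show "\<rho> h' \<le> \<rho> h" "\<rho> h'' \<le> \<rho> h" using * hh' h''h h''p by blast+
    qed
    have eq: "\<rho> h' = \<rho> h" "\<rho> h'' = \<rho> h"
    proof -
      have "(\<rho> h - \<rho> h') * height h' p + (\<rho> h - \<rho> h'') * height h'' p = 0" using sx by (simp add: algebra_simps)
      moreover have "(\<rho> h - \<rho> h') * height h' p \<ge> 0" "(\<rho> h - \<rho> h'') * height h'' p \<ge> 0" using le hh' h''p by auto
      ultimately have "(\<rho> h - \<rho> h') * height h' p = 0" "(\<rho> h - \<rho> h'') * height h'' p = 0" by linarith+
      then show "\<rho> h' = \<rho> h" "\<rho> h'' = \<rho> h" using hh' h''p by auto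
    qed
    have sep: "k \<in> separators x" if "k \<in> hyperplanes" "height k p > 0" "\<rho> k = \<rho> h" for k
      using that xr[of k] rpos by (simp add: separators_def)
    have d: "d h \<le> d h'" "d h \<le> d h''" using min sep eq hh' h''h h''p by blast+
    let ?\<alpha> = "fst h" and ?\<beta> = "fst h'"
    have \<Phi>: "?\<alpha> \<in> \<Phi>" "?\<beta> \<in> \<Phi>" using hh hh' by (auto simp: hyperplanes_def)
    then have n: "norm ?\<alpha> > 0" "norm ?\<beta> > 0" using zero_notin_Phi by auto
    have "norm (fst h'') = norm ?\<beta>"
      using reflection_isometry[OF \<Phi>(1), of ?\<beta> ?\<beta>] by (simp add: h''_def opposite_def pullback_def norm_eq_sqrt_inner)
    then have dsum: "d h' + d h'' = c * height h p / norm ?\<beta>"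
      using sum[of p] by (simp add: d_def flip: add_divide_distrib)
    have c': "c * (norm ?\<alpha> * norm ?\<alpha>) = 2 * (?\<beta> \<bullet> ?\<alpha>)"
      using n by (simp add: c_def coroot_def dot_square_norm power2_eq_square)
    have "2 * (height h p / norm ?\<alpha>) \<le> c * height h p / norm ?\<beta>" using d dsum by (simp add: d_def)
    then have "(2 / norm ?\<alpha>) * height h p \<le> (c / norm ?\<beta>) * height h p" by simp
    then have "2 / norm ?\<alpha> \<le> c / norm ?\<beta>" using hh(2) by (simp only: mult_le_cancel_right_pos)
    then have "2 * norm ?\<beta> * norm ?\<alpha> \<le> c * (norm ?\<alpha> * norm ?\<alpha>)" using n by (simp add: field_simps)
    then have "norm ?\<beta> * norm ?\<alpha> \<le> ?\<beta> \<bullet> ?\<alpha>" using c' by simp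
    moreover have "?\<beta> \<bullet> ?\<alpha> \<le> norm ?\<beta> * norm ?\<alpha>" by (rule norm_cauchy_schwarz)
    ultimately have "?\<beta> \<bullet> ?\<alpha> = norm ?\<beta> * norm ?\<alpha>" by simp
    then have "norm ?\<beta> *\<^sub>R ?\<alpha> = norm ?\<alpha> *\<^sub>R ?\<beta>" by (simp add: norm_cauchy_schwarz_eq)
    define t where "t = norm ?\<beta> / norm ?\<alpha>"
    have "t > 0" using n by (simp add: t_def)
    have "t *\<^sub>R ?\<alpha> = (1 / norm ?\<alpha>) *\<^sub>R (norm ?\<beta> *\<^sub>R ?\<alpha>)" by (simp add: t_def)
    also have "\<dots> = ?\<beta>" unfolding \<open>norm ?\<beta> *\<^sub>R ?\<alpha> = norm ?\<alpha> *\<^sub>R ?\<beta>\<close> using n by simp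
    finally have t: "t *\<^sub>R ?\<alpha> = ?\<beta>" .
    then have "t = 1 \<or> t = -1" using reduced[OF \<Phi>(1), of t] \<Phi>(2) by simp
    with \<open>t > 0\<close> t have \<alpha>\<beta>: "?\<beta> = ?\<alpha>" by auto
    then have "c = 2" using root_coroot[OF \<Phi>(1)] by (simp add: c_def)
    then have "height h' p + height h'' p = 2 * height h p" using sum by simp
    moreover have "height h p \<le> height h' p" "height h p \<le> height h'' p"
      using d n \<alpha>\<beta> \<open>norm (fst h'') = norm ?\<beta>\<close> by (simp_all add: d_def divide_le_cancel)
    ultimately have "height h p = height h' p" by linarith
    then have "snd h = snd h'" using \<alpha>\<beta> by (simp add: height_def)
    then show "h' = h" using \<alpha>\<beta> by (simp add: prod_eq_iff)
  qed
  moreover have "h \<in> separators (mirror h p)"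
    using hh height_mirror[OF hh(1)] by (simp add: separators_def)
  ultimately have "h \<in> walls" using hh by (auto simp: walls_def)
  then show ?thesis using hh by blast
qed

lemma wall_mirror_positive:
  assumes "s \<in> walls" "h \<in> hyperplanes" "height h p > 0" "h \<noteq> s"
  shows "height h (mirror s p) > 0"
proof (rule ccontr)
  assume *: "\<not> height h (mirror s p) > 0"
  have "s \<in> hyperplanes" using assms by (auto simp: walls_def)
  then have "height h (mirror s p) \<noteq> 0" using pullback assms regular_p by metis
  then have "h \<in> separators (mirror s p)" using * assms by (simp add: separators_def)
  then show False using assms by (auto simp: walls_def)
qed

text \<open>
  If \<open>h\<close> is not a wall, some wall \<open>s\<close> separates \<open>p\<close> from its mirror image in \<open>h\<close>.  The normals of
  \<open>s\<close> and \<open>h\<close> then form an acute angle, so the image of \<open>h\<close> under the reflection in \<open>s\<close> is closer to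
  \<open>p\<close>, and conjugation with this reflection reduces \<open>h\<close> to that image.  As reflected
  roots have the same length, closer means smaller height at \<open>p\<close>, and only finitely many
  hyperplanes have a positive height at \<open>p\<close> below a given one.
\<close>
lemma mirror_eq_wall_walk:
  assumes "h \<in> hyperplanes" shows "\<exists>ss. set ss \<subseteq> walls \<and> mirror h = walk ss"
proof -
  have pos: "\<exists>ss. set ss \<subseteq> walls \<and> mirror h = walk ss" if "h \<in> hyperplanes" "height h p > 0" for h
    using that
  proof (induction "card {k \<in> hyperplanes. 0 < height k p \<and> height k p < height h p}" arbitrary: h rule: less_induct)
    case less
    show ?case
    proof (cases "h \<in> walls")
      case True then show ?thesis by (intro exI[of _ "[h]"]) (auto simp: fun_eq_iff)
    next
      case False
      have "h \<in> separators (mirror h p)" using less.prems height_mirror by (simp add: separators_def)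
      then obtain s where s: "s \<in> walls" "height s (mirror h p) < 0" using wall_separates by blast
      have sh: "s \<in> hyperplanes" "height s p > 0" using s by (auto simp: walls_def)
      have neq: "h \<noteq> s" using False s by blast
      let ?h = "pullback s h"
      note pb = pullback[OF sh(1) less.prems(1)]
      have h1: "height ?h p > 0" using wall_mirror_positive[OF s(1) less.prems neq] pb(2) by simp
      have "height s p < height h p * (fst s \<bullet> coroot (fst h))"
        using s(2) by (simp add: height_mirror_diff)
      then have "fst s \<bullet> coroot (fst h) > 0"
        using sh(2) less.prems(2) by (smt (verit) mult_nonneg_nonpos)
      moreover have \<Phi>: "fst h \<in> \<Phi>" "fst s \<in> \<Phi>" using sh less.prems by (auto simp: hyperplanes_def)
      ultimately have "fst s \<bullet> fst h > 0"
        using root_nonzero[OF \<Phi>(1)] by (simp add: coroot_def zero_less_divide_iff zero_less_mult_iff)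
      then have pos: "fst h \<bullet> coroot (fst s) > 0"
        using root_nonzero[OF \<Phi>(2)] by (simp add: coroot_def inner_commute)
      have "height ?h p < height h p" using pb(2)[of p] mult_pos_pos[OF sh(2) pos] by (simp add: height_mirror_diff)
      then have "{k \<in> hyperplanes. 0 < height k p \<and> height k p < height ?h p} \<subset> {k \<in> hyperplanes. 0 < height k p \<and> height k p < height h p}"
        using h1 pb(1) by force
      then have "card {k \<in> hyperplanes. 0 < height k p \<and> height k p < height ?h p} < card {k \<in> hyperplanes. 0 < height k p \<and> height k p < height h p}"
        by (intro psubset_card_mono finite_hyperplanes)
      from less.hyps[OF this pb(1) h1] obtain ss where ss: "set ss \<subseteq> walls" "mirror ?h = walk ss" by blast
      have "mirror h x = walk (s # ss @ [s]) x" for x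
        using pb(3)[of "mirror s x"] mirror_mirror[OF sh(1)] ss(2) by simp
      then show ?thesis using ss(1) s(1) by (intro exI[of _ "s # ss @ [s]"]) (auto simp: fun_eq_iff)
    qed
  qed
  show ?thesis
  proof (cases "height h p > 0")
    case False
    then have "height (opposite h) p > 0" using regular_p[OF assms] opposite by (simp add: order.order_iff_strict)
    then show ?thesis using pos[of "opposite h"] opposite assms by metis
  qed (use pos assms in blast)
qed

lemma sign_change:
  assumes "P []" "\<not> P xs" shows "\<exists>us s vs. xs = us @ s # vs \<and> P us \<and> \<not> P (us @ [s])"
  using assms
proof (induction xs rule: rev_induct)
  case (snoc s xs)
  show ?case
  proof (cases "P xs")
    case True then show ?thesis using snoc by blast
  next
    case False
    then obtain us t vs where "xs = us @ t # vs \<and> P us \<and> \<not> P (us @ [t])" using snoc by blast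
    then show ?thesis by (intro exI[of _ us] exI[of _ t] exI[of _ "vs @ [s]"]) auto
  qed
qed auto

text \<open>
  The deletion argument.  Let the word be \<open>s # rest\<close>.  Along the prefixes of \<open>rest\<close> the images of
  \<open>p\<close> start on the positive side of \<open>s\<close> and end on the negative one, so some letter \<open>t\<close>, after a
  prefix \<open>us\<close>, is responsible for the change.  The preimage of \<open>s\<close> under \<open>us\<close> separates \<open>p\<close> from its
  mirror image in the wall \<open>t\<close>, hence equals \<open>t\<close>.  So the reflection in \<open>s\<close> composed with \<open>us\<close> is \<open>us\<close>
  composed with the reflection in \<open>t\<close>, and the letters \<open>s\<close> and \<open>t\<close> cancel.
\<close>
lemma wall_walk_eq_id:
  assumes "set ss \<subseteq> walls" "separators (walk ss p) = {}"
  shows "walk ss x = x"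
  using assms
proof (induction "length ss" arbitrary: ss x rule: less_induct)
  case less
  show ?case
  proof (cases ss)
    case (Cons s rest)
    have s: "s \<in> hyperplanes" "height s p > 0" "s \<in> walls" using less.prems Cons by (auto simp: walls_def)
    have rest: "set rest \<subseteq> walls" "set rest \<subseteq> hyperplanes" using less.prems Cons walls_hyperplanes by auto
    have nz: "height s (walk us p) \<noteq> 0" if "set us \<subseteq> hyperplanes" for us
      using pullback_walk[OF that s(1)] regular_p by metis
    have "\<not> height s (walk ss p) < 0"
    proof
      assume "height s (walk ss p) < 0"
      then have "s \<in> separators (walk ss p)" using s by (simp add: separators_def)
      then show False using less.prems(2) by simp
    qed
    then have "height s (walk rest p) < 0"
      using nz[OF rest(2)] height_mirror[OF s(1), of "walk rest p"] Cons by auto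
    then have "\<not> height s (walk rest p) > 0" by simp
    then obtain us t vs where dec: "rest = us @ t # vs" "height s (walk us p) > 0" "\<not> height s (walk (us @ [t]) p) > 0"
      using sign_change[of "\<lambda>us. height s (walk us p) > 0" rest] s(2) by auto
    have t: "t \<in> walls" "set us \<subseteq> hyperplanes" using rest dec by auto
    then have th: "t \<in> hyperplanes" using walls_hyperplanes by blast
    obtain h where h: "h \<in> hyperplanes" "\<And>x. height s (walk us x) = height h x"
      "\<And>x. mirror s (walk us x) = walk us (mirror h x)" using pullback_walk[OF t(2) s(1)] by auto
    have "h = t"
      using wall_mirror_positive[OF t(1) h(1)] dec(2,3) h(2) by auto
    then have "walk ss x = walk (us @ vs) x" for x
      using h(3) mirror_mirror[OF th] by (simp add: Cons dec(1))
    moreover have "walk (us @ vs) x = x" for x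
      using calculation less.prems Cons dec(1) by (intro less.hyps) auto
    ultimately show ?thesis by simp
  qed simp
qed

text \<open>
  Reflecting \<open>x\<close> in a wall that separates it from \<open>p\<close> lowers the number of separating hyperplanes:
  the reflection exchanges the two sides of the wall and permutes the other hyperplanes without
  changing the side on which \<open>p\<close> lies.
\<close>
lemma wall_walk_to_base:
  assumes "\<And>h. h \<in> hyperplanes \<Longrightarrow> height h x \<noteq> 0"
  shows "\<exists>ss. set ss \<subseteq> walls \<and> separators (walk ss x) = {}"
  using assms
proof (induction "card (separators x)" arbitrary: x rule: less_induct)
  case less
  show ?case
  proof (cases "separators x = {}")
    case True then show ?thesis by (intro exI[of _ "[]"]) auto
  next
    case False
    then obtain s where s: "s \<in> walls" "height s x < 0" using wall_separates by blast
    have sh: "s \<in> hyperplanes" "height s p > 0" using s by (auto simp: walls_def)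
    have inj: "inj_on (pullback s) hyperplanes"
    proof (rule inj_onI)
      fix h h' assume h: "h \<in> hyperplanes" "h' \<in> hyperplanes" "pullback s h = pullback s h'"
      have eq: "height h x = height h' x" for x
        using pullback(2)[OF sh(1) h(1), of "mirror s x"] pullback(2)[OF sh(1) h(2), of "mirror s x"] h(3) mirror_mirror[OF sh(1)] by simp
      from eq[of 0] have 2: "snd h = snd h'" by (simp add: height_def)
      with eq have "(fst h - fst h') \<bullet> y = 0" for y by (simp add: height_def inner_diff_left)
      then have "fst h = fst h'" by (metis inner_eq_zero_iff right_minus_eq)
      with 2 show "h = h'" by (simp add: prod_eq_iff)
    qed
    have sub: "pullback s ` separators (mirror s x) \<subseteq> separators x - {s}"
    proof (rule image_subsetI)
      fix h assume "h \<in> separators (mirror s x)"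
      then have h: "h \<in> hyperplanes" "height h p > 0" "height h (mirror s x) < 0" by (auto simp: separators_def)
      have "h \<noteq> s" using h(3) s(2) height_mirror[OF sh(1), of x] by auto
      then have "height h (mirror s p) > 0" using wall_mirror_positive[OF s(1) h(1,2)] by simp
      then have "pullback s h \<in> separators x" using h pullback[OF sh(1) h(1)] by (simp add: separators_def)
      moreover have "pullback s h \<noteq> s"
        using h(2) pullback(2)[OF sh(1) h(1), of "mirror s p"] mirror_mirror[OF sh(1)] height_mirror[OF sh(1), of p] sh(2) by auto
      ultimately show "pullback s h \<in> separators x - {s}" by simp
    qed
    have "separators (mirror s x) \<subseteq> hyperplanes" by (auto simp: separators_def)
    then have "card (separators (mirror s x)) = card (pullback s ` separators (mirror s x))"
      using inj by (metis card_image inj_on_subset)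
    also have "\<dots> \<le> card (separators x - {s})" using sub finite_separators by (intro card_mono) auto
    also have "\<dots> < card (separators x)" using s sh finite_separators by (intro card_Diff1_less) (auto simp: separators_def)
    finally obtain ss where "set ss \<subseteq> walls" "separators (walk ss (mirror s x)) = {}"
      using less.hyps[of "mirror s x"] less.prems pullback[OF sh(1)] by auto
    then show ?thesis using s(1) by (intro exI[of _ "ss @ [s]"]) auto
  qed
qed

end

section \<open>The affine Weyl group\<close>

lemma BijGroup_UNIV:
  "carrier (BijGroup UNIV) = {f. bij f}" "\<one>\<^bsub>BijGroup UNIV\<^esub> = id"
  "bij f \<Longrightarrow> bij g \<Longrightarrow> g \<otimes>\<^bsub>BijGroup UNIV\<^esub> f = g \<circ> f"
  by (auto simp: BijGroup_def Bij_def compose_def fun_eq_iff)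

context reduced_root_system
begin

lemma bij_reflection: "\<alpha> \<in> \<Phi> \<Longrightarrow> bij (root_reflection \<alpha>)"
  using reflection_involution by (intro o_bij[of "root_reflection \<alpha>"]) (auto simp: fun_eq_iff)

lemma weyl_group_subgroup: "subgroup (weyl_group \<Phi>) (BijGroup UNIV)"
  unfolding weyl_group_def
  by (intro group.generate_is_subgroup group_BijGroup) (auto simp: BijGroup_UNIV bij_reflection)

lemma weyl_bij: "w \<in> weyl_group \<Phi> \<Longrightarrow> bij w"
  using subgroup.mem_carrier[OF weyl_group_subgroup] by (simp add: BijGroup_UNIV)

lemma weyl_id: "id \<in> weyl_group \<Phi>"
  using subgroup.one_closed[OF weyl_group_subgroup] by (simp add: BijGroup_UNIV)

lemma weyl_comp: "v \<in> weyl_group \<Phi> \<Longrightarrow> w \<in> weyl_group \<Phi> \<Longrightarrow> v \<circ> w \<in> weyl_group \<Phi>"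
  using subgroup.m_closed[OF weyl_group_subgroup] by (simp add: BijGroup_UNIV weyl_bij)

lemma weyl_reflection: "\<alpha> \<in> \<Phi> \<Longrightarrow> root_reflection \<alpha> \<in> weyl_group \<Phi>"
  unfolding weyl_group_def by (intro generate.incl) auto

lemma weyl_inverse:
  assumes "w \<in> weyl_group \<Phi>" shows "\<exists>v\<in>weyl_group \<Phi>. v \<circ> w = id \<and> w \<circ> v = id"
proof -
  interpret G: group "BijGroup (UNIV :: (real ^ 'n) set)" by (rule group_BijGroup)
  have c: "w \<in> carrier (BijGroup UNIV)" using assms by (simp add: BijGroup_UNIV weyl_bij)
  let ?v = "inv\<^bsub>BijGroup UNIV\<^esub> w"
  have v: "?v \<in> weyl_group \<Phi>" using subgroup.m_inv_closed[OF weyl_group_subgroup assms] .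
  have "?v \<circ> w = id" "w \<circ> ?v = id"
    using G.l_inv[OF c] G.r_inv[OF c] weyl_bij[OF v] weyl_bij[OF assms] by (simp_all add: BijGroup_UNIV)
  then show ?thesis using v by blast
qed

text \<open>
  Reflections are their own inverses, so every element of the group is a word in reflections.
\<close>
lemma weyl_induct [consumes 1, case_names id reflection]:
  assumes "w \<in> weyl_group \<Phi>" "P id"
    and step: "\<And>\<alpha> w. \<alpha> \<in> \<Phi> \<Longrightarrow> w \<in> weyl_group \<Phi> \<Longrightarrow> P w \<Longrightarrow> P (root_reflection \<alpha> \<circ> w)"
  shows "P w"
proof -
  interpret G: group "BijGroup (UNIV :: (real ^ 'n) set)" by (rule group_BijGroup)
  have reflection_inv: "inv\<^bsub>BijGroup UNIV\<^esub> (root_reflection \<alpha>) = root_reflection \<alpha>" if "\<alpha> \<in> \<Phi>" for \<alpha>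
    using that reflection_involution bij_reflection
    by (intro G.inv_equality) (auto simp: BijGroup_UNIV fun_eq_iff)
  have "\<forall>u\<in>weyl_group \<Phi>. P u \<longrightarrow> P (w \<circ> u)"
    using assms(1) unfolding weyl_group_def
  proof (induction w rule: generate.induct)
    case one
    then show ?case by (simp add: BijGroup_UNIV)
  next
    case (incl h)
    then obtain \<alpha> where "\<alpha> \<in> \<Phi>" "h = root_reflection \<alpha>" by blast
    then show ?case using step by (metis weyl_group_def)
  next
    case (inv h)
    then obtain \<alpha> where "\<alpha> \<in> \<Phi>" "h = root_reflection \<alpha>" by blast
    then show ?case using step reflection_inv by (metis weyl_group_def)
  next
    case (eng v w)
    then have vw: "v \<in> weyl_group \<Phi>" "w \<in> weyl_group \<Phi>" by (simp_all add: weyl_group_def)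
    show ?case
    proof (intro ballI impI)
      fix u assume u: "u \<in> generate (BijGroup UNIV) (root_reflection ` \<Phi>)" "P u"
      then have "w \<circ> u \<in> weyl_group \<Phi>" using weyl_comp vw by (simp add: weyl_group_def)
      then have "P (v \<circ> (w \<circ> u))" using eng.IH u unfolding weyl_group_def by blast
      then show "P ((v \<otimes>\<^bsub>BijGroup UNIV\<^esub> w) \<circ> u)" using vw by (simp add: BijGroup_UNIV weyl_bij comp_assoc)
    qed
  qed
  then have "P (w \<circ> id)" using weyl_id assms(2) by blast
  then show ?thesis by simp
qed

lemma weyl_linear: "w \<in> weyl_group \<Phi> \<Longrightarrow> linear w"
proof (induction rule: weyl_induct)
  case id then show ?case by (rule linearI) auto
next
  case (reflection \<alpha> w) then show ?case using linear_compose linear_reflection by blast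
qed

lemma weyl_root: "w \<in> weyl_group \<Phi> \<Longrightarrow> \<alpha> \<in> \<Phi> \<Longrightarrow> w \<alpha> \<in> \<Phi>"
  by (induction rule: weyl_induct) (auto simp: reflection_root)

lemma weyl_lattice: "w \<in> weyl_group \<Phi> \<Longrightarrow> l \<in> real_lattice \<Longrightarrow> w l \<in> real_lattice"
  by (induction rule: weyl_induct) (auto simp: lattice_reflection)

text \<open>
  A linear map is determined by the permutation that it induces on the spanning set of roots.
\<close>
lemma finite_weyl_group: "finite (weyl_group \<Phi>)"
proof (rule inj_on_finite)
  show "inj_on (\<lambda>w. restrict w \<Phi>) (weyl_group \<Phi>)"
  proof (rule inj_onI)
    fix v w assume vw: "v \<in> weyl_group \<Phi>" "w \<in> weyl_group \<Phi>" "restrict v \<Phi> = restrict w \<Phi>"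
    have "v \<alpha> = w \<alpha>" if "\<alpha> \<in> \<Phi>" for \<alpha> using fun_cong[OF vw(3), of \<alpha>] that by simp
    then have "v x = w x" if "x \<in> span \<Phi>" for x
      using linear_eq_on_span[OF weyl_linear[OF vw(1)] weyl_linear[OF vw(2)]] that by blast
    then show "v = w" by (simp add: span_Phi fun_eq_iff)
  qed
  show "(\<lambda>w. restrict w \<Phi>) ` weyl_group \<Phi> \<subseteq> PiE \<Phi> (\<lambda>_. \<Phi>)" using weyl_root by auto
  show "finite (PiE \<Phi> (\<lambda>_. \<Phi>))" using finite_Phi by (simp add: finite_PiE)
qed

text \<open>
  Together with the next lemma: the affine reflections generate the semidirect product of the Weyl
  group and the lattice spanned by the coroots.
\<close>
lemma walk_affine:
  assumes "set hs \<subseteq> hyperplanes"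
  shows "\<exists>w\<in>weyl_group \<Phi>. \<exists>l\<in>real_lattice. \<forall>x. walk hs x = w x + l"
  using assms
proof (induction hs)
  case Nil
  then show ?case using weyl_id lattice_0 by (intro bexI[of _ id] bexI[of _ 0]) auto
next
  case (Cons h hs)
  then obtain w l where wl: "w \<in> weyl_group \<Phi>" "l \<in> real_lattice" "\<And>x. walk hs x = w x + l" by auto
  have h: "fst h \<in> \<Phi>" using Cons.prems by (auto simp: hyperplanes_def)
  have m: "mirror h y = root_reflection (fst h) y + of_int (snd h) *\<^sub>R coroot (fst h)" for y
    by (simp add: mirror_def root_reflection_eq height_def algebra_simps)
  have "walk (h # hs) x = (root_reflection (fst h) \<circ> w) x + (root_reflection (fst h) l + of_int (snd h) *\<^sub>R coroot (fst h))" for x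
    by (simp add: wl m linear_add[OF linear_reflection])
  moreover have "root_reflection (fst h) \<circ> w \<in> weyl_group \<Phi>" using wl h weyl_comp weyl_reflection by blast
  moreover have "root_reflection (fst h) l + of_int (snd h) *\<^sub>R coroot (fst h) \<in> real_lattice"
    using wl h lattice_add lattice_reflection lattice_coroot by blast
  ultimately show ?case by blast
qed

text \<open>
  Translation by a multiple \<open>k\<close> of a coroot is the product of the reflections in the parallel
  hyperplanes of levels \<open>k\<close> and \<open>0\<close>.
\<close>
lemma affine_walk:
  assumes "w \<in> weyl_group \<Phi>" "l \<in> real_lattice"
  shows "\<exists>hs. set hs \<subseteq> hyperplanes \<and> (\<forall>x. walk hs x = w x + l)"
proof -
  have mir: "mirror (\<alpha>, k) x = root_reflection \<alpha> x + of_int k *\<^sub>R coroot \<alpha>" for \<alpha> k x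
    by (simp add: mirror_def root_reflection_eq height_def algebra_simps)
  have 1: "\<exists>hs. set hs \<subseteq> hyperplanes \<and> (\<forall>x. walk hs x = w x)"
    using assms(1)
  proof (induction rule: weyl_induct)
    case id then show ?case by (intro exI[of _ "[]"]) auto
  next
    case (reflection \<alpha> w)
    then obtain hs where "set hs \<subseteq> hyperplanes" "\<forall>x. walk hs x = w x" by blast
    then show ?case using reflection by (intro exI[of _ "(\<alpha>, 0) # hs"]) (auto simp: mir hyperplanes_def)
  qed
  let ?T = "\<lambda>l. \<exists>hs. set hs \<subseteq> hyperplanes \<and> (\<forall>x. walk hs x = x + l)"
  have T0: "?T 0" by (intro exI[of _ "[]"]) auto
  have T_add: "?T (l + m)" if "?T l" "?T m" for l m
  proof -
    from that obtain hs hs' where "set hs \<subseteq> hyperplanes" "\<forall>x. walk hs x = x + l"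
      "set hs' \<subseteq> hyperplanes" "\<forall>x. walk hs' x = x + m" by blast
    then show ?thesis by (intro exI[of _ "hs @ hs'"]) (auto simp: algebra_simps)
  qed
  have T_coroot: "?T (of_int k *\<^sub>R coroot \<alpha>)" if "\<alpha> \<in> \<Phi>" for \<alpha> k
    using that reflection_involution
    by (intro exI[of _ "[(\<alpha>, k), (\<alpha>, 0)]"]) (auto simp: mir hyperplanes_def)
  have T_sum: "?T (sum f A)" if "finite A" "\<And>\<alpha>. \<alpha> \<in> A \<Longrightarrow> ?T (f \<alpha>)" for f and A :: "(real ^ 'n) set"
    using that by (induction A rule: finite_induct) (simp_all only: sum.empty sum.insert T0 T_add insert_iff simp_thms)
  obtain c where l: "l = (\<Sum>\<alpha>\<in>\<Phi>. real_of_int (c \<alpha>) *\<^sub>R coroot \<alpha>)" using assms(2) by (auto simp: real_lattice_def)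
  have "?T l" unfolding l by (intro T_sum finite_Phi T_coroot)
  with 1 obtain hs hs' where "set hs \<subseteq> hyperplanes" "\<forall>x. walk hs x = w x"
      "set hs' \<subseteq> hyperplanes" "\<forall>x. walk hs' x = x + l" by blast
  then show ?thesis by (intro exI[of _ "hs' @ hs"]) auto
qed

definition same_alcove :: "real ^ 'n \<Rightarrow> real ^ 'n \<Rightarrow> bool" where
  "same_alcove x y \<longleftrightarrow> (\<forall>h\<in>hyperplanes. height h x \<noteq> 0 \<and> height h y \<noteq> 0 \<and> (height h x > 0 \<longleftrightarrow> height h y > 0))"

lemma same_alcove_walk:
  assumes "set hs \<subseteq> hyperplanes" "same_alcove x y" shows "same_alcove (walk hs x) (walk hs y)"
  unfolding same_alcove_def
proof
  fix h assume "h \<in> hyperplanes"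
  from pullback_walk[OF assms(1) this] obtain h' where "h' \<in> hyperplanes" "\<forall>x. height h (walk hs x) = height h' x"
    by blast
  then show "height h (walk hs x) \<noteq> 0 \<and> height h (walk hs y) \<noteq> 0 \<and> (height h (walk hs x) > 0 \<longleftrightarrow> height h (walk hs y) > 0)"
    using assms(2) by (simp add: same_alcove_def)
qed

lemma same_alcove_affine:
  assumes "w \<in> weyl_group \<Phi>" "l \<in> real_lattice" "same_alcove x y"
  shows "same_alcove (w x + l) (w y + l)"
  using affine_walk[OF assms(1,2)] same_alcove_walk[OF _ assms(3)] by metis

lemma same_alcove_iff_floor:
  assumes "\<forall>\<alpha>\<in>\<Phi>. \<alpha> \<bullet> y \<notin> \<int>"
  shows "same_alcove x y \<longleftrightarrow> (\<forall>\<alpha>\<in>\<Phi>. \<alpha> \<bullet> x \<notin> \<int> \<and> \<lfloor>\<alpha> \<bullet> x\<rfloor> = \<lfloor>\<alpha> \<bullet> y\<rfloor>)"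
proof
  assume *: "same_alcove x y"
  show "\<forall>\<alpha>\<in>\<Phi>. \<alpha> \<bullet> x \<notin> \<int> \<and> \<lfloor>\<alpha> \<bullet> x\<rfloor> = \<lfloor>\<alpha> \<bullet> y\<rfloor>"
  proof
    fix \<alpha> assume "\<alpha> \<in> \<Phi>"
    then have h: "\<alpha> \<bullet> x \<noteq> of_int k" "of_int k < \<alpha> \<bullet> x \<longleftrightarrow> of_int k < \<alpha> \<bullet> y" for k
      using * by (auto simp: same_alcove_def hyperplanes_def height_def)
    have "\<alpha> \<bullet> x \<notin> \<int>" using h(1) by (auto elim: Ints_cases)
    moreover have "\<lfloor>\<alpha> \<bullet> x\<rfloor> = \<lfloor>\<alpha> \<bullet> y\<rfloor>"
    proof (rule antisym)
      have "of_int \<lfloor>\<alpha> \<bullet> x\<rfloor> < \<alpha> \<bullet> x" using h(1)[of "\<lfloor>\<alpha> \<bullet> x\<rfloor>"] by linarith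
      then show "\<lfloor>\<alpha> \<bullet> x\<rfloor> \<le> \<lfloor>\<alpha> \<bullet> y\<rfloor>" using h(2) by (simp add: le_floor_iff less_imp_le)
      have "\<alpha> \<bullet> y \<noteq> of_int \<lfloor>\<alpha> \<bullet> y\<rfloor>" using assms \<open>\<alpha> \<in> \<Phi>\<close> by (metis Ints_of_int)
      then have "of_int \<lfloor>\<alpha> \<bullet> y\<rfloor> < \<alpha> \<bullet> y" by linarith
      then show "\<lfloor>\<alpha> \<bullet> y\<rfloor> \<le> \<lfloor>\<alpha> \<bullet> x\<rfloor>" using h(2) by (simp add: le_floor_iff less_imp_le)
    qed
    ultimately show "\<alpha> \<bullet> x \<notin> \<int> \<and> \<lfloor>\<alpha> \<bullet> x\<rfloor> = \<lfloor>\<alpha> \<bullet> y\<rfloor>" by simp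
  qed
next
  assume *: "\<forall>\<alpha>\<in>\<Phi>. \<alpha> \<bullet> x \<notin> \<int> \<and> \<lfloor>\<alpha> \<bullet> x\<rfloor> = \<lfloor>\<alpha> \<bullet> y\<rfloor>"
  have "\<alpha> \<bullet> x \<noteq> of_int k \<and> \<alpha> \<bullet> y \<noteq> of_int k \<and> (of_int k < \<alpha> \<bullet> x \<longleftrightarrow> of_int k < \<alpha> \<bullet> y)" if "\<alpha> \<in> \<Phi>" for \<alpha> k
  proof -
    have "\<alpha> \<bullet> x \<noteq> of_int k" "\<alpha> \<bullet> y \<noteq> of_int k" using * assms that by (metis Ints_of_int)+
    moreover have "\<lfloor>\<alpha> \<bullet> x\<rfloor> = \<lfloor>\<alpha> \<bullet> y\<rfloor>" using * that by blast
    moreover have "of_int k < t \<longleftrightarrow> k \<le> \<lfloor>t\<rfloor>" if "t \<noteq> of_int k" for t :: real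
      using that unfolding le_floor_iff by linarith
    ultimately show ?thesis by simp
  qed
  then show "same_alcove x y" by (auto simp: same_alcove_def hyperplanes_def height_def)
qed

text \<open>
  Finitely many hyperplanes do not cover the space.  Scaling a point outside of them down makes all
  roots nonzero and smaller than \<open>1\<close> in absolute value there.
\<close>
lemma exists_regular_point: "\<exists>p. \<forall>\<alpha>\<in>\<Phi>. \<alpha> \<bullet> p \<notin> \<int>"
proof -
  have "negligible (\<Union>\<alpha>\<in>\<Phi>. {x. \<alpha> \<bullet> x = 0})"
    using finite_Phi zero_notin_Phi by (auto intro!: negligible_Union negligible_hyperplane)
  then have "(\<Union>\<alpha>\<in>\<Phi>. {x. \<alpha> \<bullet> x = 0}) \<noteq> UNIV" using non_negligible_UNIV by metis
  then obtain y where y: "\<And>\<alpha>. \<alpha> \<in> \<Phi> \<Longrightarrow> \<alpha> \<bullet> y \<noteq> 0" by auto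
  define N where "N = (\<Sum>\<alpha>\<in>\<Phi>. \<bar>\<alpha> \<bullet> y\<bar>) + 1"
  have N: "\<bar>\<alpha> \<bullet> y\<bar> < N" "N > 0" if "\<alpha> \<in> \<Phi>" for \<alpha>
    using member_le_sum[of \<alpha> \<Phi> "\<lambda>\<alpha>. \<bar>\<alpha> \<bullet> y\<bar>"] finite_Phi that unfolding N_def by (auto intro: add_nonneg_pos sum_nonneg)
  have "\<alpha> \<bullet> (y /\<^sub>R N) \<notin> \<int>" if "\<alpha> \<in> \<Phi>" for \<alpha>
  proof
    assume "\<alpha> \<bullet> (y /\<^sub>R N) \<in> \<int>"
    then obtain k where k: "\<alpha> \<bullet> (y /\<^sub>R N) = of_int k" by (auto elim: Ints_cases)
    then have "\<alpha> \<bullet> y = of_int k * N" using N[OF that] by (simp add: field_simps)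
    then have "\<bar>real_of_int k\<bar> * N < 1 * N" using N[OF that] by (simp add: abs_mult)
    then have "\<bar>real_of_int k\<bar> < 1" using N[OF that] by (simp only: mult_less_cancel_right_pos)
    then have "k = 0" by linarith
    then show False using k N[OF that] y[OF that] by simp
  qed
  then show ?thesis by blast
qed

end

context base_point
begin

lemma same_alcove_p:
  assumes "\<And>h. h \<in> hyperplanes \<Longrightarrow> height h x \<noteq> 0"
  shows "same_alcove x p \<longleftrightarrow> separators x = {}"
proof
  assume "same_alcove x p"
  then show "separators x = {}" by (auto simp: same_alcove_def separators_def)
next
  assume s: "separators x = {}"
  have pos: "height h x > 0" if h: "h \<in> hyperplanes" "height h p > 0" for h
  proof (rule ccontr)
    assume "\<not> height h x > 0"
    then have "h \<in> separators x" using assms h by (simp add: separators_def order.order_iff_strict not_less)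
    then show False using s by simp
  qed
  show "same_alcove x p"
    unfolding same_alcove_def
  proof
    fix h assume h: "h \<in> hyperplanes"
    show "height h x \<noteq> 0 \<and> height h p \<noteq> 0 \<and> (0 < height h x \<longleftrightarrow> 0 < height h p)"
      using assms[OF h] regular_p[OF h] pos[OF h] pos[OF opposite(1)[OF h]] unfolding opposite(2) by linarith
  qed
qed

lemma alcove_transitive:
  assumes "\<forall>\<alpha>\<in>\<Phi>. \<alpha> \<bullet> x \<notin> \<int>"
  shows "\<exists>w\<in>weyl_group \<Phi>. \<exists>l\<in>real_lattice. same_alcove (x + l) (w p)"
proof -
  have reg: "height h x \<noteq> 0" if "h \<in> hyperplanes" for h
    using assms that by (auto simp: height_def hyperplanes_def)
  then obtain ss where ss: "set ss \<subseteq> walls" "separators (walk ss x) = {}" using wall_walk_to_base by blast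
  have ssh: "set ss \<subseteq> hyperplanes" using ss walls_hyperplanes by blast
  have "height h (walk ss x) \<noteq> 0" if "h \<in> hyperplanes" for h
    using pullback_walk[OF ssh that] reg by metis
  then have sa: "same_alcove (walk ss x) p" using same_alcove_p ss by blast
  obtain w l where w: "w \<in> weyl_group \<Phi>" "l \<in> real_lattice" "\<And>x. walk ss x = w x + l"
    using walk_affine[OF ssh] by blast
  obtain v where v: "v \<in> weyl_group \<Phi>" "v \<circ> w = id" using weyl_inverse[OF w(1)] by blast
  have "same_alcove (v (w x + l) + 0) (v p + 0)"
    using sa unfolding w(3) by (rule same_alcove_affine[OF v(1) lattice_0])
  moreover have "v (w x + l) = x + v l"
    using v(2) linear_add[OF weyl_linear[OF v(1)]] by (simp add: fun_eq_iff)
  ultimately have "same_alcove (x + v l) (v p)" by simp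
  then show ?thesis using v(1) weyl_lattice[OF v(1) w(2)] by blast
qed

text \<open>
  An element of the affine Weyl group that maps the alcove of \<open>p\<close> to itself is a word in the walls
  of this alcove, hence trivial.
\<close>
lemma alcove_free:
  assumes "v \<in> weyl_group \<Phi>" "w \<in> weyl_group \<Phi>" "l \<in> real_lattice" "same_alcove (v p + l) (w p)"
  shows "v = w"
proof -
  obtain u where u: "u \<in> weyl_group \<Phi>" "u \<circ> w = id" "w \<circ> u = id" using weyl_inverse[OF assms(2)] by blast
  have "same_alcove (u (v p + l) + 0) (u (w p) + 0)" by (rule same_alcove_affine[OF u(1) lattice_0 assms(4)])
  moreover have "u (v p + l) = (u \<circ> v) p + u l" by (simp add: linear_add[OF weyl_linear[OF u(1)]])
  moreover have "u (w p) = p" using u(2) by (simp add: fun_eq_iff)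
  ultimately have sa: "same_alcove ((u \<circ> v) p + u l) p" by simp
  obtain hs where hs: "set hs \<subseteq> hyperplanes" "\<And>x. walk hs x = (u \<circ> v) x + u l"
    using affine_walk[OF weyl_comp[OF u(1) assms(1)] weyl_lattice[OF u(1) assms(3)]] by blast
  have "\<exists>ss. set ss \<subseteq> walls \<and> (\<forall>x. walk hs x = walk ss x)" using hs(1)
  proof (induction hs)
    case Nil then show ?case by (intro exI[of _ "[]"]) auto
  next
    case (Cons h hs)
    then obtain ss ss' where "set ss \<subseteq> walls" "\<forall>x. walk hs x = walk ss x" "set ss' \<subseteq> walls" "mirror h = walk ss'"
      using mirror_eq_wall_walk[of h] by auto
    then show ?case by (intro exI[of _ "ss' @ ss"]) auto
  qed
  then obtain ss where ss: "set ss \<subseteq> walls" "\<And>x. walk hs x = walk ss x" by blast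
  have "separators (walk ss p) = {}"
    using sa same_alcove_p[of "walk ss p"] unfolding ss(2)[symmetric] hs(2) by (auto simp: same_alcove_def)
  then have id: "(u \<circ> v) x + u l = x" for x using wall_walk_eq_id[OF ss(1)] ss(2) hs(2) by metis
  have "u l = 0" using id[of 0] linear_0[OF weyl_linear[OF u(1)]] linear_0[OF weyl_linear[OF assms(1)]] by simp
  then have "u \<circ> v = id" using id by (simp add: fun_eq_iff)
  then have "w \<circ> (u \<circ> v) = w" by simp
  then show "v = w" using u(3) by (simp add: comp_assoc[symmetric])
qed

end

section \<open>The torus in real coordinates\<close>

context reduced_root_system
begin

definition complex_point :: "(real ^ 'n) \<times> (real ^ 'n) \<Rightarrow> complex ^ 'n" where
  "complex_point z = (\<chi> i. Complex (fst z $ i) (snd z $ i))"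

text \<open>
  The projection to the torus in real coordinates, where the lattice acts on the first component.
\<close>
definition torus_point :: "(real ^ 'n) \<times> (real ^ 'n) \<Rightarrow> (complex ^ 'n) set" where
  "torus_point z = torus_proj \<Phi> (complex_point z)"

lemma coroot_lattice_eq: "coroot_lattice \<Phi> = complexify ` real_lattice"
  by (auto simp: coroot_lattice_def real_lattice_def)

lemma torus_point_eq_iff: "torus_point z = torus_point w \<longleftrightarrow> snd z = snd w \<and> fst z - fst w \<in> real_lattice"
proof -
  have add: "complex_point z + complexify l = complex_point (fst z + l, snd z)" for z l
    by (simp add: complex_point_def vec_eq_iff complexify_def complex_eq_iff)
  have inj: "complex_point z = complex_point w \<longleftrightarrow> z = w" for z w
    by (simp add: complex_point_def vec_eq_iff prod_eq_iff) blast
  have pt: "torus_point z = (\<lambda>l. complex_point (fst z + l, snd z)) ` real_lattice" for z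
    by (simp add: torus_point_def torus_proj_def coroot_lattice_eq image_image add)
  show ?thesis
  proof
    assume "torus_point z = torus_point w"
    moreover have "complex_point z \<in> torus_point z" unfolding pt using lattice_0 by (intro image_eqI[of _ _ 0]) auto
    ultimately obtain l where "l \<in> real_lattice" "complex_point z = complex_point (fst w + l, snd w)"
      unfolding pt by blast
    then have "l \<in> real_lattice" "z = (fst w + l, snd w)" by (simp_all only: inj)
    then show "snd z = snd w \<and> fst z - fst w \<in> real_lattice" by auto
  next
    have sub: "torus_point z \<subseteq> torus_point w" if *: "snd z = snd w" "fst z - fst w \<in> real_lattice" for z w
    proof
      fix t assume "t \<in> torus_point z"
      then obtain l where l: "l \<in> real_lattice" "t = complex_point (fst z + l, snd z)" unfolding pt by blast
      have "fst z + l = fst w + ((fst z - fst w) + l)" by simp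
      then have "t = complex_point (fst w + ((fst z - fst w) + l), snd w)" using l *(1) by (simp only:)
      then show "t \<in> torus_point w" unfolding pt using lattice_add[OF *(2) l(1)] by blast
    qed
    assume *: "snd z = snd w \<and> fst z - fst w \<in> real_lattice"
    moreover have "fst w - fst z \<in> real_lattice" using * lattice_minus[of "fst z - fst w"] by simp
    ultimately show "torus_point z = torus_point w" using sub[of z w] sub[of w z] by auto
  qed
qed

lemma quotient_torus_point: "quotient_map euclidean (torus \<Phi>) torus_point"
proof -
  let ?d = "\<lambda>z :: complex ^ 'n. ((\<chi> i. Re (z $ i)), (\<chi> i. Im (z $ i)))"
  have c: "continuous_on UNIV complex_point"
    unfolding complex_point_def[abs_def] Complex_eq by (intro continuous_intros)
  have d: "continuous_on UNIV ?d"
    by (intro continuous_intros)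
  have "homeomorphic_map euclidean euclidean complex_point"
    unfolding homeomorphic_map_maps homeomorphic_maps_def using c d
    by (intro exI[of _ ?d]) (auto simp: complex_point_def vec_eq_iff)
  then have "quotient_map euclidean euclidean complex_point" by (simp add: homeomorphic_map_def)
  from quotient_map_compose[OF this quotient_map_torus_proj, of \<Phi>]
  show ?thesis by (simp add: torus_point_def[abs_def] comp_def)
qed

lemma torus_point_vimage: "torus_point -` (torus_point ` A) = {(x, y). \<exists>l\<in>real_lattice. (x + l, y) \<in> A}"
proof -
  have "torus_point (x, y) \<in> torus_point ` A \<longleftrightarrow> (\<exists>l\<in>real_lattice. (x + l, y) \<in> A)" for x y
  proof
    assume "torus_point (x, y) \<in> torus_point ` A"
    then obtain z where "z \<in> A" "torus_point z = torus_point (x, y)" by (metis imageE)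
    then have "(x + (fst z - x), y) \<in> A" "fst z - x \<in> real_lattice" by (auto simp: torus_point_eq_iff)
    then show "\<exists>l\<in>real_lattice. (x + l, y) \<in> A" by blast
  next
    assume "\<exists>l\<in>real_lattice. (x + l, y) \<in> A"
    then obtain l where l: "l \<in> real_lattice" "(x + l, y) \<in> A" by blast
    have "torus_point (x, y) = torus_point (x + l, y)" using lattice_minus[OF l(1)] by (simp add: torus_point_eq_iff)
    then show "torus_point (x, y) \<in> torus_point ` A" using l by blast
  qed
  then show ?thesis by auto
qed

lemma topspace_torus_point: "topspace (torus \<Phi>) = range torus_point"
  using quotient_imp_surjective_map[OF quotient_torus_point] by simp

lemma open_torus_point_image:
  assumes "open A" shows "openin (torus \<Phi>) (torus_point ` A)"
proof -
  have "open (\<Union>l\<in>real_lattice. (\<lambda>z. z + (l, 0)) -` A)"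
    using assms by (intro open_UN ballI open_vimage continuous_intros)
  also have "(\<Union>l\<in>real_lattice. (\<lambda>z. z + (l, 0)) -` A) = torus_point -` (torus_point ` A)"
    unfolding torus_point_vimage by auto
  finally have "open (torus_point -` (torus_point ` A))" .
  moreover have "open (torus_point -` U) = openin (torus \<Phi>) U" if "U \<subseteq> range torus_point" for U
    using quotient_torus_point that unfolding quotient_map_def topspace_torus_point by (simp add: vimage_def)
  ultimately show ?thesis using image_mono[OF subset_UNIV] by metis
qed

definition euler_value :: "((real ^ 'n) \<times> (real ^ 'n)) set \<Rightarrow> int \<Rightarrow> bool" where
  "euler_value A e \<longleftrightarrow> has_euler_char (subtopology (torus \<Phi>) (torus_point ` A)) e"

lemma euler_value_empty: "euler_value {} 0"
  unfolding euler_value_def by (intro has_euler_char_empty) simp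

text \<open>
  The projection is open, so it maps \<open>K\<close> homeomorphically onto its image, and convex sets are
  contractible.
\<close>
lemma euler_value_cell:
  assumes "open K" "convex K" "K \<noteq> {}"
    and inj: "\<And>x y l. (x, y) \<in> K \<Longrightarrow> l \<in> real_lattice \<Longrightarrow> (x + l, y) \<in> K \<Longrightarrow> l = 0"
  shows "euler_value {(x + l, y) | x y l. (x, y) \<in> K \<and> l \<in> real_lattice} 1"
proof -
  have im: "torus_point ` {(x + l, y) | x y l. (x, y) \<in> K \<and> l \<in> real_lattice} = torus_point ` K"
  proof
    show "torus_point ` {(x + l, y) | x y l. (x, y) \<in> K \<and> l \<in> real_lattice} \<subseteq> torus_point ` K"
    proof clarify
      fix x y l assume "(x, y) \<in> K" "l \<in> real_lattice"
      then show "torus_point (x + l, y) \<in> torus_point ` K"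
        by (intro image_eqI[of _ _ "(x, y)"]) (auto simp: torus_point_eq_iff)
    qed
    show "torus_point ` K \<subseteq> torus_point ` {(x + l, y) | x y l. (x, y) \<in> K \<and> l \<in> real_lattice}"
      using lattice_0 by (intro image_mono) force
  qed
  have cont: "continuous_map euclidean (torus \<Phi>) torus_point"
    using quotient_torus_point by (rule quotient_imp_continuous_map)
  have "inj_on torus_point K"
  proof (rule inj_onI)
    fix z w assume zw: "z \<in> K" "w \<in> K" "torus_point z = torus_point w"
    then have "snd z = snd w" "fst z - fst w \<in> real_lattice" by (auto simp: torus_point_eq_iff)
    moreover from this have "(fst w + (fst z - fst w), snd w) = z" by (simp add: prod_eq_iff)
    with inj[of "fst w" "snd w" "fst z - fst w"] zw calculation have "fst z - fst w = 0"
      by (simp only: prod.collapse)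
    ultimately show "z = w" by (simp add: prod_eq_iff)
  qed
  moreover have "open_map (top_of_set K) (subtopology (torus \<Phi>) (torus_point ` K)) torus_point"
    unfolding open_map_def
  proof (intro allI impI)
    fix U assume "openin (top_of_set K) U"
    then have "open U" "U \<subseteq> K" using assms(1) by (auto simp: openin_open_eq)
    then show "openin (subtopology (torus \<Phi>) (torus_point ` K)) (torus_point ` U)"
      unfolding openin_subtopology
      by (intro exI[of _ "torus_point ` U"] conjI open_torus_point_image) (auto simp: Int_absorb2 image_mono)
  qed
  moreover have "continuous_map (top_of_set K) (subtopology (torus \<Phi>) (torus_point ` K)) torus_point"
    using cont by (simp add: continuous_map_in_subtopology continuous_map_from_subtopology)
  moreover have "torus_point ` K \<subseteq> topspace (torus \<Phi>)" by (auto simp: topspace_torus_point)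
  ultimately have "homeomorphic_map (top_of_set K) (subtopology (torus \<Phi>) (torus_point ` K)) torus_point"
    by (intro bijective_open_imp_homeomorphic_map) auto
  then have "top_of_set K homeomorphic_space subtopology (torus \<Phi>) (torus_point ` K)"
    by (rule homeomorphic_map_imp_homeomorphic_space)
  moreover have "has_euler_char (top_of_set K) 1"
    using assms by (intro has_euler_char_contractible) (auto simp: contractible_space_top_of_set convex_imp_contractible)
  ultimately show ?thesis
    unfolding euler_value_def im
    using has_euler_char_homotopy_equivalent homeomorphic_imp_homotopy_equivalent_space by blast
qed

text \<open>
  Periodicity ensures that the image of the intersection is the intersection of the images.
\<close>
lemma euler_value_Un:
  assumes "open A" "open B"
    and "\<And>x y l. (x, y) \<in> A \<Longrightarrow> l \<in> real_lattice \<Longrightarrow> (x + l, y) \<in> A"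
    and "\<And>x y l. (x, y) \<in> B \<Longrightarrow> l \<in> real_lattice \<Longrightarrow> (x + l, y) \<in> B"
    and "euler_value A a" "euler_value B b" "euler_value (A \<inter> B) c"
  shows "euler_value (A \<union> B) (a + b - c)"
proof -
  have "torus_point ` (A \<inter> B) = torus_point ` A \<inter> torus_point ` B"
  proof
    show "torus_point ` A \<inter> torus_point ` B \<subseteq> torus_point ` (A \<inter> B)"
    proof (rule subsetI)
      fix t assume "t \<in> torus_point ` A \<inter> torus_point ` B"
      then obtain z w where *: "z \<in> A" "w \<in> B" "t = torus_point z" "torus_point z = torus_point w" by auto
      then have "snd z = snd w" "fst z - fst w \<in> real_lattice" by (auto simp: torus_point_eq_iff)
      then have "z = (fst w + (fst z - fst w), snd w)" "(fst w + (fst z - fst w), snd w) \<in> B"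
        using assms(4)[of "fst w" "snd w" "fst z - fst w"] *(2) by (simp_all add: prod_eq_iff)
      then have "z \<in> B" by metis
      then show "t \<in> torus_point ` (A \<inter> B)" using * by auto
    qed
  qed auto
  then show ?thesis
    using has_euler_char_Un[of "torus \<Phi>" "torus_point ` A" "torus_point ` B" a b c] assms open_torus_point_image
    by (simp add: euler_value_def image_Un)
qed

text \<open>
  The character of \<open>\<alpha>\<close> at the image of \<open>x + iy\<close> is \<open>exp (2\<pi>i \<alpha>(x) - 2\<pi> \<alpha>(y))\<close>; its absolute value is \<open>1\<close>
  iff \<open>\<alpha>(y) = 0\<close>.
\<close>
lemma toric_complement_eq:
  "toric_complement \<Phi> = subtopology (torus \<Phi>) (torus_point ` {(x, y). \<forall>\<alpha>\<in>\<Phi>. \<alpha> \<bullet> y = 0 \<longrightarrow> \<alpha> \<bullet> x \<notin> \<int>})"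
proof -
  have ch: "root_character \<alpha> (torus_point z) = 1 \<longleftrightarrow> \<alpha> \<bullet> snd z = 0 \<and> \<alpha> \<bullet> fst z \<in> \<int>" if "\<alpha> \<in> \<Phi>" for \<alpha> z
  proof -
    have "root_functional \<alpha> (complex_point z) = Complex (\<alpha> \<bullet> fst z) (\<alpha> \<bullet> snd z)"
      by (simp add: root_functional_def complex_point_def inner_vec_def complex_eq_iff)
    then have "root_character \<alpha> (torus_point z) = exp (2 * of_real pi * \<i> * Complex (\<alpha> \<bullet> fst z) (\<alpha> \<bullet> snd z))"
      using root_character_torus_proj[OF root_system_roots that, of "complex_point z"] by (simp add: torus_point_def)
    also have "\<dots> = 1 \<longleftrightarrow> \<alpha> \<bullet> snd z = 0 \<and> (\<exists>k. \<alpha> \<bullet> fst z = of_int k)"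
      by (auto simp: exp_eq_1)
    finally show ?thesis by (auto simp: Ints_def)
  qed
  have "topspace (torus \<Phi>) - (\<Union>\<alpha>\<in>\<Phi>. root_hypersurface \<Phi> \<alpha>)
      = torus_point ` {(x, y). \<forall>\<alpha>\<in>\<Phi>. \<alpha> \<bullet> y = 0 \<longrightarrow> \<alpha> \<bullet> x \<notin> \<int>}"
    unfolding topspace_torus_point root_hypersurface_def using ch by force
  then show ?thesis by (simp add: toric_complement_def)
qed

end

section \<open>The Euler characteristic of the complement\<close>

context reduced_root_system
begin

lemma not_Ints_iff_height: "(\<forall>\<alpha>\<in>\<Phi>. \<alpha> \<bullet> x \<notin> \<int>) \<longleftrightarrow> (\<forall>h\<in>hyperplanes. height h x \<noteq> 0)"
proof
  assume *: "\<forall>h\<in>hyperplanes. height h x \<noteq> 0"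
  have "\<alpha> \<bullet> x \<noteq> of_int k" if "\<alpha> \<in> \<Phi>" for \<alpha> k
    using *[rule_format, of "(\<alpha>, k)"] that by (simp add: hyperplanes_def height_def)
  then show "\<forall>\<alpha>\<in>\<Phi>. \<alpha> \<bullet> x \<notin> \<int>" by (metis Ints_cases)
qed (auto simp: hyperplanes_def height_def)

lemma periodic_arrangement_torus: "periodic_arrangement real_lattice \<Phi> euler_value"
proof
  show "x = 0" if "\<And>\<alpha>. \<alpha> \<in> \<Phi> \<Longrightarrow> \<alpha> \<bullet> x = 0" for x using that by (rule separating)
  show "euler_value {(x + l, y) | x y l. (x, y) \<in> K \<and> l \<in> real_lattice} 1"
    if "open K" "convex K" "K \<noteq> {}"
      "\<And>x y l. (x, y) \<in> K \<Longrightarrow> l \<in> real_lattice \<Longrightarrow> (x + l, y) \<in> K \<Longrightarrow> l = 0" for K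
    using that by (rule euler_value_cell)
  show "euler_value (A \<union> B) (a + b - c)"
    if "open A" "open B"
      "\<And>x y l. (x, y) \<in> A \<Longrightarrow> l \<in> real_lattice \<Longrightarrow> (x + l, y) \<in> A"
      "\<And>x y l. (x, y) \<in> B \<Longrightarrow> l \<in> real_lattice \<Longrightarrow> (x + l, y) \<in> B"
      "euler_value A a" "euler_value B b" "euler_value (A \<inter> B) c" for A B a b c
    using that by (rule euler_value_Un)
qed (rule lattice_0 lattice_add lattice_minus finite_Phi uminus_Phi lattice_integral
    lattice_cocompact lattice_rational euler_value_empty; assumption?)+

text \<open>
  The images of \<open>p\<close> under the Weyl group represent the alcoves modulo the lattice, each exactly
  once.  So the real part of the complement has \<open>card (weyl_group \<Phi>)\<close> components in the torus.
\<close>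
theorem has_euler_char_toric_complement:
  "has_euler_char (toric_complement \<Phi>) ((-1) ^ CARD('n) * int (card (weyl_group \<Phi>)))"
proof -
  interpret P: periodic_arrangement real_lattice \<Phi> euler_value by (rule periodic_arrangement_torus)
  obtain p where p: "\<forall>\<alpha>\<in>\<Phi>. \<alpha> \<bullet> p \<notin> \<int>" using exists_regular_point by blast
  interpret base_point \<Phi> p
    by unfold_locales (use p not_Ints_iff_height in blast)
  have wp: "\<forall>\<alpha>\<in>\<Phi>. \<alpha> \<bullet> w p \<notin> \<int>" if "w \<in> weyl_group \<Phi>" for w
  proof -
    have "same_alcove p p" using regular_p by (simp add: same_alcove_def)
    from same_alcove_affine[OF that lattice_0 this] show ?thesis
      unfolding not_Ints_iff_height by (simp add: same_alcove_def)
  qed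
  have cell: "x \<in> P.cell \<Phi> (w p) \<longleftrightarrow> same_alcove x (w p)" if "w \<in> weyl_group \<Phi>" for w x
    unfolding same_alcove_iff_floor[OF wp[OF that]] by (auto simp: P.cell_def P.generic_def)
  have "euler_value (P.generic \<Phi> \<times> K) (int (card (weyl_group \<Phi>)))"
    if K: "open K" "convex K" "K \<noteq> {}" for K
  proof (rule P.euler_generic_alcoves[where p = "\<lambda>w. w p", OF finite_weyl_group _ _ _ K])
    show "w p \<in> P.generic \<Phi>" if "w \<in> weyl_group \<Phi>" for w using wp[OF that] by (simp add: P.generic_def)
    show "\<exists>w\<in>weyl_group \<Phi>. \<exists>l\<in>real_lattice. x + l \<in> P.cell \<Phi> (w p)" if "x \<in> P.generic \<Phi>" for x
    proof -
      have "\<forall>\<alpha>\<in>\<Phi>. \<alpha> \<bullet> x \<notin> \<int>" using that by (simp add: P.generic_def)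
      from alcove_transitive[OF this] show ?thesis using cell by blast
    qed
    show "v = w" if "v \<in> weyl_group \<Phi>" "w \<in> weyl_group \<Phi>" "l \<in> real_lattice" "v p + l \<in> P.cell \<Phi> (w p)" for v w l
      using alcove_free[OF that(1-3)] that(4) cell[OF that(2)] by blast
  qed
  from P.euler_complement[OF this] show ?thesis
    by (simp add: euler_value_def toric_complement_eq)
qed

end

theorem theorem16:
  fixes \<Phi> :: "(real ^ 'n) set"
  assumes "irreducible_root_system \<Phi>"
  shows "finite_betti (toric_complement \<Phi>) \<and>
         euler_characteristic (toric_complement \<Phi>) = (-1) ^ CARD('n) * int (card (weyl_group \<Phi>))"
proof -
  interpret reduced_root_system \<Phi> using assms by unfold_locales (simp add: irreducible_root_system_def)
  show ?thesis using has_euler_char_toric_complement by (simp add: has_euler_char_def)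
qed

end
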